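(* Let $\nu\in\mathbb{C}$ be fixed, with $\nu$ not a half-integer (i.e. $\nu-\tfrac12\notin\mathbb{Z}$), let $\vartheta=-\nu-\tfrac12$, and let $M$ be a positive integer. For $x>0$ let $m_o=m_o(x)$ be the optimal truncation index of the dominant series $\sum_k (-1)^k a_k(\nu)x^{-k}$, a positive integer satisfying $m_o\simeq 2x$, in the sense that $m_o-2x$ stays bounded as $x\to+\infty$. Then $$e^{-\pi\nu i}I_\nu(xe^{\pi i})=\frac{e^x}{\sqrt{2\pi x}}\sum_{k=0}^{m_o-1}\frac{(-1)^k a_k(\nu)}{x^k}+\frac{e^{-x}}{\sqrt{2\pi x}}\left\{\cos\pi\vartheta\sum_{k=0}^{M-1}\frac{a_k(\nu)}{x^k}-\frac{\sin\pi\vartheta}{\sqrt{\pi x}}\sum_{j=0}^{M-1}\frac{(-1)^jB_j}{(2x)^j}+O(x^{-M})\right\}$$ as $x\to+\infty$, where the coefficients $a_k(\nu)$ and $B_j$ (the latter depending on $\nu$ and on $m_o-2x$) are those defined in the context.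
   Context: $I_\nu(z)=(\tfrac12 z)^\nu\sum_{k=0}^\infty \dfrac{(z/2)^{2k}}{k!\,\Gamma(k+\nu+1)}$ is the modified Bessel function of the first kind; its value at $z=xe^{\pi i}$, $x>0$, is taken with $\arg z=\pi$, so that $I_\nu(xe^{\pi i})=e^{\pi\nu i}I_\nu(x)$. $(a)_k=\Gamma(a+k)/\Gamma(a)=a(a+1)\cdots(a+k-1)$ is the Pochhammer symbol, with $(a)_0=1$. Coefficients: for $k,j\ge 0$, $$a_k(\nu)=\frac{(-1)^k}{2^k k!}(\tfrac12+\nu)_k(\tfrac12-\nu)_k,\qquad A_j=\frac{(\tfrac12-\nu)_j(\tfrac12+\nu)_j}{j!}=(-2)^j a_j(\nu),$$ $$B_j=\sum_{k=0}^j(-2)^k(\tfrac12)_k\,A_{j-k}\,g_{2k}(j-k).$$ Here, with $\gamma_j=m_o-2x-j$ (a bounded quantity for each fixed $j$), the numbers $g_k(j)$ are defined by the expansion about $w=0$ $$\frac{\tau^{\gamma_j-1}}{1-\tau}\,\frac{d\tau}{dw}=-\frac1w+\sum_{k=0}^\infty g_k(j)w^k,\qquad \tfrac12w^2=\tau-\log\tau-1,$$ where the branch of $w(\tau)$ is chosen such that $w\sim\tau-1$ as $\tau\to1$, so that $\tau=1+w+\tfrac13w^2+\tfrac1{36}w^3-\cdots$. For example $g_0(j)=\tfrac23-\gamma_j$. The optimal truncation index means truncation of the series at, or near, its term of least magnitude; thus $m_o=2x+\alpha$ with $\alpha$ bounded (for instance $|\alpha|\le\tfrac12$). *)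

theory Defs
  imports "HOL-Complex_Analysis.Complex_Analysis" "HOL-Library.Landau_Symbols"
begin

(* "powr" uses the principal logarithm with -pi < arg <= pi, so on the negative real axis the
   value is the one with arg z = pi.  rGamma is the entire function 1/Gamma. *)
definition besselI :: "complex \<Rightarrow> complex \<Rightarrow> complex" where
  "besselI \<nu> z =
     (z / 2) powr \<nu> * (\<Sum>k. (z / 2) ^ (2 * k) / fact k * rGamma (of_nat k + \<nu> + 1))"

definition a_coeff :: "complex \<Rightarrow> nat \<Rightarrow> complex" where
  "a_coeff \<nu> k =
     (-1) ^ k / (2 ^ k * fact k) * pochhammer (1/2 + \<nu>) k * pochhammer (1/2 - \<nu>) k"

definition A_coeff :: "complex \<Rightarrow> nat \<Rightarrow> complex" where
  "A_coeff \<nu> j = pochhammer (1/2 - \<nu>) j * pochhammer (1/2 + \<nu>) j / fact j"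

(* The holomorphic branch of w^2/2 = tau - log tau - 1 near w = 0 with w ~ tau - 1.  Its germ
   at 0 is unique, and everything below depends only on that germ. *)
definition is_tau_branch :: "(complex \<Rightarrow> complex) \<Rightarrow> bool" where
  "is_tau_branch \<tau> \<longleftrightarrow>
     \<tau> analytic_on {0} \<and> \<tau> 0 = 1 \<and>
     (\<forall>\<^sub>F w in nhds 0. w ^ 2 / 2 = \<tau> w - Ln (\<tau> w) - 1) \<and>
     (\<lambda>w. w) \<sim>[at 0] (\<lambda>w. \<tau> w - 1)"

definition tau :: "complex \<Rightarrow> complex" where
  "tau = (SOME \<tau>. is_tau_branch \<tau>)"

(* g_k(j) for gamma_j = \<alpha> - j, where \<alpha> = m_o - 2x.  The expanded function has a simple pole
   with residue -1 at w = 0, so its coefficients of index k >= 0 are the g_k(j). *)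
definition g_coeff :: "real \<Rightarrow> nat \<Rightarrow> nat \<Rightarrow> complex" where
  "g_coeff \<alpha> k j =
     fls_nth
       (laurent_expansion
         (\<lambda>w. tau w powr (of_real (\<alpha> - real j) - 1) / (1 - tau w) * deriv tau w) 0)
       (int k)"

definition B_coeff :: "complex \<Rightarrow> real \<Rightarrow> nat \<Rightarrow> complex" where
  "B_coeff \<nu> \<alpha> j =
     (\<Sum>k\<le>j. (-2) ^ k * pochhammer (1/2) k * A_coeff \<nu> (j - k) * g_coeff \<alpha> (2 * k) (j - k))"

end

theory Submission
  imports Defs "HOL-Probability.Distributions"
begin

text \<open>
  Let \<open>p\<close> be one of \<open>1/2 - \<nu>\<close>, \<open>1/2 + \<nu>\<close> with \<open>Re p < 1\<close>.  Poisson's integral writes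
  \<open>I\<close> of order \<open>1/2 - p\<close> as a Laplace integral of \<open>(s (1 - s))\<^sup>-\<^sup>p\<close> over \<open>(0, 1)\<close>; expanding
  \<open>(1 - s)\<^sup>-\<^sup>p\<close> gives the dominant series.  The tail of that binomial series after \<open>n\<close> terms is a
  Stieltjes transform of a Beta density, so by Fubini the remainder is a Stieltjes transform of
  \<open>t\<^sup>n\<^sup>-\<^sup>1 exp (- 2 x t) \<Phi> (1 / (2 x t))\<close>, where \<open>\<Phi>\<close> is the rescaled Macdonald function, at a point \<open>z\<close>
  off the ray \<open>[0, \<infinity>)\<close>.  Averaging over \<open>z = 1 \<plusminus> i \<epsilon>\<close> and letting \<open>\<epsilon> \<rightarrow> 0\<close> splits the remainder
  exactly into a multiple of \<open>exp (- 2 x) \<Phi> (1 / (2 x))\<close> and a principal value integral with pole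
  at \<open>t = 1\<close>.  For the order \<open>p - 1/2\<close> one adds a multiple of the Macdonald function, which follows
  by analytic continuation from the symmetry \<open>\<Phi>\<^sub>p = \<Phi>\<^sub>1\<^sub>-\<^sub>p\<close> in the strip \<open>0 < Re p < 1\<close>.

  With \<open>n = 2 x + \<alpha>\<close> the saddle point of \<open>t\<^sup>n exp (- 2 x t)\<close> sits at the pole \<open>t = 1\<close>.  The substitution
  \<open>w\<^sup>2 / 2 = \<tau> - log \<tau> - 1\<close> turns the exponential factor into \<open>exp (- x w\<^sup>2)\<close>; the polar part
  \<open>- 1 / w\<close> is odd and drops out of the principal value, and Laplace's method applied to the regular
  part produces the coefficients \<open>g\<^sub>2\<^sub>k(j)\<close>, uniformly for bounded \<open>\<alpha>\<close>.
\<close>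

section \<open>Complex powers, holomorphic integrals, Gamma and Beta integrals\<close>

text \<open>The two choices of \<open>p\<close> share all algebraic data, because
  \<open>pochhammer p k * pochhammer (1 - p) k\<close> is symmetric under p -> 1 - p: the
  coefficients a_k and B_j are the same for both, only the sign in front of the cosine differs, and
  the connection formula corrects exactly that.

  The principal value is never a limit of truncated integrals. It is the limit of absolutely
  convergent integrals against the real part of 1 / (z - t), so that Fubini and dominated
  convergence suffice; the same sequence is evaluated in two ways, and the two limits are equated.

  The obstacle in the Laplace step is the pole: the error of the truncated expansion of \<Phi> gets
  divided by 1 - t, so a bound on its size is not enough. Its increments are estimated instead,
  which yields the missing factor 1 - t.

  Since \<alpha> = m_o - 2 x moves with x, the constants of the asymptotic estimates may depend on
  \<alpha> only through a bound for its modulus. This uniformity comes from Cauchy estimates on a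
  fixed circle, on which \<alpha> enters only as the exponent of a power of \<tau>.\<close>

text \<open>Only meant for \<open>t > 0\<close>; as \<open>ln 0 = 0\<close>, the junk value at \<open>t = 0\<close> is \<open>1\<close>.\<close>

definition rpow :: "real \<Rightarrow> complex \<Rightarrow> complex" where
  "rpow t a = exp (a * of_real (ln t))"

lemma rpow_eq_powr: "t > 0 \<Longrightarrow> rpow t a = of_real t powr a"
  by (simp add: rpow_def powr_def Ln_of_real)

lemma norm_rpow: "t > 0 \<Longrightarrow> norm (rpow t a) = t powr Re a"
  by (simp add: rpow_def powr_def mult.commute)

lemma rpow_add: "rpow t (a + b) = rpow t a * rpow t b"
  by (simp add: rpow_def ring_distribs exp_add)

lemma rpow_mult: "s > 0 \<Longrightarrow> t > 0 \<Longrightarrow> rpow (s * t) a = rpow s a * rpow t a"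
  by (simp add: rpow_def ln_mult ring_distribs exp_add)

lemma rpow_of_nat: "t > 0 \<Longrightarrow> rpow t (of_nat n) = of_real t ^ n"
  by (simp add: rpow_def exp_of_nat_mult exp_of_real)

lemma rpow_minus: "rpow t (- a) = inverse (rpow t a)"
  by (simp add: rpow_def exp_minus)

lemma rpow_diff: "rpow t (a - b) = rpow t a / rpow t b"
  by (simp add: rpow_def exp_diff left_diff_distrib)

lemma rpow_nonzero [simp]: "rpow t a \<noteq> 0"
  by (simp add: rpow_def)

lemma rpow_1 [simp]: "rpow 1 a = 1" and rpow_0_right [simp]: "rpow t 0 = 1"
  by (simp_all add: rpow_def)

lemma rpow_one_right [simp]: "t > 0 \<Longrightarrow> rpow t 1 = of_real t"
  using rpow_of_nat[of t 1] by simp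

lemma rpow_of_real: "t > 0 \<Longrightarrow> rpow t (of_real r) = of_real (t powr r)"
  by (simp add: rpow_def powr_def flip: exp_of_real)

lemma rpow_divide: "s > 0 \<Longrightarrow> t > 0 \<Longrightarrow> rpow (s / t) a = rpow s a / rpow t a"
  by (simp add: rpow_def ln_div ring_distribs exp_diff)

lemma borel_measurable_rpow [measurable]:
  "f \<in> borel_measurable M \<Longrightarrow> (\<lambda>x. rpow (f x) a) \<in> borel_measurable M"
  unfolding rpow_def by measurable

lemma holomorphic_on_rpow [holomorphic_intros]:
  "f holomorphic_on S \<Longrightarrow> (\<lambda>z. rpow t (f z)) holomorphic_on S"
  unfolding rpow_def by (intro holomorphic_intros)

lemma continuous_on_rpow [continuous_intros]:
  "continuous_on S f \<Longrightarrow> (\<And>x. x \<in> S \<Longrightarrow> f x > 0) \<Longrightarrow> continuous_on S (\<lambda>x. rpow (f x) a)"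
  unfolding rpow_def by (intro continuous_intros) force+

text \<open>No bound on the derivative is assumed. On a disc of half the radius Cauchy's inequality
  turns the dominating function \<open>g\<close> into the Lipschitz bound
  \<open>2 * g t / \<rho>\<close>, which dominates the difference quotients; dominated convergence
  along sequences then differentiates under the integral.\<close>

lemma holomorphic_on_integral:
  fixes f :: "complex \<Rightarrow> 'a \<Rightarrow> complex"
  assumes S: "open S"
    and hol: "\<And>t. t \<in> space M \<Longrightarrow> (\<lambda>z. f z t) holomorphic_on S"
    and meas: "\<And>z. z \<in> S \<Longrightarrow> f z \<in> borel_measurable M"
    and dom: "\<And>z0. z0 \<in> S \<Longrightarrow> \<exists>r>0. \<exists>g. integrable M g \<and>
        (\<forall>z\<in>ball z0 r \<inter> S. \<forall>t\<in>space M. norm (f z t) \<le> g t)"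
  shows "(\<lambda>z. \<integral>t. f z t \<partial>M) holomorphic_on S"
proof (rule holomorphic_onI)
  fix z0 assume z0: "z0 \<in> S"
  obtain r g where r: "r > 0" and g: "integrable M g"
    and bd: "\<And>z t. z \<in> ball z0 r \<inter> S \<Longrightarrow> t \<in> space M \<Longrightarrow> norm (f z t) \<le> g t"
    using dom[OF z0] by blast
  have "open (ball z0 r \<inter> S)" "z0 \<in> ball z0 r \<inter> S" using S r z0 by auto
  then obtain \<rho> where \<rho>: "\<rho> > 0" "cball z0 \<rho> \<subseteq> ball z0 r \<inter> S"
    using open_contains_cball by blast
  define B where "B = ball z0 (\<rho> / 2)"
  have BS: "B \<subseteq> ball z0 r \<inter> S" using \<rho> unfolding B_def by (force simp: subset_iff)
  have z0B: "z0 \<in> B" using \<rho> by (simp add: B_def)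
  have int: "integrable M (f z)" if "z \<in> ball z0 r \<inter> S" for z
    using that by (intro Bochner_Integration.integrable_bound[OF g] meas AE_I2)
      (use bd that in \<open>auto intro: order_trans[OF _ abs_ge_self]\<close>)
  have lip: "norm (f z t - f z0 t) \<le> 2 * g t / \<rho> * norm (z - z0)"
    if z: "z \<in> B" and t: "t \<in> space M" for z t
  proof (rule field_differentiable_bound[where S = B and f' = "deriv (\<lambda>z. f z t)"])
    show "convex B" by (simp add: B_def)
    show "z \<in> B" "z0 \<in> B" by fact+
    fix y assume y: "y \<in> B"
    have "(\<lambda>z. f z t) field_differentiable (at y)"
      using hol[OF t] y BS S by (meson IntD2 holomorphic_on_imp_differentiable_at subsetD)
    then show "((\<lambda>z. f z t) has_field_derivative deriv (\<lambda>z. f z t) y) (at y within B)"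
      by (simp add: field_differentiable_derivI has_field_derivative_at_within)
    have sub: "cball y (\<rho>/2) \<subseteq> cball z0 \<rho>"
    proof
      fix u assume "u \<in> cball y (\<rho>/2)"
      then have "dist z0 u \<le> \<rho>"
        using y dist_triangle[of z0 u y] by (auto simp: B_def)
      then show "u \<in> cball z0 \<rho>" by simp
    qed
    have "norm ((deriv ^^ 1) (\<lambda>z. f z t) y) \<le> fact 1 * g t / (\<rho>/2) ^ 1"
    proof (rule Cauchy_inequality)
      show "(\<lambda>z. f z t) holomorphic_on ball y (\<rho>/2)"
        using sub \<rho> ball_subset_cball by (intro holomorphic_on_subset[OF hol[OF t]]) blast
      show "continuous_on (cball y (\<rho>/2)) (\<lambda>z. f z t)"
        using sub \<rho> by (intro holomorphic_on_imp_continuous_on holomorphic_on_subset[OF hol[OF t]]) blast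
      fix x assume "norm (y - x) = \<rho>/2"
      then have "x \<in> cball y (\<rho>/2)" by (simp add: dist_norm)
      then show "norm (f x t) \<le> g t" using sub \<rho> bd t by blast
    qed (use \<rho> in auto)
    then show "norm (deriv (\<lambda>z. f z t) y) \<le> 2 * g t / \<rho>" by (simp add: field_simps)
  qed
  have "((\<lambda>z. ((\<integral>t. f z t \<partial>M) - (\<integral>t. f z0 t \<partial>M)) / (z - z0)) \<longlongrightarrow> (\<integral>t. deriv (\<lambda>z. f z t) z0 \<partial>M))
     (at z0 within B)"
    unfolding tendsto_at_iff_sequentially
  proof (intro allI impI)
    fix X :: "nat \<Rightarrow> complex" assume X: "\<forall>i. X i \<in> B - {z0}" and lim: "X \<longlonglongrightarrow> z0"
    have q: "(\<lambda>n. (f (X n) t - f z0 t) / (X n - z0)) \<longlonglongrightarrow> deriv (\<lambda>z. f z t) z0"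
      if t: "t \<in> space M" for t
    proof -
      have "(\<lambda>z. f z t) field_differentiable (at z0)"
        using hol[OF t] S z0 holomorphic_on_imp_differentiable_at by blast
      then have "((\<lambda>z. (f z t - f z0 t) / (z - z0)) \<longlongrightarrow> deriv (\<lambda>z. f z t) z0) (at z0)"
        using field_differentiable_derivI[of "\<lambda>z. f z t" z0] by (simp add: has_field_derivative_iff)
      moreover have "filterlim X (at z0) sequentially"
        using lim X by (simp add: filterlim_at)
      ultimately show ?thesis by (rule filterlim_compose)
    qed
    have m: "(\<lambda>t. (f (X n) t - f z0 t) / (X n - z0)) \<in> borel_measurable M" for n
      using X BS z0 by (intro borel_measurable_divide borel_measurable_diff meas) auto
    have "(\<lambda>n. \<integral>t. (f (X n) t - f z0 t) / (X n - z0) \<partial>M) \<longlonglongrightarrow> (\<integral>t. deriv (\<lambda>z. f z t) z0 \<partial>M)"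
    proof (rule integral_dominated_convergence)
      show "(\<lambda>t. deriv (\<lambda>z. f z t) z0) \<in> borel_measurable M"
        by (rule borel_measurable_LIMSEQ_metric[OF m q])
      show "integrable M (\<lambda>t. 2 * g t / \<rho>)" using g by auto
      show "AE t in M. (\<lambda>n. (f (X n) t - f z0 t) / (X n - z0)) \<longlonglongrightarrow> deriv (\<lambda>z. f z t) z0"
        using q by (intro AE_I2)
      fix n
      show "AE t in M. norm ((f (X n) t - f z0 t) / (X n - z0)) \<le> 2 * g t / \<rho>"
      proof (rule AE_I2)
        fix t assume "t \<in> space M"
        then show "norm ((f (X n) t - f z0 t) / (X n - z0)) \<le> 2 * g t / \<rho>"
          using lip[of "X n" t] X by (auto simp: norm_divide divide_le_eq)
      qed
    qed (rule m)
    moreover have "(\<lambda>n. \<integral>t. (f (X n) t - f z0 t) / (X n - z0) \<partial>M) = (\<lambda>n.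
        ((\<integral>t. f (X n) t \<partial>M) - (\<integral>t. f z0 t \<partial>M)) / (X n - z0))"
    proof
      fix n
      have "integrable M (f (X n))" "integrable M (f z0)" using X BS z0B by (auto intro!: int)
      then show "(\<integral>t. (f (X n) t - f z0 t) / (X n - z0) \<partial>M) =
        ((\<integral>t. f (X n) t \<partial>M) - (\<integral>t. f z0 t \<partial>M)) / (X n - z0)" by simp
    qed
    ultimately show "((\<lambda>z. ((\<integral>t. f z t \<partial>M) - (\<integral>t. f z0 t \<partial>M)) / (z - z0)) \<circ> X)
       \<longlonglongrightarrow> (\<integral>t. deriv (\<lambda>z. f z t) z0 \<partial>M)"
      by (simp add: o_def)
  qed
  then have "((\<lambda>z. \<integral>t. f z t \<partial>M) has_field_derivative (\<integral>t. deriv (\<lambda>z. f z t) z0 \<partial>M)) (at z0)"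
    unfolding has_field_derivative_iff at_within_open[OF z0B open_ball[of z0 "\<rho> / 2", folded B_def]] .
  from has_field_derivative_at_within[OF this]
  show "(\<lambda>z. \<integral>t. f z t \<partial>M) field_differentiable at z0 within S"
    unfolding field_differentiable_def by (rule exI)
qed

text \<open>Identity theorem: the positive reals accumulate at 1, an interior point of the
  half-plane.\<close>

lemma right_halfplane_eqI:
  fixes f g :: "complex \<Rightarrow> complex"
  assumes f: "f holomorphic_on {z. Re z > 0}" and g: "g holomorphic_on {z. Re z > 0}"
    and eq: "\<And>r::real. r > 0 \<Longrightarrow> f (of_real r) = g (of_real r)" and z: "Re z > 0"
  shows "f z = g z"
proof -
  have "(\<lambda>n. complex_of_real (1 + 1 / real (Suc n))) \<longlonglongrightarrow> of_real (1 + 0)"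
    by (intro tendsto_of_real tendsto_add tendsto_const LIMSEQ_Suc[OF lim_1_over_n])
  then have lim: "1 islimpt (complex_of_real ` {0<..})"
    unfolding islimpt_sequential
    by (intro exI[of _ "\<lambda>n. complex_of_real (1 + 1 / real (Suc n))"])
       (auto simp: add_pos_pos simp del: of_real_add intro!: imageI)
  have "f z - g z = 0"
  proof (rule analytic_continuation[where f = "\<lambda>z. f z - g z" and S = "{z. Re z > 0}"
        and U = "complex_of_real ` {0<..}" and \<xi> = 1])
    show "(\<lambda>z. f z - g z) holomorphic_on {z. Re z > 0}" by (intro holomorphic_intros f g)
    show "open {z. Re z > 0}" by (rule open_halfspace_Re_gt)
    show "connected {z. Re z > 0}" by (intro convex_connected convex_halfspace_Re_gt)
  qed (use eq z lim in auto)
  then show ?thesis by simp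
qed

section \<open>Gamma and Beta integrals with complex parameters\<close>

lemma Gamma_laplace:
  fixes a :: complex
  assumes "Re a > 0" "X > 0"
  shows set_integrable_Gamma_laplace: "set_integrable lborel {0<..} (\<lambda>t. rpow t (a - 1) * of_real (exp (- X * t)))"
    and set_integral_Gamma_laplace: "(LINT t:{0<..}|lborel. rpow t (a - 1) * of_real (exp (- X * t))) = Gamma a * rpow X (- a)"
proof -
  let ?f = "\<lambda>t. rpow t (a - 1) * of_real (exp (- t))"
  have e: "of_real t powr (a - 1) / of_real (exp t) = ?f t" if "t \<in> {0<..}" for t
    using that by (simp add: rpow_eq_powr exp_minus divide_inverse exp_of_real)
  have m: "?f \<in> borel_measurable borel" by measurable
  have "?f absolutely_integrable_on {0<..}"
    using absolutely_integrable_Gamma_integral'[of a] assms e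
    unfolding set_integrable_def by (subst Bochner_Integration.integrable_cong[OF HOL.refl, of _ _ "\<lambda>t. indicat_real {0<..} t *\<^sub>R (of_real t powr (a - 1) / of_real (exp t))"]) (auto simp: indicator_def)
  then have int: "set_integrable lborel {0<..} ?f"
    by (simp add: set_integrable_def integrable_completion m borel_measurable_indicator)
  have "(?f has_integral Gamma a) {0<..}"
    by (rule has_integral_eq[OF e Gamma_integral_complex'[OF assms(1)]])
  then have val: "(LINT t:{0<..}|lborel. ?f t) = Gamma a"
    using set_borel_integral_eq_integral[OF int] by (simp add: integral_unique)
  have ind: "indicat_real {0<..} (0 + X * x) = indicat_real {0<..} x" for x
    using assms by (auto simp: indicator_def zero_less_mult_iff)
  have eq: "indicat_real {0<..} (0 + X * x) *\<^sub>R ?f (0 + X * x) =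
     rpow X (a - 1) * (indicat_real {0<..} x *\<^sub>R (rpow x (a - 1) * of_real (exp (- X * x))))" for x
    unfolding ind using assms by (cases "x > 0") (simp_all add: rpow_mult)
  have int2: "integrable lborel (\<lambda>x. rpow X (a - 1) * (indicat_real {0<..} x *\<^sub>R (rpow x (a - 1) * of_real (exp (- X * x)))))"
    using lborel_integrable_real_affine[of _ X 0, OF int[unfolded set_integrable_def]] assms
    unfolding eq by simp
  show "set_integrable lborel {0<..} (\<lambda>t. rpow t (a - 1) * of_real (exp (- X * t)))"
    using integrable_mult_right[OF int2, of "inverse (rpow X (a - 1))"]
    unfolding set_integrable_def by (simp add: mult.assoc [symmetric])
  have "Gamma a = X *\<^sub>R (rpow X (a - 1) * (LINT t:{0<..}|lborel. rpow t (a - 1) * of_real (exp (- X * t))))"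
    unfolding val [symmetric] set_lebesgue_integral_def
    using assms by (subst lborel_integral_real_affine[of X _ 0]) (auto simp only: eq integral_mult_right_zero abs_of_pos)
  also have "\<dots> = rpow X a * (LINT t:{0<..}|lborel. rpow t (a - 1) * of_real (exp (- X * t)))"
    using assms by (simp add: rpow_diff scaleR_conv_of_real)
  finally show "(LINT t:{0<..}|lborel. rpow t (a - 1) * of_real (exp (- X * t))) = Gamma a * rpow X (- a)"
    by (simp add: rpow_minus)
qed

lemma set_integrable_Beta:
  assumes "Re a > 0" "Re b > 0"
  shows "set_integrable lborel {0<..<1} (\<lambda>y. rpow y (a - 1) * rpow (1 - y) (b - 1))"
proof -
  have "set_integrable lborel {0..1} (\<lambda>t. t powr (Re a - 1) * (1 - t) powr (Re b - 1))"
    using assms by (intro integrable_Beta)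
  then have "set_integrable lborel {0<..<1} (\<lambda>t. t powr (Re a - 1) * (1 - t) powr (Re b - 1))"
    by (rule set_integrable_subset) auto
  then show ?thesis
    by (rule set_integrable_bound)
       (auto simp: set_borel_measurable_def norm_mult norm_rpow)
qed

text \<open>The real Beta integral is continued in one parameter at a time: first in the first
  parameter with the other real and positive, then, after the reflection y -> 1 - y has exchanged
  the roles, in the remaining one.\<close>

lemma set_integral_Beta:
  assumes "Re a > 0" "Re b > 0"
  shows "(LINT y:{0<..<1}|lborel. rpow y (a - 1) * rpow (1 - y) (b - 1)) = Gamma a * Gamma b * rGamma (a + b)"
proof -
  define J where "J = (\<lambda>a b. LINT y:{0<..<1}|lborel. rpow y (a - 1) * rpow (1 - y) (b - 1))"
  have Jsym: "J a b = J b a" for a b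
    unfolding J_def set_lebesgue_integral_def
    by (subst lborel_integral_real_affine[of "-1" _ 1])
       (auto intro!: Bochner_Integration.integral_cong simp: indicator_def)
  have hol: "(\<lambda>a. J a b) holomorphic_on {z. Re z > 0}" if b: "Re b > 0" for b
    unfolding J_def set_lebesgue_integral_def
  proof (rule holomorphic_on_integral)
    show "open {z. Re z > 0}" by (rule open_halfspace_Re_gt)
    fix z0 :: complex assume "z0 \<in> {z. Re z > 0}"
    then have z0: "Re z0 > 0" by simp
    \<comment> \<open>On the disc of radius \<open>\<sigma>\<close> about \<open>z0\<close> the real
      part stays above \<open>\<sigma>\<close>, and for 0 < y < 1 the smaller exponent gives the
      larger power.\<close>
    define \<sigma> where "\<sigma> = Re z0 / 2"
    let ?g = "\<lambda>y. norm (indicat_real {0<..<1} y *\<^sub>R (rpow y (of_real \<sigma> - 1) * rpow (1 - y) (b - 1)))"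
    have "integrable lborel ?g"
      using set_integrable_Beta[of "of_real \<sigma>" b] b z0 unfolding set_integrable_def
      by (intro integrable_norm) (auto simp: \<sigma>_def)
    moreover have "norm (indicat_real {0<..<1} y *\<^sub>R (rpow y (z - 1) * rpow (1 - y) (b - 1))) \<le> ?g y"
      if z: "z \<in> ball z0 \<sigma>" for z y
    proof (cases "y \<in> {0<..<1}")
      case True
      have "\<bar>Re z0 - Re z\<bar> < \<sigma>"
        using z abs_Re_le_cmod[of "z0 - z"] by (simp add: dist_norm)
      then have "\<sigma> < Re z" unfolding \<sigma>_def by linarith
      then have "y powr (Re z - 1) \<le> y powr (\<sigma> - 1)"
        using True by (intro powr_mono') simp_all
      then show ?thesis using True by (simp add: norm_mult norm_rpow mult_right_mono)
    qed auto
    ultimately show "\<exists>r>0. \<exists>g. integrable lborel g \<and> (\<forall>z\<in>ball z0 r \<inter> {z. Re z > 0}. \<forall>t\<in>space lborel.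
       norm (indicat_real {0<..<1} t *\<^sub>R (rpow t (z - 1) * rpow (1 - t) (b - 1))) \<le> g t)"
      using z0 by (intro exI[of _ \<sigma>] exI[of _ ?g]) (auto simp: \<sigma>_def)
  qed (auto intro!: holomorphic_intros)
  let ?G = "\<lambda>a b. Gamma a * Gamma b * rGamma (a + b) :: complex"
  have holG: "(\<lambda>a. ?G a b) holomorphic_on {z. Re z > 0}" if "Re b > 0" for b
  proof -
    have "z \<notin> \<int>\<^sub>\<le>\<^sub>0" if "Re z > 0" for z :: complex
      using that by (auto elim!: nonpos_Ints_cases)
    then show ?thesis using that by (intro holomorphic_intros) auto
  qed
  have r: "J (of_real a) (of_real b) = ?G (of_real a) (of_real b)" if "a > 0" "b > 0" for a b :: real
  proof -
    have of1: "rpow t (of_real c - 1) = of_real (t powr (c - 1))" if "t > 0" for t c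
      using rpow_of_real[OF that, of "c - 1"] by simp
    have int: "set_integrable lborel {0<..<1} (\<lambda>t. t powr (a - 1) * (1 - t) powr (b - 1))"
      using that by (intro set_integrable_subset[OF integrable_Beta]) auto
    have "((\<lambda>t. t powr (a - 1) * (1 - t) powr (b - 1)) has_integral Beta a b) {0<..<1}"
      using has_integral_Beta_real[OF that] by (simp add: has_integral_Icc_iff_Ioo)
    then have "(LINT t:{0<..<1}|lborel. t powr (a - 1) * (1 - t) powr (b - 1)) = Beta a b"
      using set_borel_integral_eq_integral[OF int] by (simp add: integral_unique)
    moreover have "J (of_real a) (of_real b) = (LINT t:{0<..<1}|lborel. of_real (t powr (a - 1) * (1 - t) powr (b - 1)))"
      unfolding J_def by (intro set_lebesgue_integral_cong)
        (auto simp only: of1 greaterThanLessThan_iff diff_gt_0_iff_gt of_real_mult sets_lborel greaterThanLessThan_borel)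
    ultimately show ?thesis
      unfolding set_integral_complex_of_real
      by (simp add: Beta_altdef Gamma_complex_of_real flip: of_real_add rGamma_complex_of_real)
  qed
  have 1: "J a (of_real b) = ?G a (of_real b)" if "Re a > 0" "b > 0" for a b
    using r that by (intro right_halfplane_eqI[where f = "\<lambda>a. J a (of_real b)" and
      g = "\<lambda>a. ?G a (of_real b)" and z = a, OF hol holG]) auto
  have Gsym: "?G a b = ?G b a" for a b by (simp only: mult.commute[of "Gamma a"] add.commute[of a])
  have 2: "J b a = ?G b a" if "Re a > 0" "Re b > 0" for a b
  proof (rule right_halfplane_eqI[where f = "\<lambda>b. J b a", OF hol holG])
    fix r :: real assume "r > 0"
    then show "J (of_real r) a = ?G (of_real r) a"
      unfolding Jsym[of "of_real r" a] Gsym[of "of_real r" a] using that by (intro 1)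
  qed (use that in auto)
  show ?thesis using 2[OF assms(2,1)] unfolding J_def .
qed

section \<open>Poisson's integral\<close>

text \<open>The principal logarithm has argument pi on the negative axis, so the prefactor cancels
  precisely the phase of the power; the even powers in the series do not see the sign. What remains
  is the series of I at the positive point x.\<close>

lemma besselI_at_negative_real:
  assumes x: "x > 0"
  shows "exp (- of_real pi * \<nu> * \<i>) * besselI \<nu> (of_real x * exp (of_real pi * \<i>)) =
    rpow (x / 2) \<nu> * (\<Sum>k. of_real ((x / 2) ^ (2 * k) / fact k) * rGamma (of_nat k + \<nu> + 1))"
proof -
  have e: "of_real x * exp (of_real pi * \<i>) = - complex_of_real x"
    by (simp add: mult.commute[of "of_real pi"])
  have "Ln (- of_real (x / 2)) = of_real (ln (x / 2)) + \<i> * of_real pi"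
    using x Ln_of_real[of "x / 2"] by (subst Ln_minus) auto
  then have p: "(- of_real x / 2) powr \<nu> = rpow (x / 2) \<nu> * exp (of_real pi * \<nu> * \<i>)"
    using x by (simp add: powr_def rpow_def ring_distribs mult_ac add_ac flip: exp_add)
  have "(- complex_of_real x / 2) ^ (2 * k) = of_real ((x / 2) ^ (2 * k))" for k
    by (simp add: power_mult power_divide)
  then show ?thesis
    unfolding e besselI_def p by (simp add: exp_minus)
qed

lemma moment_integrable:
  assumes "Re b > 0"
  shows "set_integrable lborel {0<..<1} (\<lambda>s. of_real ((1 - 2 * s) ^ n) * (rpow s (b - 1) * rpow (1 - s) (b - 1)))"
proof (rule set_integrable_bound[OF set_integrable_Beta[OF assms assms]])
  show "AE s in lborel. s \<in> {0<..<1} \<longrightarrow> norm (of_real ((1 - 2 * s) ^ n) * (rpow s (b - 1) * rpow (1 - s) (b - 1)))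
     \<le> norm (rpow s (b - 1) * rpow (1 - s) (b - 1))"
  proof (intro AE_I2 impI)
    fix s :: real assume "s \<in> {0<..<1}"
    then have "\<bar>1 - 2 * s\<bar> ^ n \<le> 1" by (intro power_le_one) auto
    then have "norm (complex_of_real ((1 - 2 * s) ^ n)) \<le> 1" by (simp only: norm_of_real power_abs)
    from mult_right_mono[OF this, of "norm (rpow s (b - 1) * rpow (1 - s) (b - 1))"]
    show "norm (of_real ((1 - 2 * s) ^ n) * (rpow s (b - 1) * rpow (1 - s) (b - 1)))
     \<le> norm (rpow s (b - 1) * rpow (1 - s) (b - 1))" by (simp only: norm_mult) simp
  qed
qed (simp add: set_borel_measurable_def)

lemma odd_moment:
  assumes "odd n"
  shows "(LINT s:{0<..<1}|lborel. of_real ((1 - 2 * s) ^ n) * (rpow s (b - 1) * rpow (1 - s) (b - 1))) = 0"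
proof -
  let ?J = "LINT s:{0<..<1}|lborel. of_real ((1 - 2 * s) ^ n) * (rpow s (b - 1) * rpow (1 - s) (b - 1))"
  have "?J = (LINT s|lborel. indicator {0<..<1} (1 + -1 * s) *\<^sub>R (of_real ((1 - 2 * (1 + -1 * s)) ^ n) * (rpow (1 + -1 * s) (b - 1) * rpow (1 - (1 + -1 * s)) (b - 1))))"
    unfolding set_lebesgue_integral_def
    by (subst lborel_integral_real_affine[of "-1" _ 1]) simp_all
  also have "\<dots> = (LINT s|lborel. - (indicator {0<..<1} s *\<^sub>R (of_real ((1 - 2 * s) ^ n) * (rpow s (b - 1) * rpow (1 - s) (b - 1)))))"
  proof (rule Bochner_Integration.integral_cong[OF refl])
    fix s :: real
    have *: "1 - 2 * (1 + -1 * s) = - (1 - 2 * s)" by simp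
    have "(1 - 2 * (1 + -1 * s)) ^ n = - ((1 - 2 * s) ^ n)"
      unfolding * using assms by (rule power_minus_odd)
    then have 1: "complex_of_real ((1 - 2 * (1 + -1 * s)) ^ n) = - of_real ((1 - 2 * s) ^ n)"
      by (simp only: of_real_minus)
    have 2: "indicator {0<..<1} (1 + -1 * s) = indicat_real {0<..<1} s"
      by (auto simp: indicator_def)
    have 3: "1 - (1 + -1 * s) = s" by simp
    show "indicator {0<..<1} (1 + -1 * s) *\<^sub>R (of_real ((1 - 2 * (1 + -1 * s)) ^ n) * (rpow (1 + -1 * s) (b - 1) * rpow (1 - (1 + -1 * s)) (b - 1)))
      = - (indicator {0<..<1} s *\<^sub>R (of_real ((1 - 2 * s) ^ n) * (rpow s (b - 1) * rpow (1 - s) (b - 1))))"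
      unfolding 1 2 3 by (simp only: mult_minus_left mult_minus1 scaleR_minus_right mult_1_left mult.commute[of "rpow s (b - 1)"] minus_real_def)
  qed
  also have "\<dots> = - ?J" unfolding set_lebesgue_integral_def by simp
  finally show ?thesis by simp
qed

text \<open>Since (1 - 2 s)^2 = 1 - 4 s (1 - s), raising \<open>k\<close> by one costs a moment with
  \<open>b + 1\<close> in place of \<open>b\<close>; hence the induction with \<open>b\<close>
  arbitrary. The base case is the Beta integral combined with Legendre's duplication
  formula.\<close>

lemma even_moment:
  assumes "Re b > 0"
  shows "(LINT s:{0<..<1}|lborel. of_real ((1 - 2 * s) ^ (2 * k)) * (rpow s (b - 1) * rpow (1 - s) (b - 1)))
    = rpow 4 (1 - b) / 2 * Gamma (of_nat k + 1/2) * Gamma b * rGamma (of_nat k + 1/2 + b)"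
  using assms
proof (induction k arbitrary: b)
  case 0
  have b: "b \<notin> \<int>\<^sub>\<le>\<^sub>0" "b + 1/2 \<notin> \<int>\<^sub>\<le>\<^sub>0" "2 * b \<notin> \<int>\<^sub>\<le>\<^sub>0"
    using 0 by (auto elim!: nonpos_Ints_cases simp: complex_eq_iff)
  have "Gamma b * Gamma (b + 1/2) = rpow 4 (1 - b) / 2 * of_real (sqrt pi) * Gamma (2 * b)"
  proof -
    have "exp ((1 - 2 * b) * of_real (ln 2)) = rpow 4 (1 - b) / 2"
    proof -
      have l4: "ln 4 = 2 * ln (2::real)" using ln_realpow[of 2 2] by simp
      have "rpow 4 (1 - b) = exp ((1 - 2 * b) * of_real (ln 2) + of_real (ln 2))"
        unfolding rpow_def l4 by (simp add: algebra_simps)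
      also have "\<dots> = exp ((1 - 2 * b) * of_real (ln 2)) * 2"
        unfolding exp_add exp_of_real by simp
      finally show ?thesis by simp
    qed
    then show ?thesis using Gamma_legendre_duplication[of b] b by simp
  qed
  then have "Gamma b * rGamma (2 * b) = rpow 4 (1 - b) / 2 * of_real (sqrt pi) * rGamma (b + 1/2)"
    using b by (simp add: rGamma_inverse_Gamma field_simps Gamma_eq_zero_iff)
  then have "Gamma b * Gamma b * rGamma (b + b) = rpow 4 (1 - b) / 2 * of_real (sqrt pi) * Gamma b * rGamma (b + 1/2)"
    by (simp add: mult_ac)
  then show ?case
    using set_integral_Beta[OF 0 0] by (simp add: Gamma_one_half_complex add_ac)
next
  case (Suc k)
  let ?w = "\<lambda>b s. rpow s (b - 1) * rpow (1 - s) (b - 1)"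
  let ?N = "\<lambda>k b. LINT s:{0<..<1}|lborel. of_real ((1 - 2 * s) ^ (2 * k)) * ?w b s"
  have "?N (Suc k) b = (LINT s:{0<..<1}|lborel. of_real ((1 - 2 * s) ^ (2 * k)) * ?w b s -
      4 * (of_real ((1 - 2 * s) ^ (2 * k)) * ?w (b + 1) s))"
  proof (rule set_lebesgue_integral_cong)
    show "\<forall>s. s \<in> {0<..<1} \<longrightarrow> of_real ((1 - 2 * s) ^ (2 * Suc k)) * ?w b s = 
      of_real ((1 - 2 * s) ^ (2 * k)) * ?w b s - 4 * (of_real ((1 - 2 * s) ^ (2 * k)) * ?w (b + 1) s)"
    proof (intro allI impI)
      fix s :: real assume s: "s \<in> {0<..<1}"
      have w: "?w (b + 1) s = of_real (s * (1 - s)) * ?w b s"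
        using s rpow_add[of s 1 "b - 1"] rpow_add[of "1 - s" 1 "b - 1"] by simp
      have sq: "complex_of_real ((1 - 2 * s) ^ (2 * Suc k)) = of_real ((1 - 2 * s) ^ (2 * k)) * (1 - 4 * of_real (s * (1 - s)))"
        by (simp add: algebra_simps power2_eq_square)
      show "of_real ((1 - 2 * s) ^ (2 * Suc k)) * ?w b s = 
        of_real ((1 - 2 * s) ^ (2 * k)) * ?w b s - 4 * (of_real ((1 - 2 * s) ^ (2 * k)) * ?w (b + 1) s)"
        unfolding w sq by (simp only: algebra_simps mult_1_left)
    qed
  qed simp
  also have "\<dots> = ?N k b - 4 * ?N k (b + 1)"
    using moment_integrable[of b "2 * k"] moment_integrable[of "b + 1" "2 * k"] Suc.prems
    by (subst set_integral_diff) auto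
  also have "\<dots> = rpow 4 (1 - b) / 2 * Gamma (of_nat k + 1/2) * Gamma b * rGamma (of_nat k + 1/2 + b) -
     4 * (rpow 4 (1 - (b + 1)) / 2 * Gamma (of_nat k + 1/2) * Gamma (b + 1) * rGamma (of_nat k + 1/2 + (b + 1)))"
    using Suc.prems by (subst (1 2) Suc.IH) auto
  also have "rpow 4 (1 - (b + 1)) = rpow 4 (1 - b) / 4"
    using rpow_diff[of 4 "1 - b" 1] by (simp add: algebra_simps)
  also have "Gamma (b + 1) = b * Gamma b"
    using Suc.prems by (intro Gamma_plus1) (auto elim!: nonpos_Ints_cases)
  also have "rGamma (of_nat k + 1/2 + b) = (of_nat k + 1/2 + b) * rGamma (of_nat k + 1/2 + (b + 1))"
    using rGamma_plus1[of "of_nat k + 1/2 + b"] by (simp add: add_ac)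
  also have "rpow 4 (1 - b) / 2 * Gamma (of_nat k + 1/2) * Gamma b * ((of_nat k + 1/2 + b) * rGamma (of_nat k + 1/2 + (b + 1))) -
      4 * (rpow 4 (1 - b) / 4 / 2 * Gamma (of_nat k + 1/2) * (b * Gamma b) * rGamma (of_nat k + 1/2 + (b + 1))) =
      rpow 4 (1 - b) / 2 * ((of_nat k + 1/2) * Gamma (of_nat k + 1/2)) * Gamma b * rGamma (of_nat k + 1/2 + (b + 1))"
    by (simp add: algebra_simps)
  also have "(of_nat k + 1/2) * Gamma (of_nat k + 1/2) = Gamma (of_nat (Suc k) + 1/2 :: complex)"
  proof -
    have "of_nat k + 1/2 \<notin> (\<int>\<^sub>\<le>\<^sub>0 :: complex set)"
      by (auto elim!: nonpos_Ints_cases simp: complex_eq_iff)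
    from Gamma_plus1[OF this] show ?thesis by (simp add: add_ac)
  qed
  also have "of_nat k + 1/2 + (b + 1) = of_nat (Suc k) + 1/2 + b" by simp
  finally show ?case .
qed

text \<open>This quotient turns the coefficient 1 / (2 k)! of the exponential series into the 1 /
  (4^k k!) of the Bessel series.\<close>

lemma Gamma_half_over_fact:
  "Gamma (of_nat k + 1/2) / fact (2 * k) = (of_real (sqrt pi / (4 ^ k * fact k)) :: complex)"
proof (induction k)
  case 0 show ?case by (simp add: Gamma_one_half_complex)
next
  case (Suc k)
  have "of_nat k + 1/2 \<notin> (\<int>\<^sub>\<le>\<^sub>0 :: complex set)"
    by (auto elim!: nonpos_Ints_cases simp: complex_eq_iff)
  from Gamma_plus1[OF this]
  have "Gamma (of_nat (Suc k) + 1/2) / fact (2 * Suc k) =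
     (of_nat k + 1/2) / (of_nat (2 * k + 2) * of_nat (2 * k + 1)) * (Gamma (of_nat k + 1/2) / (fact (2 * k) :: complex))"
    by (simp add: add_ac)
  also have "(of_nat k + 1/2) / (of_nat (2 * k + 2) * of_nat (2 * k + 1)) = (1 / (4 * of_nat (Suc k)) :: complex)"
  proof -
    have 1: "of_nat (2 * k + 1) = (2 * (of_nat k + 1/2) :: complex)"
      and 2: "of_nat (2 * k + 2) = (2 * of_nat (Suc k) :: complex)"
      by simp_all
    have "of_nat k + 1/2 \<noteq> (0 :: complex)" by (auto simp: complex_eq_iff)
    moreover have "c / (2 * d * (2 * c)) = 1 / (4 * d)" if "c \<noteq> 0" for c d :: complex
      using that by simp
    ultimately show ?thesis unfolding 1 2 by blast
  qed
  finally show ?case by (simp add: Suc.IH)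
qed

text \<open>The kernel exp (x (1 - 2 s)) is expanded in powers of 1 - 2 s and integrated term by
  term: odd moments vanish by symmetry, even ones reproduce the Bessel series. Pulling out exp x
  leaves a Laplace integral with parameter 2 x. The condition on \<open>\<nu>\<close> makes the
  weight integrable at both ends.\<close>

lemma besselI_poisson:
  assumes x: "x > 0" and \<nu>: "Re \<nu> > - 1/2"
  defines "p \<equiv> 1/2 - \<nu>"
  shows "exp (- of_real pi * \<nu> * \<i>) * besselI \<nu> (of_real x * exp (of_real pi * \<i>)) =
    of_real (exp x / sqrt (2 * pi * x)) * (rpow (2 * x) (1 - p) * rGamma (1 - p) *
      (LINT s:{0<..<1}|lborel. of_real (exp (- (2 * x) * s)) * (rpow s (- p) * rpow (1 - s) (- p))))"
proof -
  define b where "b = \<nu> + 1/2"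
  have b: "Re b > 0" using \<nu> by (simp add: b_def)
  have pb: "- p = b - 1" "1 - p = b" by (simp_all add: p_def b_def)
  let ?w = "\<lambda>s. rpow s (b - 1) * rpow (1 - s) (b - 1)"
  let ?t = "\<lambda>n s. indicator {0<..<1} s *\<^sub>R (of_real (x ^ n / fact n) * (of_real ((1 - 2 * s) ^ n) * ?w s))"
  let ?N = "\<lambda>n. LINT s:{0<..<1}|lborel. of_real ((1 - 2 * s) ^ n) * ?w s"
  have int: "integrable lborel (?t n)" for n
    using set_integrable_mult_right[of "of_real (x ^ n / fact n)", OF moment_integrable[OF b, of n]]
    unfolding set_integrable_def by auto
  have bound: "norm (?t n s) \<le> x ^ n / fact n * norm (indicator {0<..<1} s *\<^sub>R ?w s)" for n s
  proof (cases "s \<in> {0<..<1}")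
    case True
    then have "\<bar>1 - 2 * s\<bar> ^ n \<le> 1" by (intro power_le_one) auto
    then have "norm (complex_of_real ((1 - 2 * s) ^ n)) \<le> 1" by (simp only: norm_of_real power_abs)
    from mult_right_mono[OF this, of "norm (?w s)"]
    have "norm (of_real ((1 - 2 * s) ^ n) * ?w s) \<le> norm (?w s)" by (simp only: norm_mult) simp
    from mult_left_mono[OF this, of "x ^ n / fact n"]
    show ?thesis using True x by (simp only: norm_scaleR norm_mult[of "of_real (x ^ n / fact n)"]) (simp add: norm_divide norm_power)
  qed auto
  have se: "summable (\<lambda>n. x ^ n / fact n)"
    using summable_exp[of x] by (simp add: field_simps)
  have wint: "integrable lborel (\<lambda>s. indicator {0<..<1} s *\<^sub>R ?w s)"
    using set_integrable_Beta[OF b b] by (simp add: set_integrable_def)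
  have sums: "(\<lambda>n. integral\<^sup>L lborel (?t n)) sums (\<integral>s. (\<Sum>n. ?t n s) \<partial>lborel)"
  proof (rule sums_integral[OF int])
    show "AE s in lborel. summable (\<lambda>n. norm (?t n s))"
    proof (rule AE_I2)
      fix s show "summable (\<lambda>n. norm (?t n s))"
        by (rule summable_comparison_test'[OF summable_mult2[OF se, of "norm (indicator {0<..<1} s *\<^sub>R ?w s)"], of 0])
           (use bound in auto)
    qed
    show "summable (\<lambda>n. \<integral>s. norm (?t n s) \<partial>lborel)"
    proof (rule summable_comparison_test'[OF summable_mult2[OF se, of "\<integral>s. norm (indicator {0<..<1} s *\<^sub>R ?w s) \<partial>lborel"], of 0])
      fix n :: nat
      have "(\<integral>s. norm (?t n s) \<partial>lborel) \<le> (\<integral>s. x ^ n / fact n * norm (indicator {0<..<1} s *\<^sub>R ?w s) \<partial>lborel)"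
        by (rule Bochner_Integration.integral_mono[OF integrable_norm[OF int] integrable_mult_right[OF integrable_norm[OF wint]] bound])
      then show "norm (\<integral>s. norm (?t n s) \<partial>lborel) \<le> x ^ n / fact n * (\<integral>s. norm (indicator {0<..<1} s *\<^sub>R ?w s) \<partial>lborel)"
        by (simp only: real_norm_def abs_of_nonneg[OF Bochner_Integration.integral_nonneg[OF norm_ge_zero]] integral_mult_right_zero)
    qed
  qed
  have ts: "(\<Sum>n. ?t n s) = of_real (exp x) * (indicator {0<..<1} s *\<^sub>R (of_real (exp (- (2 * x) * s)) * ?w s))" for s
  proof (cases "s \<in> {0<..<1}")
    case True
    have "(\<lambda>n. complex_of_real ((x * (1 - 2 * s)) ^ n /\<^sub>R fact n)) sums of_real (exp (x * (1 - 2 * s)))"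
      by (intro sums_of_real exp_converges)
    from sums_mult2[OF this, of "?w s"]
    moreover have "of_real ((x * (1 - 2 * s)) ^ n /\<^sub>R fact n) * ?w s = ?t n s" for n
    proof -
      have "(x * (1 - 2 * s)) ^ n /\<^sub>R fact n = x ^ n / fact n * (1 - 2 * s) ^ n"
        by (simp add: power_mult_distrib divide_inverse)
      then show ?thesis using True by (simp only: of_real_mult mult.assoc) simp
    qed
    ultimately have "(\<lambda>n. ?t n s) sums (of_real (exp (x * (1 - 2 * s))) * ?w s)" by (simp only:)
    moreover have "exp (x * (1 - 2 * s)) = exp x * exp (- (2 * x) * s)"
      by (simp add: algebra_simps flip: exp_add)
    ultimately show ?thesis using True by (simp add: sums_iff mult.assoc)
  qed auto
  have te: "integral\<^sup>L lborel (?t n) = of_real (x ^ n / fact n) * ?N n" for n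
    unfolding set_lebesgue_integral_def
    by (subst integral_mult_right_zero [symmetric]) (simp only: mult_scaleR_right)
  let ?J = "LINT s:{0<..<1}|lborel. of_real (exp (- (2 * x) * s)) * ?w s"
  have Jeq: "(\<integral>s. (\<Sum>n. ?t n s) \<partial>lborel) = of_real (exp x) * ?J"
    unfolding ts set_lebesgue_integral_def by (rule integral_mult_right_zero)
  have "(\<lambda>n. of_real (x ^ n / fact n) * ?N n) sums (of_real (exp x) * ?J)"
    using sums unfolding Jeq te .
  then have "(\<lambda>k. of_real (x ^ (2 * k) / fact (2 * k)) * ?N (2 * k)) sums (of_real (exp x) * ?J)"
  proof (subst (asm) sums_mono_reindex[of "\<lambda>k. 2 * k", symmetric])
    fix n :: nat assume "n \<notin> range ((*) 2)"
    then have "odd n" by (auto elim!: evenE)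
    from odd_moment[OF this, of b] show "of_real (x ^ n / fact n) * ?N n = 0" by simp
  qed (auto simp: strict_mono_def)
  moreover have "of_real (x ^ (2 * k) / fact (2 * k)) * ?N (2 * k) =
     rpow 4 (1 - b) / 2 * of_real (sqrt pi) * Gamma b * (of_real ((x / 2) ^ (2 * k) / fact k) * rGamma (of_nat k + \<nu> + 1))" for k
  proof -
    have "of_real (x ^ (2 * k) / fact (2 * k)) * ?N (2 * k) =
      rpow 4 (1 - b) / 2 * Gamma b * rGamma (of_nat k + 1/2 + b) * of_real (x ^ (2 * k)) * (Gamma (of_nat k + 1/2) / fact (2 * k))"
      unfolding even_moment[OF b] by (simp add: field_simps)
    also have "\<dots> = rpow 4 (1 - b) / 2 * of_real (sqrt pi) * Gamma b * (of_real ((x / 2) ^ (2 * k) / fact k) * rGamma (of_nat k + 1/2 + b))"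
      unfolding Gamma_half_over_fact by (simp add: power_mult power_divide)
    also have "of_nat k + 1/2 + b = of_nat k + \<nu> + 1" by (simp add: b_def)
    finally show ?thesis .
  qed
  ultimately have *: "(\<lambda>k. rpow 4 (1 - b) / 2 * of_real (sqrt pi) * Gamma b * (of_real ((x / 2) ^ (2 * k) / fact k) * rGamma (of_nat k + \<nu> + 1)))
     sums (of_real (exp x) * ?J)" by simp
  have nz: "Gamma b \<noteq> 0" "b \<notin> \<int>\<^sub>\<le>\<^sub>0"
    using b by (auto simp: Gamma_eq_zero_iff elim!: nonpos_Ints_cases)
  define C where "C = rpow 4 (1 - b) / 2 * of_real (sqrt pi) * Gamma b"
  have C: "C \<noteq> 0" using nz by (simp add: C_def)
  have "(\<lambda>k. C * (of_real ((x / 2) ^ (2 * k) / fact k) * rGamma (of_nat k + \<nu> + 1))) sums (C * (of_real (exp x) * ?J / C))"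
    using * C unfolding C_def by simp
  then have "(\<lambda>k. of_real ((x / 2) ^ (2 * k) / fact k) * rGamma (of_nat k + \<nu> + 1)) sums (of_real (exp x) * ?J / C)"
    using C by (simp only: sums_mult_iff simp_thms)
  then have "exp (- of_real pi * \<nu> * \<i>) * besselI \<nu> (of_real x * exp (of_real pi * \<i>)) = rpow (x / 2) \<nu> * (of_real (exp x) * ?J / C)"
    unfolding besselI_at_negative_real[OF x] by (simp only: sums_iff)
  also have "\<dots> = of_real (exp x / sqrt (2 * pi * x)) * (rpow (2 * x) b * rGamma b * ?J)"
  proof -
    have "rpow (2 * x) b = rpow (x / 2) \<nu> * rpow 4 \<nu> * rpow (2 * x) (1/2)"
      using x rpow_mult[of "x/2" 4 \<nu>] by (simp add: b_def rpow_add)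
    moreover have "rpow (2 * x) (1/2) = of_real (sqrt (2 * x))"
      using rpow_of_real[of "2 * x" "1/2"] x by (simp add: powr_half_sqrt)
    \<comment> \<open>As \<open>b = \<nu> + 1/2\<close>, the exponents add up to 1/2. The factor
      left over by the duplication formula thus cancels against the one that converts the power of
      \<open>x / 2\<close> into one of \<open>2 * x\<close>.\<close>
    moreover have "rpow 4 (1 - b) * rpow 4 \<nu> = 2"
      using rpow_add[of 4 "1 - b" \<nu>] rpow_of_real[of 4 "1/2"] by (simp add: b_def powr_half_sqrt)
    then have "rpow 4 \<nu> = 2 / rpow 4 (1 - b)" by (simp add: field_simps)
    ultimately show ?thesis
      using nz x by (simp add: C_def rGamma_inverse_Gamma real_sqrt_mult field_simps)
  qed
  finally show ?thesis unfolding pb .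
qed

section \<open>The tail of the binomial series\<close>

text \<open>Here the principal branch of (1 - s)^(-p) is holomorphic in s, and so is 1 / (1 - s y)
  for every y in [0, 1].\<close>

abbreviation cut_plane :: "complex set" where
  "cut_plane \<equiv> - (complex_of_real ` {1..})"

lemma closed_of_real_ray: "closed (complex_of_real ` {a..})"
proof -
  have "complex_of_real ` {a..} = {z. Im z = 0} \<inter> {z. Re z \<ge> a}"
    by (auto simp: complex_eq_iff image_iff intro!: exI[of _ "Re _"])
  then show ?thesis
    by (auto intro!: closed_Int closed_halfspace_Re_ge closed_Collect_eq continuous_intros)
qed

lemma open_cut_plane: "open cut_plane"
  using closed_of_real_ray by auto

lemma connected_cut_plane: "connected cut_plane"
proof -
  have "starlike cut_plane"
    unfolding starlike_def
  proof (intro bexI ballI subsetI)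
    show "0 \<in> cut_plane" by auto
    fix s u assume s: "s \<in> cut_plane" and u: "u \<in> closed_segment 0 s"
    obtain t where t: "0 \<le> t" "t \<le> 1" "u = of_real t * s"
      using u by (auto simp: closed_segment_def scaleR_conv_of_real)
    show "u \<in> cut_plane"
    proof
      assume "u \<in> complex_of_real ` {1..}"
      then obtain r where r: "r \<ge> 1" "u = of_real r" by auto
      then have "t \<noteq> 0" using t by auto
      then have "s = of_real (r / t)" using r t by (simp add: field_simps)
      moreover have "r / t \<ge> 1" using r t \<open>t \<noteq> 0\<close> by (simp add: field_simps)
      ultimately show False using s by blast
    qed
  qed
  then show ?thesis by (rule starlike_imp_connected)
qed

lemma one_minus_mult_nonzero:
  assumes "s \<in> cut_plane" "0 \<le> y" "y \<le> 1"
  shows "1 - s * of_real y \<noteq> 0"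
proof
  assume *: "1 - s * of_real y = 0"
  then have "y \<noteq> 0" by auto
  then have "s = of_real (1 / y)" using * by (simp add: field_simps)
  moreover have "1 / y \<ge> 1" using assms \<open>y \<noteq> 0\<close> by (simp add: field_simps)
  ultimately show False using assms(1) by blast
qed

lemma cut_plane_resolvent_bound:
  assumes "s0 \<in> cut_plane"
  obtains r K where "r > 0" "ball s0 r \<subseteq> cut_plane" "K > 0"
    "\<And>s y. s \<in> ball s0 r \<Longrightarrow> 0 \<le> y \<Longrightarrow> y \<le> 1 \<Longrightarrow> norm (1 / (1 - s * of_real y)) \<le> K"
proof -
  obtain r where r: "r > 0" "cball s0 r \<subseteq> cut_plane"
    using open_cut_plane assms open_contains_cball by blast
  have "compact ((\<lambda>(s, y). 1 / (1 - s * of_real y)) ` (cball s0 r \<times> {0..1::real}))"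
    using r one_minus_mult_nonzero
    by (intro compact_continuous_image compact_Times continuous_on_divide continuous_intros)
       (auto simp: case_prod_unfold subset_iff intro!: continuous_intros)
  then obtain K where "K > 0" "\<And>z. z \<in> (\<lambda>(s, y). 1 / (1 - s * of_real y)) ` (cball s0 r \<times> {0..1::real}) \<Longrightarrow> norm z \<le> K"
    using compact_imp_bounded bounded_pos by metis
  moreover have "1 / (1 - s * of_real y) \<in> (\<lambda>(s, y). 1 / (1 - s * of_real y)) ` (cball s0 r \<times> {0..1::real})"
    if "s \<in> ball s0 r" "0 \<le> y" "y \<le> 1" for s y
    using that by (intro image_eqI[of _ _ "(s, y)"]) auto
  moreover have "ball s0 r \<subseteq> cut_plane" using r ball_subset_cball[of s0 r] by (rule_tac subset_trans)
  ultimately show ?thesis using r by (intro that[of r K]) blast+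
qed

lemma Gamma_pochhammer_eq:
  assumes "p \<notin> \<int>"
  shows "Gamma (p + of_nat n) = pochhammer p n * Gamma (p :: complex)"
  using assms by (subst pochhammer_Gamma) (auto simp: Gamma_eq_zero_iff elim: nonpos_Ints_cases)

text \<open>For |s| < 1 the geometric series is integrated term by term, and the Beta integrals are
  the binomial coefficients up to the constant Gamma (p) Gamma (1 - p) = pi / sin (pi p). Both sides
  are holomorphic on the connected cut plane, so the identity extends beyond the disc of
  convergence. The two conditions on \<open>Re p\<close> are integrability at y = 1 and at y =
  0.\<close>

lemma binomial_tail_integral:
  fixes p :: complex
  assumes p: "p \<notin> \<int>" "Re p < 1" "Re p + real n > 0" and s: "s \<in> cut_plane"
  shows "s ^ n * (LINT y:{0<..<1}|lborel. rpow y (p + of_nat n - 1) * rpow (1 - y) (- p) * (1 / (1 - s * of_real y)))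
     = of_real pi / sin (of_real pi * p) * ((1 - s) powr (- p) - (\<Sum>k<n. pochhammer p k / fact k * s ^ k))"
proof -
  let ?w = "\<lambda>y. rpow y (p + of_nat n - 1) * rpow (1 - y) (- p)"
  have "(\<lambda>y. rpow y ((p + of_nat n) - 1) * rpow (1 - y) ((1 - p) - 1)) = ?w" by simp
  with set_integrable_Beta[of "p + of_nat n" "1 - p"]
  have wint: "set_integrable lborel {0<..<1} ?w" using p by simp
  define J where "J = (\<lambda>s. LINT y:{0<..<1}|lborel. ?w y * (1 / (1 - s * of_real y)))"
  let ?G = "\<lambda>s. of_real pi / sin (of_real pi * p) * ((1 - s) powr (- p) - (\<Sum>k<n. pochhammer p k / fact k * s ^ k))"
  have holJ: "J holomorphic_on cut_plane"
    unfolding J_def set_lebesgue_integral_def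
  proof (rule holomorphic_on_integral[OF open_cut_plane])
    fix y :: real
    show "(\<lambda>s. indicator {0<..<1} y *\<^sub>R (?w y * (1 / (1 - s * of_real y)))) holomorphic_on cut_plane"
    proof (cases "y \<in> {0<..<1}")
      case True
      have "(\<lambda>s. ?w y * (1 / (1 - s * of_real y))) holomorphic_on cut_plane"
        using True one_minus_mult_nonzero by (intro holomorphic_intros) auto
      then show ?thesis using True by simp
    qed simp
  next
    fix s0 assume "s0 \<in> cut_plane"
    then obtain r K where rK: "r > 0" "ball s0 r \<subseteq> cut_plane" "K > 0"
      "\<And>s y. s \<in> ball s0 r \<Longrightarrow> 0 \<le> y \<Longrightarrow> y \<le> 1 \<Longrightarrow> norm (1 / (1 - s * of_real y)) \<le> K"
      by (rule cut_plane_resolvent_bound) blast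
    let ?g = "\<lambda>y. norm (indicator {0<..<1} y *\<^sub>R ?w y) * K"
    have "integrable lborel ?g"
      using wint unfolding set_integrable_def by (intro integrable_mult_left integrable_norm)
    moreover have "norm (indicator {0<..<1} y *\<^sub>R (?w y * (1 / (1 - s * of_real y)))) \<le> ?g y"
      if "s \<in> ball s0 r" for s y
    proof (cases "y \<in> {0<..<1}")
      case True
      then have "norm (?w y) * norm (1 / (1 - s * of_real y)) \<le> norm (?w y) * K"
        by (intro mult_left_mono rK(4)[OF that]) auto
      then show ?thesis using True by (simp add: norm_mult norm_divide)
    qed simp
    ultimately show "\<exists>r>0. \<exists>g. integrable lborel g \<and> (\<forall>s\<in>ball s0 r \<inter> cut_plane. \<forall>y\<in>space lborel.
       norm (indicator {0<..<1} y *\<^sub>R (?w y * (1 / (1 - s * of_real y)))) \<le> g y)"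
      using rK(1) by (intro exI[of _ r] exI[of _ ?g] conjI ballI) blast+
  qed simp
  have holG: "?G holomorphic_on cut_plane"
  proof -
    have "1 - s \<notin> \<real>\<^sub>\<le>\<^sub>0" if "s \<in> cut_plane" for s
    proof
      assume "1 - s \<in> \<real>\<^sub>\<le>\<^sub>0"
      then obtain r where "r \<le> 0" "1 - s = of_real r" by (auto elim: nonpos_Reals_cases)
      then have "s = of_real (1 - r)" "1 - r \<ge> 1" by (simp_all add: algebra_simps)
      then show False using that by blast
    qed
    moreover have "sin (of_real pi * p) \<noteq> 0"
    proof
      assume "sin (of_real pi * p) = 0"
      then obtain k :: int where "of_real pi * p = of_real (of_int k * pi)"
        unfolding sin_eq_0 by (auto simp: mult_ac)
      then have "p = of_int k" by (simp add: field_simps)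
      then show False using p by simp
    qed
    ultimately show ?thesis by (intro holomorphic_intros) auto
  qed
  have small: "s ^ n * J s = ?G s" if s: "norm s < 1" for s
  proof -
    have "norm s = \<bar>norm s\<bar>" by simp
    let ?t = "\<lambda>k y. indicator {0<..<1} y *\<^sub>R (s ^ k * (rpow y (p + of_nat (n + k) - 1) * rpow (1 - y) (- p)))"
    have teq: "?t k y = indicator {0<..<1} y *\<^sub>R (?w y * (s * of_real y) ^ k)" for k y
    proof (cases "y \<in> {0<..<1}")
      case True
      have "rpow y (p + of_nat (n + k) - 1) = rpow y (p + of_nat n - 1) * of_real y ^ k"
        using True rpow_add[of y "p + of_nat n - 1" "of_nat k"] rpow_of_nat[of y k] by (simp add: algebra_simps)
      then show ?thesis by (simp add: power_mult_distrib)
    qed simp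
    have int: "integrable lborel (?t k)" for k
    proof -
      have "set_integrable lborel {0<..<1} (\<lambda>y. s ^ k * (rpow y (p + of_nat (n + k) - 1) * rpow (1 - y) ((1 - p) - 1)))"
        using p by (intro set_integrable_mult_right set_integrable_Beta) auto
      then show ?thesis unfolding set_integrable_def by simp
    qed
    have bound: "norm (?t k y) \<le> norm s ^ k * norm (indicator {0<..<1} y *\<^sub>R ?w y)" for k y
    proof (cases "y \<in> {0<..<1}")
      case True
      then have "norm (s * of_real y) ^ k \<le> norm s ^ k"
        by (intro power_mono) (auto simp: norm_mult mult_left_le)
      then show ?thesis unfolding teq using True by (simp add: norm_mult norm_power mult_left_mono mult.commute)
    qed simp
    have sg: "summable (\<lambda>k. norm s ^ k)" using s by (simp add: summable_geometric)
    have sums: "(\<lambda>k. integral\<^sup>L lborel (?t k)) sums (\<integral>y. (\<Sum>k. ?t k y) \<partial>lborel)"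
    proof (rule sums_integral[OF int])
      show "AE y in lborel. summable (\<lambda>k. norm (?t k y))"
      proof (rule AE_I2)
        fix y show "summable (\<lambda>k. norm (?t k y))"
          by (rule summable_comparison_test'[OF summable_mult2[OF sg, of "norm (indicator {0<..<1} y *\<^sub>R ?w y)"], of 0])
             (use bound in auto)
      qed
      have wi: "integrable lborel (\<lambda>y. norm (indicator {0<..<1} y *\<^sub>R ?w y))"
        using wint unfolding set_integrable_def by (rule integrable_norm)
      show "summable (\<lambda>k. \<integral>y. norm (?t k y) \<partial>lborel)"
      proof (rule summable_comparison_test'[OF summable_mult2[OF sg, of "\<integral>y. norm (indicator {0<..<1} y *\<^sub>R ?w y) \<partial>lborel"], of 0])
        fix k :: nat
        have "(\<integral>y. norm (?t k y) \<partial>lborel) \<le> (\<integral>y. norm s ^ k * norm (indicator {0<..<1} y *\<^sub>R ?w y) \<partial>lborel)"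
          by (rule Bochner_Integration.integral_mono[OF integrable_norm[OF int] integrable_mult_right[OF wi] bound])
        then show "norm (\<integral>y. norm (?t k y) \<partial>lborel) \<le> norm s ^ k * (\<integral>y. norm (indicator {0<..<1} y *\<^sub>R ?w y) \<partial>lborel)"
          by (simp only: real_norm_def abs_of_nonneg[OF Bochner_Integration.integral_nonneg[OF norm_ge_zero]] integral_mult_right_zero)
      qed
    qed
    have "(\<Sum>k. ?t k y) = indicator {0<..<1} y *\<^sub>R (?w y * (1 / (1 - s * of_real y)))" for y
    proof (cases "y \<in> {0<..<1}")
      case True
      then have "norm (s * of_real y) < 1"
        using s mult_strict_mono[of "norm s" 1 y 1] by (simp add: norm_mult)
      from sums_mult[OF geometric_sums[OF this], of "?w y"] show ?thesis
        unfolding teq using True by (simp add: sums_iff)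
    qed simp
    then have 1: "(\<integral>y. (\<Sum>k. ?t k y) \<partial>lborel) = J s"
      unfolding J_def set_lebesgue_integral_def by simp
    \<comment> \<open>The Beta value is Gamma (p + m) Gamma (1 - p) / m! with m = n + k; extracting
      (p)_m leaves the reflection constant, which is independent of m.\<close>
    have 2: "integral\<^sup>L lborel (?t k) = of_real pi / sin (of_real pi * p) * (pochhammer p (n + k) / fact (n + k)) * s ^ k" for k
    proof -
      have "integral\<^sup>L lborel (?t k) = (LINT y:{0<..<1}|lborel. s ^ k * (rpow y ((p + of_nat (n + k)) - 1) * rpow (1 - y) ((1 - p) - 1)))"
        unfolding set_lebesgue_integral_def by (intro Bochner_Integration.integral_cong) simp_all
      also have "\<dots> = s ^ k * (Gamma (p + of_nat (n + k)) * Gamma (1 - p) * rGamma (of_nat (n + k) + 1))"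
        using p by (subst set_integral_mult_right, subst set_integral_Beta) (auto simp: add_ac)
      also have "\<dots> = s ^ k * (pochhammer p (n + k) * (Gamma p * Gamma (1 - p)) / fact (n + k))"
        unfolding Gamma_pochhammer_eq[OF p(1)] rGamma_inverse_Gamma
        by (subst add.commute[of _ 1], subst Gamma_fact) (simp add: field_simps)
      finally show ?thesis by (simp add: Gamma_reflection_complex)
    qed
    have "(\<lambda>k. ((- p) gchoose k) * (- s) ^ k) sums (1 + - s) powr (- p)"
      using s by (intro gen_binomial_complex) auto
    moreover have "((- p) gchoose k) * (- s) ^ k = pochhammer p k / fact k * s ^ k" for k
    proof -
      have "(-1) ^ k * (-1) ^ k = (1 :: complex)" by (simp flip: power_mult_distrib)
      then show ?thesis by (simp add: gbinomial_pochhammer power_minus[of s k])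
    qed
    ultimately have b: "(\<lambda>k. pochhammer p k / fact k * s ^ k) sums (1 - s) powr (- p)" by simp
    have "(\<lambda>k. pochhammer p (k + n) / fact (k + n) * s ^ (k + n)) sums ((1 - s) powr (- p) - (\<Sum>k<n. pochhammer p k / fact k * s ^ k))"
      using sums_split_initial_segment[OF b] by simp
    from sums_mult[OF this, of "of_real pi / sin (of_real pi * p)"]
    have "(\<lambda>k. s ^ n * integral\<^sup>L lborel (?t k)) sums ?G s"
      unfolding 2 by (simp add: power_add mult_ac add_ac)
    moreover have "(\<lambda>k. s ^ n * integral\<^sup>L lborel (?t k)) sums (s ^ n * J s)"
      using sums unfolding 1 by (rule sums_mult)
    ultimately show ?thesis by (rule sums_unique2[symmetric])
  qed
  have sub: "ball 0 1 \<subseteq> cut_plane" by auto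
  have "s ^ n * J s - ?G s = 0"
  proof (rule analytic_continuation_open[of "ball 0 1" cut_plane "\<lambda>s. s ^ n * J s - ?G s" "\<lambda>_. 0"])
    show "(\<lambda>s. s ^ n * J s - ?G s) holomorphic_on cut_plane"
      by (intro holomorphic_on_diff holomorphic_on_mult holJ holG holomorphic_intros)
  qed (use small s sub open_cut_plane connected_cut_plane in auto)
  then show ?thesis by (simp add: J_def)
qed

section \<open>The remainder as a principal value\<close>

text \<open>\<open>Phi p (1 / (2 * x))\<close> is \<open>sqrt (2 * x / pi) * exp x * K x\<close> for the Macdonald function \<open>K\<close> of
  order \<open>1/2 - p\<close>.\<close>

definition Phi :: "complex \<Rightarrow> real \<Rightarrow> complex" where
  "Phi p y = rGamma (1 - p) *
     (LINT v:{0<..}|lborel. of_real (exp (- v)) * rpow v (- p) * rpow (1 + v * y) (- p))"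

lemma Gamma_nonzero_right_halfplane: "Re z > 0 \<Longrightarrow> Gamma (z :: complex) \<noteq> 0"
  by (auto simp: Gamma_eq_zero_iff elim!: nonpos_Ints_cases)

section \<open>Integrability and growth under exponential weights\<close>

lemma set_integrable_Gamma_weight:
  assumes "Re a > 0" "X > 0"
  shows "set_integrable lborel {0<..} (\<lambda>v. rpow v (a - 1) * of_real (exp (- X * v) * (1 + v) ^ N))"
  using assms
proof (induction N arbitrary: a)
  case 0 then show ?case using set_integrable_Gamma_laplace[of a X] by simp
next
  case (Suc N)
  have "set_integrable lborel {0<..} (\<lambda>v. rpow v (a - 1) * of_real (exp (- X * v) * (1 + v) ^ N)
     + rpow v (a + 1 - 1) * of_real (exp (- X * v) * (1 + v) ^ N))"
    using Suc.prems by (intro set_integral_add Suc.IH) auto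
  then show ?case
  proof (rule set_integrable_cong[THEN iffD1, rotated 3])
    fix v :: real assume "v \<in> {0<..}"
    then have "rpow v (a + 1 - 1) = rpow v (a - 1) * of_real v"
      using rpow_add[of v "a - 1" 1] by simp
    then show "rpow v (a - 1) * of_real (exp (- X * v) * (1 + v) ^ N)
     + rpow v (a + 1 - 1) * of_real (exp (- X * v) * (1 + v) ^ N) = rpow v (a - 1) * of_real (exp (- X * v) * (1 + v) ^ Suc N)"
      by (simp add: algebra_simps)
  qed simp_all
qed

lemma norm_rpow_one_plus_le:
  assumes "u \<ge> 0" "- Re p \<le> real N"
  shows "norm (rpow (1 + u) (- p)) \<le> (1 + u) ^ N"
proof -
  have "norm (rpow (1 + u) (- p)) = (1 + u) powr (- Re p)"
    using assms by (subst norm_rpow) auto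
  also have "\<dots> \<le> (1 + u) powr real N" using assms by (intro powr_mono) auto
  finally show ?thesis using assms by (simp add: powr_realpow)
qed

lemma norm_rpow_one_plus_mult_le:
  assumes "v \<ge> 0" "y \<ge> 0" "- Re p \<le> real N"
  shows "norm (rpow (1 + v * y) (- p)) \<le> (1 + v) ^ N * (1 + y) ^ N"
proof -
  have "norm (rpow (1 + v * y) (- p)) \<le> (1 + v * y) ^ N"
    using assms by (intro norm_rpow_one_plus_le) auto
  also have "\<dots> \<le> ((1 + v) * (1 + y)) ^ N"
    using assms by (intro power_mono) (auto simp: algebra_simps)
  finally show ?thesis by (simp add: power_mult_distrib)
qed

lemma set_integrable_Phi:
  assumes "Re p < 1" "y \<ge> 0"
  shows "set_integrable lborel {0<..} (\<lambda>v. of_real (exp (- v)) * rpow v (- p) * rpow (1 + v * y) (- p))"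
proof -
  obtain N :: nat where N: "- Re p \<le> real N" using real_arch_simple by blast
  have "set_integrable lborel {0<..} (\<lambda>v. (rpow v ((1 - p) - 1) * of_real (exp (- 1 * v) * (1 + v) ^ N)) * of_real ((1 + y) ^ N))"
    using assms by (intro set_integrable_mult_left set_integrable_Gamma_weight) auto
  then show ?thesis
  proof (rule set_integrable_bound)
    show "AE v in lborel. v \<in> {0<..} \<longrightarrow> norm (of_real (exp (- v)) * rpow v (- p) * rpow (1 + v * y) (- p))
      \<le> norm ((rpow v ((1 - p) - 1) * of_real (exp (- 1 * v) * (1 + v) ^ N)) * of_real ((1 + y) ^ N))"
    proof (intro AE_I2 impI)
      fix v :: real assume v: "v \<in> {0<..}"
      from mult_left_mono[OF norm_rpow_one_plus_mult_le[of v y p N], of "exp (- v) * norm (rpow v (- p))"]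
      show "norm (of_real (exp (- v)) * rpow v (- p) * rpow (1 + v * y) (- p))
        \<le> norm ((rpow v ((1 - p) - 1) * of_real (exp (- 1 * v) * (1 + v) ^ N)) * of_real ((1 + y) ^ N))"
        using v assms N by (simp add: norm_mult abs_mult mult_ac del: of_real_add of_real_mult of_real_power)
    qed
  qed (simp add: set_borel_measurable_def)
qed

lemma
  fixes h :: "real \<Rightarrow> complex"
  assumes s: "s > 0"
  shows integral_scale_interval: "(\<integral>t. (if 0 < t \<and> t < s then h t else 0) \<partial>lborel) = s *\<^sub>R (LINT y:{0<..<1}|lborel. h (s * y))"
    and integrable_scale_interval: "set_integrable lborel {0<..<1} (\<lambda>y. h (s * y)) \<Longrightarrow> integrable lborel (\<lambda>t. if 0 < t \<and> t < s then h t else 0)"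
proof -
  have eq: "(\<lambda>y. if 0 < 0 + s * y \<and> 0 + s * y < s then h (0 + s * y) else 0) = (\<lambda>y. indicator {0<..<1} y *\<^sub>R h (s * y))"
    using s by (auto simp: indicator_def fun_eq_iff zero_less_mult_iff)
  show "(\<integral>t. (if 0 < t \<and> t < s then h t else 0) \<partial>lborel) = s *\<^sub>R (LINT y:{0<..<1}|lborel. h (s * y))"
    using s unfolding set_lebesgue_integral_def
    by (subst lborel_integral_real_affine[of s _ 0]) (simp_all only: eq, simp)
  show "set_integrable lborel {0<..<1} (\<lambda>y. h (s * y)) \<Longrightarrow> integrable lborel (\<lambda>t. if 0 < t \<and> t < s then h t else 0)"
    using s lborel_integrable_real_affine_iff[of s "\<lambda>t. if 0 < t \<and> t < s then h t else 0" 0]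
    unfolding set_integrable_def eq by simp
qed

text \<open>Both sides are iterated integrals of one function \<open>D\<close> living on 0 < t < s.
  For fixed s, t = s y produces the Beta kernel; for fixed t, s = t + v / X produces
  \<open>Phi p (1 / (X * t))\<close>. Because z is not real, the pole factor is at most
  \<open>1 / \<bar>Im z\<bar>\<close>, which makes the double integral absolutely
  convergent.\<close>

lemma Phi_Stieltjes_Fubini:
  fixes p z :: complex
  assumes p: "Re p < 1" "Re p + real n > 0" and n: "n > 0" and X: "X > 0" and z: "Im z \<noteq> 0"
  shows "set_integrable lborel {0<..} (\<lambda>t. of_real (t ^ (n - 1) * exp (- X * t)) * Phi p (1 / (X * t)) / (z - of_real t))"
    and "set_integrable lborel {0<..} (\<lambda>s. of_real (exp (- X * s)) * rpow s (of_nat n - p) *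
       (LINT y:{0<..<1}|lborel. rpow y (p + of_nat n - 1) * rpow (1 - y) (- p) / (z - of_real s * of_real y)))"
    and "Gamma (1 - p) * rpow X (p - 1) * (LINT t:{0<..}|lborel. of_real (t ^ (n - 1) * exp (- X * t)) * Phi p (1 / (X * t)) / (z - of_real t))
     = (LINT s:{0<..}|lborel. of_real (exp (- X * s)) * rpow s (of_nat n - p) *
       (LINT y:{0<..<1}|lborel. rpow y (p + of_nat n - 1) * rpow (1 - y) (- p) / (z - of_real s * of_real y)))"
proof -
  define h where "h = (\<lambda>s t. of_real (exp (- X * s)) * rpow t (of_nat n - 1 + p) * rpow (s - t) (- p) * rpow s (- p) / (z - of_real t))"
  define D where "D = (\<lambda>s t. if 0 < t \<and> t < s then h s t else 0)"
  define w where "w = (\<lambda>y. rpow y (p + of_nat n - 1) * rpow (1 - y) (- p))"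
  have [measurable]: "(\<lambda>x. D (fst x) (snd x)) \<in> borel_measurable (lborel \<Otimes>\<^sub>M lborel)"
    unfolding D_def h_def by measurable
  then have Dm: "case_prod D \<in> borel_measurable (lborel \<Otimes>\<^sub>M lborel)"
    by (simp add: case_prod_unfold)
  have "(\<lambda>y. rpow y ((p + of_nat n) - 1) * rpow (1 - y) ((1 - p) - 1)) = w" by (simp add: w_def)
  with set_integrable_Beta[of "p + of_nat n" "1 - p"]
  have wint: "set_integrable lborel {0<..<1} w" using p by simp
  have hs: "h s (s * y) = of_real (exp (- X * s)) * rpow s (of_nat n - 1 - p) * (w y / (z - of_real s * of_real y))"
    if "s > 0" "y \<in> {0<..<1}" for s y
  proof -
    have "s - s * y = s * (1 - y)" by (simp add: algebra_simps)
    moreover have "rpow s (of_nat n - 1 - p) = rpow s (of_nat n - 1 + p) * rpow s (- p) * rpow s (- p)"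
      by (simp add: algebra_simps flip: rpow_add)
    ultimately show ?thesis
      using that by (simp add: h_def w_def rpow_mult add_ac) (simp add: algebra_simps)
  qed
  have zb: "norm (1 / (z - of_real t)) \<le> 1 / \<bar>Im z\<bar>" for t
    using z abs_Im_le_cmod[of "z - of_real t"] by (simp add: norm_divide frac_le)
  have hb: "norm (h s (s * y)) \<le> exp (- X * s) * s powr (real n - 1 - Re p) / \<bar>Im z\<bar> * norm (w y)"
    if "s > 0" "y \<in> {0<..<1}" for s y
  proof -
    have "norm (h s (s * y)) = exp (- X * s) * s powr (real n - 1 - Re p) * norm (w y) * norm (1 / (z - of_real (s * y)))"
      unfolding hs[OF that] using that by (simp add: norm_mult norm_divide norm_rpow)
    also have "\<dots> \<le> exp (- X * s) * s powr (real n - 1 - Re p) * norm (w y) * (1 / \<bar>Im z\<bar>)"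
      by (intro mult_left_mono zb) auto
    finally show ?thesis by (simp add: mult_ac)
  qed
  have hm: "(\<lambda>y. h s (s * y)) \<in> borel_measurable borel" for s
    unfolding h_def by measurable
  have inth: "set_integrable lborel {0<..<1} (\<lambda>y. h s (s * y))" if s: "s > 0" for s
  proof (rule set_integrable_bound)
    show "set_integrable lborel {0<..<1} (\<lambda>y. of_real (exp (- X * s) * s powr (real n - 1 - Re p) / \<bar>Im z\<bar>) * w y)"
      using wint by (intro set_integrable_mult_right)
    show "AE y in lborel. y \<in> {0<..<1} \<longrightarrow> norm (h s (s * y)) \<le> norm (of_real (exp (- X * s) * s powr (real n - 1 - Re p) / \<bar>Im z\<bar>) * w y)"
      using hb[OF s] by (intro AE_I2 impI) (simp add: norm_mult abs_mult del: of_real_mult of_real_divide)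
    show "set_borel_measurable lborel {0<..<1} (\<lambda>y. h s (s * y))"
      using hm by (simp add: set_borel_measurable_def borel_measurable_indicator)
  qed
  have D0: "D s = (\<lambda>_. 0)" if "\<not> s > 0" for s
    using that by (auto simp: D_def fun_eq_iff)
  have intD: "integrable lborel (D s)" for s
  proof (cases "s > 0")
    case True
    then show ?thesis unfolding D_def by (intro integrable_scale_interval inth)
  next
    case False
    then show ?thesis by (simp add: D0)
  qed
  define K where "K = (LINT y:{0<..<1}|lborel. norm (w y)) / \<bar>Im z\<bar>"
  have normD: "(\<integral>t. norm (D s t) \<partial>lborel) \<le> indicator {0<..} s * (s powr (real n - Re p) * exp (- X * s) * K)" for s
  proof (cases "s > 0")
    case True
    have "(\<integral>t. complex_of_real (norm (D s t)) \<partial>lborel) = (\<integral>t. (if 0 < t \<and> t < s then of_real (norm (h s t)) else 0) \<partial>lborel)"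
      by (intro Bochner_Integration.integral_cong) (auto simp: D_def)
    also have "\<dots> = s *\<^sub>R (LINT y:{0<..<1}|lborel. complex_of_real (norm (h s (s * y))))"
      using True by (rule integral_scale_interval)
    finally have "(\<integral>t. norm (D s t) \<partial>lborel) = s * (LINT y:{0<..<1}|lborel. norm (h s (s * y)))"
      unfolding set_integral_complex_of_real integral_complex_of_real
      by (simp only: scaleR_conv_of_real of_real_mult [symmetric] of_real_eq_iff)
    also have "(LINT y:{0<..<1}|lborel. norm (h s (s * y))) \<le> (LINT y:{0<..<1}|lborel. exp (- X * s) * s powr (real n - 1 - Re p) / \<bar>Im z\<bar> * norm (w y))"
      using inth[OF True] wint hb[OF True]
      by (intro set_integral_mono set_integrable_mult_right) (auto simp: set_integrable_norm)
    also have "\<dots> = exp (- X * s) * s powr (real n - 1 - Re p) * K" by (simp add: K_def)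
    finally have "(\<integral>t. norm (D s t) \<partial>lborel) \<le> s * (exp (- X * s) * s powr (real n - 1 - Re p) * K)"
      using True by simp
    also have "s * (exp (- X * s) * s powr (real n - 1 - Re p) * K) = s powr (1 + (real n - 1 - Re p)) * exp (- X * s) * K"
      unfolding powr_add using True by simp
    finally show ?thesis using True by (simp add: algebra_simps)
  qed (simp add: D0)
  have gint: "integrable lborel (\<lambda>s. indicator {0<..} s * (s powr (real n - Re p) * exp (- X * s) * K))"
  proof -
    have "set_integrable lborel {0<..} (\<lambda>t. rpow t (of_real (real n - Re p + 1) - 1) * of_real (exp (- X * t)))"
      using p X by (intro set_integrable_Gamma_laplace) auto
    from integrable_norm[OF this[unfolded set_integrable_def]]
    have "integrable lborel (\<lambda>s. norm (indicator {0<..} s *\<^sub>R (rpow s (of_real (real n - Re p + 1) - 1) * of_real (exp (- X * s)))) * K)"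
      by (rule integrable_mult_left)
    then show ?thesis
      by (rule Bochner_Integration.integrable_cong[THEN iffD1, rotated 2])
         (auto simp: indicator_def norm_mult norm_rpow)
  qed
  have nm: "(\<lambda>s. \<integral>t. norm (D s t) \<partial>lborel) \<in> borel_measurable lborel"
    by measurable
  have Dint: "integrable (lborel \<Otimes>\<^sub>M lborel) (case_prod D)"
  proof (rule lborel_pair.Fubini_integrable[OF Dm])
    show "integrable lborel (\<lambda>s. \<integral>t. norm (case_prod D (s, t)) \<partial>lborel)"
      by (rule Bochner_Integration.integrable_bound[OF gint])
         (use nm normD in \<open>auto intro!: AE_I2 order_trans[OF _ abs_ge_self] simp: abs_of_nonneg[OF Bochner_Integration.integral_nonneg]\<close>)
  qed (use intD in simp)
  have inner1: "(\<integral>t. D s t \<partial>lborel) = indicator {0<..} s *\<^sub>R (of_real (exp (- X * s)) * rpow s (of_nat n - p) *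
       (LINT y:{0<..<1}|lborel. rpow y (p + of_nat n - 1) * rpow (1 - y) (- p) / (z - of_real s * of_real y)))" for s
  proof (cases "s > 0")
    case True
    have "(\<integral>t. D s t \<partial>lborel) = s *\<^sub>R (LINT y:{0<..<1}|lborel. h s (s * y))"
      unfolding D_def using True by (rule integral_scale_interval)
    also have "(LINT y:{0<..<1}|lborel. h s (s * y)) = (LINT y:{0<..<1}|lborel. of_real (exp (- X * s)) * rpow s (of_nat n - 1 - p) * (w y / (z - of_real s * of_real y)))"
      using hs[OF True] by (intro set_lebesgue_integral_cong) auto
    also have "s *\<^sub>R \<dots> = of_real (exp (- X * s)) * (rpow s 1 * rpow s (of_nat n - 1 - p)) * (LINT y:{0<..<1}|lborel. w y / (z - of_real s * of_real y))"
      using True by (subst set_integral_mult_right) (simp add: scaleR_conv_of_real)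
    also have "rpow s 1 * rpow s (of_nat n - 1 - p) = rpow s (of_nat n - p)"
      unfolding rpow_add [symmetric] by (simp add: algebra_simps)
    finally show ?thesis using True by (simp add: w_def)
  qed (simp add: D0)
  have inner2: "(\<integral>s. D s t \<partial>lborel) = indicator {0<..} t *\<^sub>R (Gamma (1 - p) * rpow X (p - 1) *
     (of_real (t ^ (n - 1) * exp (- X * t)) * Phi p (1 / (X * t)) / (z - of_real t)))" for t
  proof (cases "t > 0")
    case True
    let ?f = "\<lambda>v. of_real (exp (- v)) * rpow v (- p) * rpow (1 + v * (1 / (X * t))) (- p)"
    let ?c = "of_real (exp (- X * t)) * rpow t (of_nat n - 1 + p) * rpow X p * rpow t (- p) / (z - of_real t)"
    have "D (t + 1 / X * v) t = ?c * (indicator {0<..} v *\<^sub>R ?f v)" for v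
    proof (cases "v > 0")
      case v: True
      have "t + v / X = t * (1 + v * (1 / (X * t)))" using X True by (simp add: field_simps)
      then have "rpow (t + v / X) (- p) = rpow t (- p) * rpow (1 + v * (1 / (X * t))) (- p)"
        using True v X by (simp only: rpow_mult add_pos_pos zero_less_one zero_less_mult_iff divide_pos_pos) (simp add: add_pos_pos rpow_mult)
      moreover have "exp (- X * (t + v / X)) = exp (- X * t) * exp (- v)"
        using X by (simp add: field_simps flip: exp_add)
      moreover have "rpow (v / X) (- p) = rpow v (- p) * rpow X p"
        using v X by (simp add: rpow_divide rpow_minus field_simps)
      moreover have "D (t + 1 / X * v) t = of_real (exp (- X * (t + v / X))) * rpow t (of_nat n - 1 + p) * rpow (v / X) (- p) * rpow (t + v / X) (- p) / (z - of_real t)"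
        using v X True by (simp add: D_def h_def)
      ultimately show ?thesis using v by simp
    next
      case False
      then show ?thesis using X by (simp add: D_def field_simps zero_less_divide_iff)
    qed
    then have "(\<integral>s. D s t \<partial>lborel) = (1 / X) *\<^sub>R (\<integral>v. ?c * (indicator {0<..} v *\<^sub>R ?f v) \<partial>lborel)"
      using X by (subst lborel_integral_real_affine[of "1 / X" _ t]) auto
    also have "\<dots> = (1 / X) *\<^sub>R (?c * (LINT v:{0<..}|lborel. ?f v))"
      unfolding set_lebesgue_integral_def by (subst integral_mult_right_zero) (rule refl)
    also have "(LINT v:{0<..}|lborel. ?f v) = Gamma (1 - p) * Phi p (1 / (X * t))"
    proof -
      have "Gamma (1 - p) * rGamma (1 - p) = 1"
        using p Gamma_nonzero_right_halfplane[of "1 - p"] by (simp add: rGamma_inverse_Gamma)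
      then show ?thesis by (simp add: Phi_def mult.assoc [symmetric])
    qed
    also have "(1 / X) *\<^sub>R (?c * (Gamma (1 - p) * Phi p (1 / (X * t)))) = Gamma (1 - p) * (rpow X p * rpow X (- 1)) *
      (of_real (exp (- X * t)) * (rpow t (of_nat n - 1 + p) * rpow t (- p)) * Phi p (1 / (X * t)) / (z - of_real t))"
      using X by (simp add: scaleR_conv_of_real rpow_minus field_simps)
    also have "rpow t (of_nat n - 1 + p) * rpow t (- p) = of_real (t ^ (n - 1))"
      using True n rpow_of_nat[of t "n - 1"] by (simp add: of_nat_diff flip: rpow_add)
    also have "rpow X p * rpow X (- 1) = rpow X (p - 1)"
      by (simp flip: rpow_add)
    finally show ?thesis using True by (simp add: mult_ac)
  qed (auto simp: D_def)
  have i1: "integrable lborel (\<lambda>s. \<integral>t. D s t \<partial>lborel)"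
    using lborel_pair.integrable_fst[OF Dint] .
  then show "set_integrable lborel {0<..} (\<lambda>s. of_real (exp (- X * s)) * rpow s (of_nat n - p) *
       (LINT y:{0<..<1}|lborel. rpow y (p + of_nat n - 1) * rpow (1 - y) (- p) / (z - of_real s * of_real y)))"
    unfolding inner1 set_integrable_def .
  have nz: "Gamma (1 - p) * rpow X (p - 1) \<noteq> 0"
    using p Gamma_nonzero_right_halfplane[of "1 - p"] by simp
  have "integrable lborel (\<lambda>t. \<integral>s. D s t \<partial>lborel)"
    using lborel_pair.integrable_snd[OF Dint] .
  then have "set_integrable lborel {0<..} (\<lambda>t. Gamma (1 - p) * rpow X (p - 1) *
     (of_real (t ^ (n - 1) * exp (- X * t)) * Phi p (1 / (X * t)) / (z - of_real t)))"
    unfolding inner2 set_integrable_def .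
  then show "set_integrable lborel {0<..} (\<lambda>t. of_real (t ^ (n - 1) * exp (- X * t)) * Phi p (1 / (X * t)) / (z - of_real t))"
    by (simp only: set_integrable_mult_right_iff[OF nz])
  have "(\<integral>t. (\<integral>s. D s t \<partial>lborel) \<partial>lborel) = (\<integral>s. (\<integral>t. D s t \<partial>lborel) \<partial>lborel)"
    by (rule lborel_pair.Fubini_integral[OF Dint])
  then have "(LINT t:{0<..}|lborel. Gamma (1 - p) * rpow X (p - 1) *
     (of_real (t ^ (n - 1) * exp (- X * t)) * Phi p (1 / (X * t)) / (z - of_real t)))
     = (LINT s:{0<..}|lborel. of_real (exp (- X * s)) * rpow s (of_nat n - p) *
       (LINT y:{0<..<1}|lborel. rpow y (p + of_nat n - 1) * rpow (1 - y) (- p) / (z - of_real s * of_real y)))"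
    unfolding inner1 inner2 set_lebesgue_integral_def .
  then show "Gamma (1 - p) * rpow X (p - 1) * (LINT t:{0<..}|lborel. of_real (t ^ (n - 1) * exp (- X * t)) * Phi p (1 / (X * t)) / (z - of_real t))
     = (LINT s:{0<..}|lborel. of_real (exp (- X * s)) * rpow s (of_nat n - p) *
       (LINT y:{0<..<1}|lborel. rpow y (p + of_nat n - 1) * rpow (1 - y) (- p) / (z - of_real s * of_real y)))"
    by (simp only: set_integral_mult_right)
qed

text \<open>The inner Beta integral is the binomial tail at u = s / z, a point of the cut plane
  since z is not real. From u^n J = C T one gets s^n J = C z^n T, and 1 / (z - s y) = (1 / z) / (1 -
  u y) takes one power back, hence \<open>z ^ (n - 1)\<close>.\<close>

lemma Phi_Stieltjes_resummed:
  fixes p z :: complex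
  assumes p: "p \<notin> \<int>" "Re p < 1" "Re p + real n > 0" and n: "n > 0" and X: "X > 0" and z: "Im z \<noteq> 0"
  defines "T \<equiv> \<lambda>s. (1 - of_real s / z) powr (- p) - (\<Sum>k<n. pochhammer p k / fact k * (of_real s / z) ^ k)"
  shows "set_integrable lborel {0<..} (\<lambda>s. of_real (exp (- X * s)) * rpow s (- p) * (z ^ (n - 1) * T s))" (is ?int)
    and "Gamma (1 - p) * rpow X (p - 1) * (LINT t:{0<..}|lborel. of_real (t ^ (n - 1) * exp (- X * t)) * Phi p (1 / (X * t)) / (z - of_real t))
     = of_real pi / sin (of_real pi * p) * (LINT s:{0<..}|lborel. of_real (exp (- X * s)) * rpow s (- p) * (z ^ (n - 1) * T s))" (is ?eq)
proof -
  have z0: "z \<noteq> 0" using z by auto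
  let ?C = "of_real pi / sin (of_real pi * p)"
  have sin0: "sin (of_real pi * p) \<noteq> 0"
  proof
    assume "sin (of_real pi * p) = 0"
    then obtain k :: int where "of_real pi * p = of_real (of_int k * pi)"
      unfolding sin_eq_0 by (auto simp: mult_ac)
    then have "p = of_int k" by (simp add: field_simps)
    then show False using p by simp
  qed
  have key: "of_real (exp (- X * s)) * rpow s (of_nat n - p) *
       (LINT y:{0<..<1}|lborel. rpow y (p + of_nat n - 1) * rpow (1 - y) (- p) / (z - of_real s * of_real y)) =
    ?C * (of_real (exp (- X * s)) * rpow s (- p) * (z ^ (n - 1) * T s))" if s: "s > 0" for s
  proof -
    define u where "u = of_real s / z"
    have u: "u \<in> cut_plane"
    proof
      assume "u \<in> complex_of_real ` {1..}"
      then obtain r where "u = of_real r" by auto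
      then have "of_real s = of_real r * z" using z0 by (simp add: u_def field_simps)
      then have "Im (of_real r * z) = 0" "Re (of_real r * z) = s" by (metis Im_complex_of_real, metis Re_complex_of_real)
      then show False using z s by auto
    qed
    define J where "J = (LINT y:{0<..<1}|lborel. rpow y (p + of_nat n - 1) * rpow (1 - y) (- p) * (1 / (1 - u * of_real y)))"
    have "u ^ n * J = ?C * T s"
      using binomial_tail_integral[OF p u] by (simp add: J_def T_def u_def)
    then have J: "of_real s ^ n * J = ?C * (z ^ n * T s)"
      using z0 by (simp add: u_def power_divide field_simps)
    have "(LINT y:{0<..<1}|lborel. rpow y (p + of_nat n - 1) * rpow (1 - y) (- p) / (z - of_real s * of_real y)) =
      (LINT y:{0<..<1}|lborel. 1 / z * (rpow y (p + of_nat n - 1) * rpow (1 - y) (- p) * (1 / (1 - u * of_real y))))"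
    proof (intro set_lebesgue_integral_cong allI impI)
      fix y :: real
      have "z - of_real s * of_real y = z * (1 - u * of_real y)" using z0 by (simp add: u_def field_simps)
      then show "rpow y (p + of_nat n - 1) * rpow (1 - y) (- p) / (z - of_real s * of_real y) =
        1 / z * (rpow y (p + of_nat n - 1) * rpow (1 - y) (- p) * (1 / (1 - u * of_real y)))"
        by simp
    qed simp
    also have "\<dots> = 1 / z * J" unfolding J_def by (rule set_integral_mult_right)
    finally have I: "(LINT y:{0<..<1}|lborel. rpow y (p + of_nat n - 1) * rpow (1 - y) (- p) / (z - of_real s * of_real y)) = 1 / z * J" .
    have "rpow s (of_nat n - p) = rpow s (- p) * of_real s ^ n"
      using rpow_add[of s "of_nat n" "- p"] rpow_of_nat[OF s, of n] by simp
    moreover have "z ^ n = z * z ^ (n - 1)" using n by (cases n) auto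
    ultimately have "of_real (exp (- X * s)) * rpow s (of_nat n - p) * (1 / z * J) =
        of_real (exp (- X * s)) * rpow s (- p) * (1 / z) * (of_real s ^ n * J)"
      by simp
    also have "\<dots> = of_real (exp (- X * s)) * rpow s (- p) * (1 / z) * (?C * (z * z ^ (n - 1) * T s))"
      unfolding J using \<open>z ^ n = z * z ^ (n - 1)\<close> by simp
    also have "\<dots> = ?C * (of_real (exp (- X * s)) * rpow s (- p) * (z ^ (n - 1) * T s))"
      using z0 by simp
    finally show ?thesis unfolding I .
  qed
  have "set_integrable lborel {0<..} (\<lambda>s. ?C * (of_real (exp (- X * s)) * rpow s (- p) * (z ^ (n - 1) * T s)))"
    using Phi_Stieltjes_Fubini(2)[OF p(2,3) n X z] key
    by (subst set_integrable_cong[OF refl refl]) (auto simp only: greaterThan_iff)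
  then show ?int using sin0 by (subst (asm) set_integrable_mult_right_iff) auto
  show ?eq
    unfolding Phi_Stieltjes_Fubini(3)[OF p(2,3) n X z]
    using key by (subst set_integral_mult_right [symmetric]) (intro set_lebesgue_integral_cong, auto simp only: greaterThan_iff sets_lborel greaterThan_borel)
qed

text \<open>The substitution s = 1 + v / X. This integral is what the boundary values contribute
  beyond the branch point s = 1, and it is the source of the exponentially small term.\<close>

lemma
  assumes p: "Re p < 1" and X: "X > 0"
  shows tail_integrable: "set_integrable lborel {1<..} (\<lambda>s. of_real (exp (- X * s)) * (rpow s (- p) * rpow (s - 1) (- p)))" (is "set_integrable _ _ ?F")
    and tail_integral: "(LINT s:{1<..}|lborel. of_real (exp (- X * s)) * (rpow s (- p) * rpow (s - 1) (- p)))
      = Gamma (1 - p) * rpow X (p - 1) * (of_real (exp (- X)) * Phi p (1 / X))"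
proof -
  let ?f = "\<lambda>v. of_real (exp (- v)) * rpow v (- p) * rpow (1 + v * (1 / X)) (- p)"
  let ?c = "of_real (exp (- X)) * rpow X p"
  have eq: "indicator {1<..} (1 + 1 / X * v) *\<^sub>R ?F (1 + 1 / X * v) = ?c * (indicator {0<..} v *\<^sub>R ?f v)" for v
  proof (cases "v > 0")
    case v: True
    have "exp (- X * (1 + 1 / X * v)) = exp (- X) * exp (- v)"
      using X by (simp add: field_simps flip: exp_add)
    moreover have "rpow (1 + 1 / X * v - 1) (- p) = rpow v (- p) * rpow X p"
      using v X by (simp add: rpow_divide rpow_minus field_simps)
    moreover have "1 + 1 / X * v = 1 + v * (1 / X)" by simp
    ultimately show ?thesis using v X by (simp add: mult_ac)
  next
    case False
    then show ?thesis using X by (simp add: field_simps zero_less_divide_iff)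
  qed
  have fi: "integrable lborel (\<lambda>v. ?c * (indicator {0<..} v *\<^sub>R ?f v))"
    using set_integrable_Phi[OF p, of "1 / X"] X unfolding set_integrable_def by (intro integrable_mult_right) auto
  show "set_integrable lborel {1<..} ?F"
    unfolding set_integrable_def
    using X fi by (subst lborel_integrable_real_affine_iff[of "1 / X" _ 1, symmetric]) (simp_all only: eq, simp)
  have "(LINT s:{1<..}|lborel. ?F s) = (1 / X) *\<^sub>R (\<integral>v. ?c * (indicator {0<..} v *\<^sub>R ?f v) \<partial>lborel)"
    unfolding set_lebesgue_integral_def
    using X by (subst lborel_integral_real_affine[of "1 / X" _ 1]) (simp_all only: eq, simp_all)
  also have "\<dots> = (1 / X) *\<^sub>R (?c * (LINT v:{0<..}|lborel. ?f v))"
    unfolding set_lebesgue_integral_def by (subst integral_mult_right_zero) (rule refl)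
  also have "(LINT v:{0<..}|lborel. ?f v) = Gamma (1 - p) * Phi p (1 / X)"
    using p Gamma_nonzero_right_halfplane[of "1 - p"] by (simp add: Phi_def rGamma_inverse_Gamma)
  also have "(1 / X) *\<^sub>R (?c * (Gamma (1 - p) * Phi p (1 / X))) = Gamma (1 - p) * (rpow X p * rpow X (- 1)) * (of_real (exp (- X)) * Phi p (1 / X))"
    using X by (simp add: scaleR_conv_of_real rpow_minus field_simps)
  also have "rpow X p * rpow X (- 1) = rpow X (p - 1)"
    by (simp flip: rpow_add)
  finally show "(LINT s:{1<..}|lborel. ?F s) = Gamma (1 - p) * rpow X (p - 1) * (of_real (exp (- X)) * Phi p (1 / X))" .
qed

lemma head_integrable:
  assumes p: "Re p < 1" and X: "X > 0"
  shows "set_integrable lborel {0<..<1} (\<lambda>s. of_real (exp (- X * s)) * (rpow s (- p) * rpow (1 - s) (- p)))"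
proof -
  have "set_integrable lborel {0<..<1} (\<lambda>s. rpow s ((1 - p) - 1) * rpow (1 - s) ((1 - p) - 1))"
    using p by (intro set_integrable_Beta) auto
  then show ?thesis
  proof (rule set_integrable_bound)
    show "AE s in lborel. s \<in> {0<..<1} \<longrightarrow> norm (of_real (exp (- X * s)) * (rpow s (- p) * rpow (1 - s) (- p)))
       \<le> norm (rpow s ((1 - p) - 1) * rpow (1 - s) ((1 - p) - 1))"
    proof (intro AE_I2 impI)
      fix s :: real assume s: "s \<in> {0<..<1}"
      have "exp (- X * s) \<le> 1" using s X by simp
      from mult_right_mono[OF this, of "norm (rpow s (- p) * rpow (1 - s) (- p))"]
      show "norm (of_real (exp (- X * s)) * (rpow s (- p) * rpow (1 - s) (- p)))
       \<le> norm (rpow s ((1 - p) - 1) * rpow (1 - s) ((1 - p) - 1))"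
        by (simp add: norm_mult)
    qed
  qed (simp add: set_borel_measurable_def)
qed

section \<open>Boundary values of the binomial power on its cut\<close>

lemma norm_powr_le:
  assumes "v \<noteq> 0"
  shows "norm ((v :: complex) powr (- p)) \<le> norm v powr (- Re p) * exp (pi * \<bar>Im p\<bar>)"
proof -
  have "Im p * Im (Ln v) \<le> \<bar>Im p\<bar> * pi"
  proof -
    have "\<bar>Im (Ln v)\<bar> \<le> pi" using mpi_less_Im_Ln[OF assms] Im_Ln_le_pi[OF assms] by linarith
    then have "\<bar>Im p * Im (Ln v)\<bar> \<le> \<bar>Im p\<bar> * pi" by (simp add: abs_mult mult_left_mono)
    then show ?thesis by linarith
  qed
  then have "exp (- Re p * ln (norm v) + Im p * Im (Ln v)) \<le> exp (- Re p * ln (norm v) + pi * \<bar>Im p\<bar>)"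
    by (simp add: mult.commute)
  then show ?thesis using assms by (simp add: powr_def algebra_simps flip: exp_add)
qed

lemma powr_between:
  fixes v :: real
  assumes "0 < a" "a \<le> v" "v \<le> b"
  shows "v powr r \<le> a powr r + b powr r"
proof (cases "r \<ge> 0")
  case True
  then have "v powr r \<le> b powr r" using assms by (intro powr_mono2) auto
  then show ?thesis by (simp add: add_increasing)
next
  case False
  then have "v powr r \<le> a powr r" using assms by (intro powr_mono2') auto
  then show ?thesis by (simp add: add_increasing2)
qed

text \<open>Uniform in z on a segment through 1: there 1 <= |z| <= 2 and |z - s| >= |s - 1|, so |1 -
  s / z| lies between |s - 1| / 2 and s + 2. Both end points appear because \<open>Re p\<close> may
  have either sign; the exponential accounts for the argument when \<open>p\<close> is not
  real.\<close>

lemma norm_one_minus_divide_powr_le: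
  assumes s: "s > 0" "s \<noteq> 1" and z: "Re z = 1" "\<bar>Im z\<bar> \<le> 1"
  shows "norm ((1 - of_real s / z) powr (- p)) \<le>
    ((\<bar>s - 1\<bar> / 2) powr (- Re p) + (s + 2) powr (- Re p)) * exp (pi * \<bar>Im p\<bar>)"
proof -
  have z1: "1 \<le> norm z" using abs_Re_le_cmod[of z] z by simp
  have z2: "norm z \<le> 2" using cmod_le[of z] z by simp
  have z0: "z \<noteq> 0" using z1 by auto
  have e: "1 - of_real s / z = (z - of_real s) / z" using z0 by (simp add: field_simps)
  have l: "\<bar>s - 1\<bar> \<le> norm (z - of_real s)" using abs_Re_le_cmod[of "z - of_real s"] z by simp
  have u: "norm (z - of_real s) \<le> 2 + s" using norm_triangle_ineq4[of z "of_real s"] z2 s by simp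
  have pos: "0 < norm (z - of_real s)" using l s by linarith
  have "\<bar>s - 1\<bar> / 2 \<le> norm (z - of_real s) / norm z"
    using l z1 z2 by (intro frac_le) auto
  moreover have "norm (z - of_real s) / norm z \<le> s + 2"
  proof -
    have "norm (z - of_real s) / norm z \<le> norm (z - of_real s) / 1"
      using z1 by (intro divide_left_mono) auto
    then show ?thesis using u by simp
  qed
  ultimately have "norm (1 - of_real s / z) powr (- Re p) \<le> (\<bar>s - 1\<bar> / 2) powr (- Re p) + (s + 2) powr (- Re p)"
    unfolding e norm_divide using s by (intro powr_between) auto
  moreover have "1 - of_real s / z \<noteq> 0" unfolding e using pos z0 by auto
  ultimately show ?thesis
    using norm_powr_le[of "1 - of_real s / z" p] by (meson exp_ge_zero mult_right_mono order_trans)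
qed

text \<open>For s > 1 the point 1 - s / z and its conjugate approach the negative axis from opposite
  sides. The powers then carry the phases exp (- i pi p) and exp (i pi p), whose mean is the cosine.
  For s < 1 the limit stays off the cut.\<close>

lemma powr_boundary_average:
  assumes s: "s > 0" "s \<noteq> 1" and z: "\<And>i. Re (z i) = 1" "\<And>i. Im (z i) > 0" "z \<longlonglongrightarrow> 1"
  shows "(\<lambda>i. ((1 - of_real s / z i) powr (- p) + (1 - of_real s / cnj (z i)) powr (- p)) / 2)
    \<longlonglongrightarrow> (if s < 1 then rpow (1 - s) (- p) else cos (of_real pi * p) * rpow (s - 1) (- p))"
proof -
  have zc: "(\<lambda>i. cnj (z i)) \<longlonglongrightarrow> 1" using tendsto_cnj[OF z(3)] by simp
  have l1: "(\<lambda>i. of_real s / z i) \<longlonglongrightarrow> of_real s" "(\<lambda>i. of_real s / cnj (z i)) \<longlonglongrightarrow> of_real s"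
    using tendsto_divide[OF tendsto_const z(3), of "of_real s"] tendsto_divide[OF tendsto_const zc, of "of_real s"] by auto
  show ?thesis
  proof (cases "s < 1")
    case True
    have nn: "1 - complex_of_real s \<notin> \<real>\<^sub>\<le>\<^sub>0"
      using True by (auto simp: complex_nonpos_Reals_iff)
    have "(\<lambda>i. ((1 - of_real s / z i) powr (- p) + (1 - of_real s / cnj (z i)) powr (- p)) / 2)
      \<longlonglongrightarrow> ((1 - of_real s) powr (- p) + (1 - of_real s) powr (- p)) / 2"
      using nn by (intro tendsto_intros tendsto_powr_complex l1) auto
    then show ?thesis using True rpow_eq_powr[of "1 - s" "- p"] by simp
  next
    case False
    then have s1: "s > 1" using s by simp
    have nn: "complex_of_real s - 1 \<notin> \<real>\<^sub>\<le>\<^sub>0"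
      using s1 by (auto simp: complex_nonpos_Reals_iff)
    have Im1: "Im (of_real s / z i) < 0" for i
      using z(2)[of i] s z(1)[of i] by (simp add: Im_divide divide_neg_pos add_pos_pos)
    have Im2: "Im (of_real s / cnj (z i)) > 0" for i
      using z(2)[of i] s z(1)[of i] by (simp add: Im_divide add_pos_pos)
    have 1: "(1 - of_real s / z i) powr (- p) = exp (- p * (Ln (of_real s / z i - 1) + \<i> * of_real pi))" for i
    proof -
      have "of_real s / z i - 1 \<noteq> 0" using Im1[of i] by force
      then have "Ln (- (of_real s / z i - 1)) = Ln (of_real s / z i - 1) + \<i> * of_real pi"
        using Im1[of i] by (subst Ln_minus) auto
      moreover have "1 - of_real s / z i \<noteq> 0" using Im1[of i] by force
      ultimately show ?thesis by (simp add: powr_def)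
    qed
    have 2: "(1 - of_real s / cnj (z i)) powr (- p) = exp (- p * (Ln (of_real s / cnj (z i) - 1) - \<i> * of_real pi))" for i
    proof -
      have "of_real s / cnj (z i) - 1 \<noteq> 0" using Im2[of i] by force
      then have "Ln (- (of_real s / cnj (z i) - 1)) = Ln (of_real s / cnj (z i) - 1) - \<i> * of_real pi"
        using Im2[of i] by (subst Ln_minus) auto
      moreover have "1 - of_real s / cnj (z i) \<noteq> 0" using Im2[of i] by force
      ultimately show ?thesis by (simp add: powr_def)
    qed
    have "(\<lambda>i. ((1 - of_real s / z i) powr (- p) + (1 - of_real s / cnj (z i)) powr (- p)) / 2)
      \<longlonglongrightarrow> (exp (- p * (Ln (of_real s - 1) + \<i> * of_real pi)) + exp (- p * (Ln (of_real s - 1) - \<i> * of_real pi))) / 2"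
      unfolding 1 2 using nn by (intro tendsto_intros l1) auto
    also have "Ln (of_real s - 1) = of_real (ln (s - 1))"
      using s1 Ln_of_real[of "s - 1"] by simp
    also have "(exp (- p * (of_real (ln (s - 1)) + \<i> * of_real pi)) + exp (- p * (of_real (ln (s - 1)) - \<i> * of_real pi))) / 2
      = cos (of_real pi * p) * rpow (s - 1) (- p)"
      unfolding rpow_def cos_exp_eq by (simp add: ring_distribs exp_add exp_diff exp_minus field_simps)
    finally show ?thesis using s1 by simp
  qed
qed

lemma right_halfplane_not_nonpos_Int: "Re z > 0 \<Longrightarrow> (z :: complex) \<notin> \<int>\<^sub>\<le>\<^sub>0"
  by (auto elim!: nonpos_Ints_cases)

lemma set_integrable_power_weight:
  assumes "Re p < 1" "X > 0"
  shows "set_integrable lborel {0<..} (\<lambda>s. of_real (exp (- X * s) * (1 + s) ^ k) * rpow s (- p))"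
  using set_integrable_Gamma_weight[of "1 - p" X k] assms by (simp add: mult.commute)

lemma Gamma_power_term:
  assumes "Re p < 1" "X > 0"
  shows "set_integrable lborel {0<..} (\<lambda>s. of_real (exp (- X * s)) * rpow s (- p) * of_real s ^ k)" (is ?int)
    and "(LINT s:{0<..}|lborel. of_real (exp (- X * s)) * rpow s (- p) * of_real s ^ k) =
      Gamma (1 - p) * rpow X (p - 1) * (pochhammer (1 - p) k / of_real X ^ k)" (is ?eq)
proof -
  have c: "of_real (exp (- X * s)) * rpow s (- p) * of_real s ^ k = rpow s (1 - p + of_nat k - 1) * of_real (exp (- X * s))"
    if "s \<in> {0<..}" for s
    using that rpow_add[of s "- p" "of_nat k"] rpow_of_nat[of s k] by (simp add: algebra_simps)
  have G: "Gamma (1 - p + of_nat k) = pochhammer (1 - p) k * Gamma (1 - p)"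
    using assms right_halfplane_not_nonpos_Int[of "1 - p"]
    by (subst pochhammer_Gamma) (auto simp: Gamma_nonzero_right_halfplane)
  have R: "rpow X (- (1 - p + of_nat k)) = rpow X (p - 1) / of_real X ^ k"
    using assms rpow_diff[of X "p - 1" "of_nat k"] rpow_of_nat[of X k] by (simp add: algebra_simps)
  show ?int
    using set_integrable_Gamma_laplace[of "1 - p + of_nat k" X] assms c
    by (subst set_integrable_cong[OF refl refl]) auto
  have "(LINT s:{0<..}|lborel. of_real (exp (- X * s)) * rpow s (- p) * of_real s ^ k) =
    (LINT s:{0<..}|lborel. rpow s (1 - p + of_nat k - 1) * of_real (exp (- X * s)))"
    using c by (intro set_lebesgue_integral_cong) auto
  also have "\<dots> = Gamma (1 - p + of_nat k) * rpow X (- (1 - p + of_nat k))"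
    using assms by (intro set_integral_Gamma_laplace) auto
  finally show ?eq unfolding G R by (simp add: mult_ac)
qed

text \<open>The mean of 1 / (z - t) and 1 / (cnj z - t) at z = 1 + i \<epsilon> is its real part (1
  - t) / ((1 - t)^2 + \<epsilon>^2): an integrable smoothing of 1 / (1 - t) that is odd about t =
  1.\<close>

lemma Phi_Stieltjes_average:
  fixes p :: complex
  assumes p: "p \<notin> \<int>" "Re p < 1" "Re p + real n > 0" and n: "n > 0" and X: "X > 0" and e: "\<epsilon> > 0"
  defines "z \<equiv> Complex 1 \<epsilon>"
  defines "T \<equiv> \<lambda>z s. (1 - of_real s / z) powr (- p) - (\<Sum>k<n. pochhammer p k / fact k * (of_real s / z) ^ k)"
  shows "set_integrable lborel {0<..} (\<lambda>t. of_real (t ^ (n - 1) * exp (- X * t) * ((1 - t) / ((1 - t)\<^sup>2 + \<epsilon>\<^sup>2))) * Phi p (1 / (X * t)))" (is ?int)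
    and "Gamma (1 - p) * rpow X (p - 1) *
      (LINT t:{0<..}|lborel. of_real (t ^ (n - 1) * exp (- X * t) * ((1 - t) / ((1 - t)\<^sup>2 + \<epsilon>\<^sup>2))) * Phi p (1 / (X * t)))
     = of_real pi / sin (of_real pi * p) * (LINT s:{0<..}|lborel. of_real (exp (- X * s)) * rpow s (- p) *
        ((z ^ (n - 1) * T z s + cnj z ^ (n - 1) * T (cnj z) s) / 2))" (is ?eq)
proof -
  have z: "Im z \<noteq> 0" "Im (cnj z) \<noteq> 0" using e by (auto simp: z_def)
  note R1 = Phi_Stieltjes_resummed[OF p n X z(1)] and R2 = Phi_Stieltjes_resummed[OF p n X z(2)]
  note F1 = Phi_Stieltjes_Fubini(1)[OF p(2,3) n X z(1)] and F2 = Phi_Stieltjes_Fubini(1)[OF p(2,3) n X z(2)]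
  let ?N = "\<lambda>z t. of_real (t ^ (n - 1) * exp (- X * t)) * Phi p (1 / (X * t)) / (z - of_real t)"
  let ?S = "\<lambda>z s. of_real (exp (- X * s)) * rpow s (- p) * (z ^ (n - 1) * T z s)"
  have kern: "1 / (z - of_real t) + 1 / (cnj z - of_real t) = of_real (2 * ((1 - t) / ((1 - t)\<^sup>2 + \<epsilon>\<^sup>2)))" for t
  proof -
    have nz: "z - of_real t \<noteq> 0" "cnj z - of_real t \<noteq> 0" using z by (auto simp: complex_eq_iff)
    have "(z - of_real t) * (cnj z - of_real t) = of_real ((1 - t)\<^sup>2 + \<epsilon>\<^sup>2)"
      by (simp add: z_def complex_eq_iff power2_eq_square algebra_simps)
    moreover have "(cnj z - of_real t) + (z - of_real t) = of_real (2 * (1 - t))"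
      by (simp add: z_def complex_eq_iff)
    moreover have "1 / (z - of_real t) + 1 / (cnj z - of_real t) = ((cnj z - of_real t) + (z - of_real t)) / ((z - of_real t) * (cnj z - of_real t))"
      using nz by (simp add: field_simps)
    ultimately have "1 / (z - of_real t) + 1 / (cnj z - of_real t) = of_real (2 * (1 - t)) / of_real ((1 - t)\<^sup>2 + \<epsilon>\<^sup>2)"
      by (simp only:)
    also have "\<dots> = of_real (2 * ((1 - t) / ((1 - t)\<^sup>2 + \<epsilon>\<^sup>2)))" by (simp only: of_real_divide [symmetric] times_divide_eq_right)
    finally show ?thesis .
  qed
  have N: "of_real (t ^ (n - 1) * exp (- X * t) * ((1 - t) / ((1 - t)\<^sup>2 + \<epsilon>\<^sup>2))) * Phi p (1 / (X * t)) = (?N z t + ?N (cnj z) t) / 2" for t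
  proof -
    have aux: "of_real (a * r) * b = of_real a * b * of_real (2 * r) / 2" for a r and b :: complex by simp
    have eq: "?N z t + ?N (cnj z) t = of_real (t ^ (n - 1) * exp (- X * t)) * Phi p (1 / (X * t)) * of_real (2 * ((1 - t) / ((1 - t)\<^sup>2 + \<epsilon>\<^sup>2)))"
      unfolding kern [symmetric] by (simp add: ring_distribs)
    show ?thesis unfolding eq by (rule aux)
  qed
  show ?int unfolding N using F1 F2 by (intro set_integrable_divide set_integral_add)
  let ?G = "Gamma (1 - p) * rpow X (p - 1)"
  have "?G * (LINT t:{0<..}|lborel. of_real (t ^ (n - 1) * exp (- X * t) * ((1 - t) / ((1 - t)\<^sup>2 + \<epsilon>\<^sup>2))) * Phi p (1 / (X * t)))
    = (?G * (LINT t:{0<..}|lborel. ?N z t) + ?G * (LINT t:{0<..}|lborel. ?N (cnj z) t)) / 2"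
    unfolding N using F1 F2 by (simp add: set_integral_add ring_distribs)
  also have "\<dots> = of_real pi / sin (of_real pi * p) * (((LINT s:{0<..}|lborel. ?S z s) + (LINT s:{0<..}|lborel. ?S (cnj z) s)) / 2)"
    unfolding R1(2) R2(2) T_def by (simp add: ring_distribs add_divide_distrib)
  also have "(LINT s:{0<..}|lborel. ?S z s) + (LINT s:{0<..}|lborel. ?S (cnj z) s) = (LINT s:{0<..}|lborel. ?S z s + ?S (cnj z) s)"
    using R1(1) R2(1) unfolding T_def by (intro set_integral_add(2) [symmetric])
  also have "\<dots> / 2 = (LINT s:{0<..}|lborel. (?S z s + ?S (cnj z) s) / 2)"
    by (rule set_integral_divide_zero [symmetric])
  also have "(\<lambda>s. (?S z s + ?S (cnj z) s) / 2) = (\<lambda>s. of_real (exp (- X * s)) * rpow s (- p) *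
        ((z ^ (n - 1) * T z s + cnj z ^ (n - 1) * T (cnj z) s) / 2))"
    by (simp add: fun_eq_iff ring_distribs)
  finally show ?eq .
qed

text \<open>Dominated convergence as z -> 1. The range s < 1 gives Poisson's integral, the range s >
  1 gives the cosine times \<open>Phi p (1 / X)\<close> with its factor exp (- X), and the
  subtracted binomial polynomial gives the truncated divergent series through Gamma moments. The
  identity is exact for each admissible \<open>n\<close>, before any asymptotics.\<close>

lemma Phi_hyperterminant_limit:
  fixes p :: complex
  assumes p: "p \<notin> \<int>" "Re p < 1" "Re p + real n > 0" and n: "n > 0" and X: "X > 0"
  shows "(\<lambda>i. LINT t:{0<..}|lborel. of_real (t ^ (n - 1) * exp (- X * t) * ((1 - t) / ((1 - t)\<^sup>2 + (1 / real (Suc i))\<^sup>2))) * Phi p (1 / (X * t)))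
    \<longlonglongrightarrow> of_real pi / sin (of_real pi * p) *
      (rpow X (1 - p) * rGamma (1 - p) * (LINT s:{0<..<1}|lborel. of_real (exp (- X * s)) * (rpow s (- p) * rpow (1 - s) (- p)))
       + cos (of_real pi * p) * (of_real (exp (- X)) * Phi p (1 / X))
       - (\<Sum>k<n. pochhammer p k / fact k * pochhammer (1 - p) k / of_real X ^ k))"
proof -
  define z where "z = (\<lambda>i. Complex 1 (1 / real (Suc i)))"
  define P where "P = (\<lambda>u. \<Sum>k<n. pochhammer p k / fact k * u ^ k)"
  define T where "T = (\<lambda>z s. (1 - of_real s / z) powr (- p) - P (of_real s / z))"
  define W where "W = (\<lambda>s. of_real (exp (- X * s)) * rpow s (- p))"
  define G0 where "G0 = (\<lambda>s. indicator {0<..<1} s *\<^sub>R (of_real (exp (- X * s)) * (rpow s (- p) * rpow (1 - s) (- p))))"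
  define G1 where "G1 = (\<lambda>s. indicator {1<..} s *\<^sub>R (of_real (exp (- X * s)) * (rpow s (- p) * rpow (s - 1) (- p))))"
  define f where "f = (\<lambda>i s. indicator {0<..} s *\<^sub>R (W s * ((z i ^ (n - 1) * T (z i) s + cnj (z i) ^ (n - 1) * T (cnj (z i)) s) / 2)))"
  define g where "g = (\<lambda>s. G0 s + cos (of_real pi * p) * G1 s - indicator {0<..} s *\<^sub>R (W s * P (of_real s)))"
  have iG0: "integrable lborel G0" and iG1: "integrable lborel G1"
    using head_integrable[OF p(2) X] tail_integrable[OF p(2) X] by (simp_all add: G0_def G1_def set_integrable_def)
  have zR: "Re (z i) = 1" "Im (z i) > 0" "\<bar>Im (z i)\<bar> \<le> 1" for i by (auto simp: z_def)
  have zlim: "z \<longlonglongrightarrow> 1"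
  proof -
    have "(\<lambda>i. Complex 1 (1 / real (Suc i))) \<longlonglongrightarrow> Complex 1 0"
      by (intro tendsto_Complex tendsto_const LIMSEQ_Suc[OF lim_1_over_n])
    then show ?thesis by (simp add: z_def complex_eq_iff one_complex.code)
  qed
  have zclim: "(\<lambda>i. cnj (z i)) \<longlonglongrightarrow> 1" using tendsto_cnj[OF zlim] by simp
  obtain N :: nat where N: "- Re p \<le> real N" using real_arch_simple by blast
  \<comment> \<open>\<open>M1\<close> bounds the (n - 1)-st power of z, as |z| <= 2;
    \<open>E\<close> is the argument factor of \<open>norm_one_minus_divide_powr_le\<close>;
    \<open>2 powr Re p\<close> undoes the halving of |s - 1|; the power \<open>N\<close> absorbs (s
    + 2)^(- Re p); \<open>Q\<close> collects the coefficients of the polynomial.\<close>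
  define M1 where "M1 = (2::real) ^ (n - 1)"
  define E where "E = exp (pi * \<bar>Im p\<bar>)"
  define Q where "Q = (\<Sum>k<n. norm (pochhammer p k / fact k :: complex))"
  define B where "B = (\<lambda>s. M1 * (E * (2 powr Re p * (norm (G0 s) + norm (G1 s))
      + 2 ^ N * norm (indicator {0<..} s *\<^sub>R (of_real (exp (- X * s) * (1 + s) ^ N) * rpow s (- p))))
      + Q * norm (indicator {0<..} s *\<^sub>R (of_real (exp (- X * s) * (1 + s) ^ n) * rpow s (- p)))))"
  have iB: "integrable lborel B"
    unfolding B_def using iG0 iG1 set_integrable_power_weight[OF p(2) X, unfolded set_integrable_def]
    by (intro integrable_mult_right Bochner_Integration.integrable_add integrable_norm)
  have Pb: "norm (P u) \<le> Q * (1 + s) ^ n" if "norm u \<le> s" for u s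
  proof -
    have s0: "s \<ge> 0" using that norm_ge_zero[of u] by linarith
    have "norm (P u) \<le> (\<Sum>k<n. norm (pochhammer p k / fact k * u ^ k))" unfolding P_def by (rule norm_sum)
    also have "\<dots> \<le> (\<Sum>k<n. norm (pochhammer p k / fact k :: complex) * (1 + s) ^ n)"
    proof (rule sum_mono)
      fix k assume k: "k \<in> {..<n}"
      have "norm u ^ k \<le> (1 + s) ^ k" using that by (intro power_mono) auto
      also have "\<dots> \<le> (1 + s) ^ n" using k s0 by (intro power_increasing) auto
      finally show "norm (pochhammer p k / fact k * u ^ k) \<le> norm (pochhammer p k / fact k :: complex) * (1 + s) ^ n"
        unfolding norm_mult norm_power by (intro mult_left_mono) auto
    qed
    finally show ?thesis by (simp add: Q_def sum_distrib_right)
  qed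
  have zT: "norm (z' ^ (n - 1) * T z' s) \<le> M1 * (E * ((\<bar>s - 1\<bar> / 2) powr (- Re p) + (s + 2) powr (- Re p)) + Q * (1 + s) ^ n)"
    if z': "Re z' = 1" "\<bar>Im z'\<bar> \<le> 1" and s: "s > 0" "s \<noteq> 1" for z' s
  proof -
    have z1: "1 \<le> norm z'" using abs_Re_le_cmod[of z'] z' by simp
    have z2: "norm z' \<le> 2" using cmod_le[of z'] z' by simp
    have "norm (of_real s / z') \<le> s"
      using z1 s by (simp add: norm_divide divide_le_eq mult_le_cancel_left1)
    then have "norm (T z' s) \<le> ((\<bar>s - 1\<bar> / 2) powr (- Re p) + (s + 2) powr (- Re p)) * E + Q * (1 + s) ^ n"
      unfolding T_def E_def
      by (intro order_trans[OF norm_triangle_ineq4] add_mono norm_one_minus_divide_powr_le Pb s z')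
    moreover have "norm (z' ^ (n - 1)) \<le> M1" unfolding M1_def norm_power using z2 by (intro power_mono) auto
    ultimately show ?thesis unfolding norm_mult by (intro mult_mono) (auto simp: M1_def mult_ac)
  qed
  have bound: "norm (f i s) \<le> B s" if s1: "s \<noteq> 1" for i s
  proof (cases "s > 0")
    case s: True
    let ?R = "E * ((\<bar>s - 1\<bar> / 2) powr (- Re p) + (s + 2) powr (- Re p)) + Q * (1 + s) ^ n"
    have "norm ((z i ^ (n - 1) * T (z i) s + cnj (z i) ^ (n - 1) * T (cnj (z i)) s) / 2) \<le> (M1 * ?R + M1 * ?R) / 2"
      unfolding norm_divide using zR[of i] s s1
      by (intro divide_mono order_trans[OF norm_triangle_ineq] add_mono zT) auto
    then have "norm ((z i ^ (n - 1) * T (z i) s + cnj (z i) ^ (n - 1) * T (cnj (z i)) s) / 2) \<le> M1 * ?R" by simp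
    from mult_left_mono[OF this norm_ge_zero[of "W s"]]
    have 1: "norm (f i s) \<le> norm (W s) * (M1 * ?R)"
      unfolding f_def using s by (simp add: norm_mult)
    have a: "norm (W s) * (\<bar>s - 1\<bar> / 2) powr (- Re p) = 2 powr Re p * (norm (G0 s) + norm (G1 s))"
    proof -
      have "(\<bar>s - 1\<bar> / 2) powr (- Re p) = 2 powr Re p * \<bar>s - 1\<bar> powr (- Re p)"
        by (simp add: powr_divide powr_minus field_simps)
      moreover have "norm (G0 s) + norm (G1 s) = norm (W s) * \<bar>s - 1\<bar> powr (- Re p)"
        using s s1 by (cases "s < 1") (auto simp: G0_def G1_def W_def norm_mult norm_rpow mult_ac)
      ultimately show ?thesis by simp
    qed
    have b: "norm (W s) * (s + 2) powr (- Re p) \<le> 2 ^ N * (norm (W s) * (1 + s) ^ N)"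
    proof -
      have "(s + 2) powr (- Re p) \<le> (s + 2) powr real N" using s N by (intro powr_mono) auto
      also have "\<dots> = (s + 2) ^ N" using s by (simp add: powr_realpow)
      also have "\<dots> \<le> (2 * (1 + s)) ^ N" using s by (intro power_mono) auto
      finally have "(s + 2) powr (- Re p) \<le> 2 ^ N * (1 + s) ^ N" by (simp only: power_mult_distrib)
      from mult_left_mono[OF this norm_ge_zero[of "W s"]] show ?thesis by (simp add: mult_ac)
    qed
    have c: "norm (indicator {0<..} s *\<^sub>R (of_real (exp (- X * s) * (1 + s) ^ k) * rpow s (- p))) = norm (W s) * (1 + s) ^ k" for k
      using s by (simp add: W_def norm_mult abs_mult mult_ac del: of_real_mult of_real_add of_real_power)
    have "norm (W s) * ?R \<le> E * (2 powr Re p * (norm (G0 s) + norm (G1 s)) + 2 ^ N * (norm (W s) * (1 + s) ^ N)) + Q * (norm (W s) * (1 + s) ^ n)"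
    proof -
      have "norm (W s) * ?R = E * (norm (W s) * (\<bar>s - 1\<bar> / 2) powr (- Re p) + norm (W s) * (s + 2) powr (- Re p)) + Q * (norm (W s) * (1 + s) ^ n)"
        by (simp add: algebra_simps)
      also have "\<dots> \<le> E * (2 powr Re p * (norm (G0 s) + norm (G1 s)) + 2 ^ N * (norm (W s) * (1 + s) ^ N)) + Q * (norm (W s) * (1 + s) ^ n)"
        unfolding a using b by (intro add_mono mult_left_mono) (auto simp: E_def Q_def intro!: sum_nonneg)
      finally show ?thesis .
    qed
    from mult_left_mono[OF this, of M1] have "norm (W s) * (M1 * ?R) \<le> B s"
      unfolding B_def c by (simp add: M1_def mult_ac)
    with 1 show ?thesis by linarith
  next
    case False
    then have "f i s = 0" by (simp add: f_def)
    moreover have "B s \<ge> 0"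
      unfolding B_def M1_def E_def Q_def
      by (intro mult_nonneg_nonneg add_nonneg_nonneg sum_nonneg norm_ge_zero zero_le_power powr_ge_zero) auto
    ultimately show ?thesis by simp
  qed
  have conv: "(\<lambda>i. f i s) \<longlonglongrightarrow> g s" if s1: "s \<noteq> 1" for s
  proof (cases "s > 0")
    case s: True
    have l1: "(\<lambda>i. of_real s / z i) \<longlonglongrightarrow> of_real s" "(\<lambda>i. of_real s / cnj (z i)) \<longlonglongrightarrow> of_real s"
      using tendsto_divide[OF tendsto_const zlim, of "of_real s"] tendsto_divide[OF tendsto_const zclim, of "of_real s"] by auto
    let ?a = "\<lambda>i. (1 - of_real s / z i) powr (- p)" and ?b = "\<lambda>i. (1 - of_real s / cnj (z i)) powr (- p)"
    let ?L = "if s < 1 then rpow (1 - s) (- p) else cos (of_real pi * p) * rpow (s - 1) (- p)"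
    have av: "(\<lambda>i. (?a i + ?b i) / 2) \<longlonglongrightarrow> ?L"
      by (rule powr_boundary_average[OF s s1 zR(1) zR(2) zlim])
    have zp: "(\<lambda>i. z i ^ (n - 1)) \<longlonglongrightarrow> 1" "(\<lambda>i. cnj (z i) ^ (n - 1)) \<longlonglongrightarrow> 1"
      using tendsto_power[OF zlim, of "n - 1"] tendsto_power[OF zclim, of "n - 1"] by simp_all
    \<comment> \<open>\<open>av\<close> only controls the mean of the two powers, whereas they are
      multiplied by different factors \<open>z i ^ (n - 1)\<close> and its conjugate. Those factors
      are first replaced by 1: the error is a null sequence times a bounded one.\<close>
    have bd: "Bseq ?a" "Bseq ?b"
      using norm_one_minus_divide_powr_le[OF s s1, of "z _" p] norm_one_minus_divide_powr_le[OF s s1, of "cnj (z _)" p] zR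
      by (auto intro!: BseqI')
    have "(\<lambda>i. (z i ^ (n - 1) - 1) * ?a i) \<longlonglongrightarrow> 0"
      using bounded_bilinear.Zfun_prod_Bfun[OF bounded_bilinear_mult, OF zp(1)[unfolded tendsto_Zfun_iff] bd(1)]
      by (simp add: tendsto_Zfun_iff)
    moreover have "(\<lambda>i. (cnj (z i) ^ (n - 1) - 1) * ?b i) \<longlonglongrightarrow> 0"
      using bounded_bilinear.Zfun_prod_Bfun[OF bounded_bilinear_mult, OF zp(2)[unfolded tendsto_Zfun_iff] bd(2)]
      by (simp add: tendsto_Zfun_iff)
    ultimately have "(\<lambda>i. (?a i + ?b i) / 2 + ((z i ^ (n - 1) - 1) * ?a i + (cnj (z i) ^ (n - 1) - 1) * ?b i) / 2
       - (z i ^ (n - 1) * P (of_real s / z i) + cnj (z i) ^ (n - 1) * P (of_real s / cnj (z i))) / 2) \<longlonglongrightarrow>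
       ?L + (0 + 0) / 2 - (1 * P (of_real s) + 1 * P (of_real s)) / 2"
      unfolding P_def by (intro tendsto_intros av zp l1) auto
    also have "(\<lambda>i. (?a i + ?b i) / 2 + ((z i ^ (n - 1) - 1) * ?a i + (cnj (z i) ^ (n - 1) - 1) * ?b i) / 2
       - (z i ^ (n - 1) * P (of_real s / z i) + cnj (z i) ^ (n - 1) * P (of_real s / cnj (z i))) / 2)
       = (\<lambda>i. (z i ^ (n - 1) * T (z i) s + cnj (z i) ^ (n - 1) * T (cnj (z i)) s) / 2)"
      by (simp add: T_def fun_eq_iff field_simps)
    finally have "(\<lambda>i. W s * ((z i ^ (n - 1) * T (z i) s + cnj (z i) ^ (n - 1) * T (cnj (z i)) s) / 2)) \<longlonglongrightarrow>
       W s * (?L + (0 + 0) / 2 - (1 * P (of_real s) + 1 * P (of_real s)) / 2)"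
      by (intro tendsto_mult tendsto_const)
    moreover have "g s = W s * (?L + (0 + 0) / 2 - (1 * P (of_real s) + 1 * P (of_real s)) / 2)"
      using s s1 by (simp add: g_def G0_def G1_def W_def algebra_simps)
    ultimately show ?thesis using s by (simp add: f_def)
  next
    case False
    then show ?thesis by (simp add: f_def g_def G0_def G1_def)
  qed
  have fm: "f i \<in> borel_measurable lborel" for i
  proof -
    have "(\<lambda>s::real. (1 - of_real s / z') powr (- p)) \<in> borel_measurable borel" for z'
      unfolding powr_def by (measurable)
    then show ?thesis unfolding f_def W_def T_def P_def by measurable
  qed
  have gm: "g \<in> borel_measurable lborel"
    unfolding g_def W_def P_def G0_def G1_def by measurable
  have lim: "(\<lambda>i. integral\<^sup>L lborel (f i)) \<longlonglongrightarrow> integral\<^sup>L lborel g"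
  proof (rule integral_dominated_convergence[OF gm fm iB])
    show "AE s in lborel. (\<lambda>i. f i s) \<longlonglongrightarrow> g s"
      using AE_lborel_singleton[of "1::real"] by eventually_elim (rule conv)
    show "AE s in lborel. norm (f i s) \<le> B s" for i
      using AE_lborel_singleton[of "1::real"] by eventually_elim (rule bound)
  qed
  have Pint: "set_integrable lborel {0<..} (\<lambda>s. pochhammer p k / fact k * (W s * of_real s ^ k))" for k
    unfolding W_def by (intro set_integrable_mult_right Gamma_power_term(1) p(2) X)
  have PW: "(\<lambda>s. indicator {0<..} s *\<^sub>R (W s * P (of_real s))) = (\<lambda>s. \<Sum>k<n. indicator {0<..} s *\<^sub>R (pochhammer p k / fact k * (W s * of_real s ^ k)))"
    by (simp add: P_def sum_distrib_left scaleR_sum_right fun_eq_iff mult_ac)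
  have iPW: "integrable lborel (\<lambda>s. indicator {0<..} s *\<^sub>R (W s * P (of_real s)))"
    unfolding PW using Pint by (intro Bochner_Integration.integrable_sum) (simp add: set_integrable_def)
  let ?GX = "Gamma (1 - p) * rpow X (p - 1)"
  have vPW: "(\<integral>s. indicator {0<..} s *\<^sub>R (W s * P (of_real s)) \<partial>lborel) = ?GX * (\<Sum>k<n. pochhammer p k / fact k * pochhammer (1 - p) k / of_real X ^ k)"
  proof -
    have "(\<integral>s. indicator {0<..} s *\<^sub>R (W s * P (of_real s)) \<partial>lborel) = (\<Sum>k<n. LINT s:{0<..}|lborel. pochhammer p k / fact k * (W s * of_real s ^ k))"
      unfolding PW set_lebesgue_integral_def using Pint
      by (intro Bochner_Integration.integral_sum) (simp add: set_integrable_def)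
    also have "\<dots> = (\<Sum>k<n. pochhammer p k / fact k * (?GX * (pochhammer (1 - p) k / of_real X ^ k)))"
      unfolding W_def by (simp only: set_integral_mult_right Gamma_power_term(2)[OF p(2) X])
    finally show ?thesis by (simp add: sum_distrib_left mult_ac)
  qed
  define J0 where "J0 = (LINT s:{0<..<1}|lborel. of_real (exp (- X * s)) * (rpow s (- p) * rpow (1 - s) (- p)))"
  have "integral\<^sup>L lborel g = integral\<^sup>L lborel G0 + cos (of_real pi * p) * integral\<^sup>L lborel G1 - (\<integral>s. indicator {0<..} s *\<^sub>R (W s * P (of_real s)) \<partial>lborel)"
    unfolding g_def using iG0 iG1 iPW by simp
  also have "integral\<^sup>L lborel G0 = J0" by (simp add: G0_def J0_def set_lebesgue_integral_def)
  also have "integral\<^sup>L lborel G1 = ?GX * (of_real (exp (- X)) * Phi p (1 / X))"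
    unfolding G1_def using tail_integral[OF p(2) X] by (simp add: set_lebesgue_integral_def)
  finally have gv: "integral\<^sup>L lborel g = J0 + cos (of_real pi * p) * (?GX * (of_real (exp (- X)) * Phi p (1 / X)))
     - ?GX * (\<Sum>k<n. pochhammer p k / fact k * pochhammer (1 - p) k / of_real X ^ k)"
    unfolding vPW .
  have GX0: "Gamma (1 - p) \<noteq> 0" using p Gamma_nonzero_right_halfplane[of "1 - p"] by simp
  have inv: "inverse ?GX = rpow X (1 - p) * rGamma (1 - p)"
    using rpow_minus[of X "p - 1"] by (simp add: rGamma_inverse_Gamma)
  have V: "(LINT t:{0<..}|lborel. of_real (t ^ (n - 1) * exp (- X * t) * ((1 - t) / ((1 - t)\<^sup>2 + (1 / real (Suc i))\<^sup>2))) * Phi p (1 / (X * t)))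
    = inverse ?GX * (of_real pi / sin (of_real pi * p)) * integral\<^sup>L lborel (f i)" for i
  proof -
    have aux: "L = inverse G * C * S" if "G \<noteq> 0" "G * L = C * S" for G L C S :: complex
      using that by (simp add: field_simps)
    show ?thesis
      using Phi_Stieltjes_average(2)[OF p n X, of "1 / real (Suc i)"] GX0
      unfolding f_def W_def T_def P_def z_def set_lebesgue_integral_def by (intro aux) simp_all
  qed
  have "(\<lambda>i. inverse ?GX * (of_real pi / sin (of_real pi * p)) * integral\<^sup>L lborel (f i))
    \<longlonglongrightarrow> inverse ?GX * (of_real pi / sin (of_real pi * p)) * integral\<^sup>L lborel g"
    by (intro tendsto_mult tendsto_const lim)
  also have "inverse ?GX * (of_real pi / sin (of_real pi * p)) * integral\<^sup>L lborel g =
     of_real pi / sin (of_real pi * p) * (inverse ?GX * J0 + cos (of_real pi * p) * (of_real (exp (- X)) * Phi p (1 / X))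
       - (\<Sum>k<n. pochhammer p k / fact k * pochhammer (1 - p) k / of_real X ^ k))"
    unfolding gv using GX0 by (simp add: field_simps)
  finally show ?thesis unfolding V inv J0_def .
qed

section \<open>The connection formula\<close>

text \<open>The factor (1 + v y)^(-p) is itself a Laplace integral in a second variable w, which
  requires Re p > 0. The exponent - v - w - v w y of the resulting double integral is symmetric in v
  and w.\<close>

lemma Phi_double_integral:
  assumes p: "0 < Re p" "Re p < 1" and y: "y > 0"
  defines "D \<equiv> \<lambda>p v w. if 0 < v \<and> 0 < w then of_real (exp (- v - w - v * w * y)) * rpow v (- p) * rpow w (p - 1) else 0"
  shows "Phi p y = rGamma p * rGamma (1 - p) * (\<integral>v. (\<integral>w. D p v w \<partial>lborel) \<partial>lborel)"
    and "integrable (lborel \<Otimes>\<^sub>M lborel) (case_prod (D p))"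
proof -
  have inner: "(\<integral>w. D p v w \<partial>lborel) = indicator {0<..} v *\<^sub>R (Gamma p * (of_real (exp (- v)) * rpow v (- p) * rpow (1 + v * y) (- p)))" for v
  proof (cases "v > 0")
    case True
    have "D p v = (\<lambda>w. of_real (exp (- v)) * rpow v (- p) * (indicator {0<..} w *\<^sub>R (rpow w (p - 1) * of_real (exp (- (1 + v * y) * w)))))"
    proof
      fix w
      have "exp (- v - w - v * w * y) = exp (- v) * exp (- (1 + v * y) * w)"
        by (simp add: algebra_simps flip: exp_add)
      then show "D p v w = of_real (exp (- v)) * rpow v (- p) * (indicator {0<..} w *\<^sub>R (rpow w (p - 1) * of_real (exp (- (1 + v * y) * w))))"
        using True by (cases "w > 0") (simp_all add: D_def mult_ac)
    qed
    then have "(\<integral>w. D p v w \<partial>lborel) = of_real (exp (- v)) * rpow v (- p) * (LINT w:{0<..}|lborel. rpow w (p - 1) * of_real (exp (- (1 + v * y) * w)))"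
      unfolding set_lebesgue_integral_def by (simp only: integral_mult_right_zero)
    also have "(LINT w:{0<..}|lborel. rpow w (p - 1) * of_real (exp (- (1 + v * y) * w))) = Gamma p * rpow (1 + v * y) (- p)"
      using p y True by (intro set_integral_Gamma_laplace) (auto intro: add_pos_pos)
    finally show ?thesis using True by simp
  qed (simp add: D_def)
  have "(\<integral>v. (\<integral>w. D p v w \<partial>lborel) \<partial>lborel) = Gamma p * (LINT v:{0<..}|lborel. of_real (exp (- v)) * rpow v (- p) * rpow (1 + v * y) (- p))"
    unfolding inner set_lebesgue_integral_def by (subst integral_mult_right_zero [symmetric]) (simp only: mult_scaleR_right)
  then show "Phi p y = rGamma p * rGamma (1 - p) * (\<integral>v. (\<integral>w. D p v w \<partial>lborel) \<partial>lborel)"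
    using p Gamma_nonzero_right_halfplane[of p] by (simp add: Phi_def rGamma_inverse_Gamma)
  have wq: "set_integrable lborel {0<..} (\<lambda>w. rpow w (p - 1) * of_real (exp (- 1 * w)))"
    using p by (intro set_integrable_Gamma_laplace) auto
  have vq: "set_integrable lborel {0<..} (\<lambda>v. rpow v ((1 - p) - 1) * of_real (exp (- 1 * v)))"
    using p by (intro set_integrable_Gamma_laplace) auto
  let ?b = "\<lambda>w. norm (indicator {0<..} w *\<^sub>R (rpow w (p - 1) * of_real (exp (- 1 * w))))"
  let ?a = "\<lambda>v. norm (indicator {0<..} v *\<^sub>R (rpow v ((1 - p) - 1) * of_real (exp (- 1 * v))))"
  have ib: "integrable lborel ?b" and ia: "integrable lborel ?a"
    using integrable_norm[OF wq[unfolded set_integrable_def]] integrable_norm[OF vq[unfolded set_integrable_def]] by simp_all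
  have Db: "norm (D p v w) \<le> ?a v * ?b w" for v w
  proof (cases "0 < v \<and> 0 < w")
    case True
    have "exp (- v - w - v * w * y) \<le> exp (- v) * exp (- w)"
      using True y by (simp flip: exp_add)
    from mult_right_mono[OF this, of "norm (rpow v (- p) * rpow w (p - 1))"]
    show ?thesis using True by (simp add: D_def norm_mult mult_ac)
  next
    case False
    then have "D p v w = 0" by (auto simp: D_def)
    then show ?thesis by simp
  qed
  have m: "case_prod (D p) \<in> borel_measurable (lborel \<Otimes>\<^sub>M lborel)"
    unfolding D_def case_prod_unfold by measurable
  have mv: "D p v \<in> borel_measurable lborel" for v
    unfolding D_def by measurable
  have iD: "integrable lborel (D p v)" for v
    by (rule Bochner_Integration.integrable_bound[OF integrable_mult_right[OF ib, of "?a v"] mv]) (use Db in \<open>simp add: AE_I2 abs_mult\<close>)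
  show "integrable (lborel \<Otimes>\<^sub>M lborel) (case_prod (D p))"
  proof (rule lborel_pair.Fubini_integrable[OF m])
    have [measurable]: "(\<lambda>x. norm (D p (fst x) (snd x))) \<in> borel_measurable (lborel \<Otimes>\<^sub>M lborel)"
      using m by (simp add: case_prod_unfold)
    have le: "(\<integral>w. norm (D p v w) \<partial>lborel) \<le> ?a v * (\<integral>w. ?b w \<partial>lborel)" for v
    proof -
      have "(\<integral>w. norm (D p v w) \<partial>lborel) \<le> (\<integral>w. ?a v * ?b w \<partial>lborel)"
        by (rule Bochner_Integration.integral_mono[OF integrable_norm[OF iD] integrable_mult_right[OF ib] Db])
      then show ?thesis by (simp only: integral_mult_right_zero)
    qed
    show "integrable lborel (\<lambda>v. \<integral>w. norm (case_prod (D p) (v, w)) \<partial>lborel)"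
    proof (rule Bochner_Integration.integrable_bound[OF integrable_mult_left[OF ia, of "\<integral>w. ?b w \<partial>lborel"]])
      have "(\<lambda>v. \<integral>w. norm (D p v w) \<partial>lborel) \<in> borel_measurable lborel" by measurable
      then show "(\<lambda>v. \<integral>w. norm (case_prod (D p) (v, w)) \<partial>lborel) \<in> borel_measurable lborel" by simp
      show "AE v in lborel. norm (\<integral>w. norm (case_prod (D p) (v, w)) \<partial>lborel) \<le> norm (?a v * (\<integral>w. ?b w \<partial>lborel))"
      proof (rule AE_I2)
        fix v
        show "norm (\<integral>w. norm (case_prod (D p) (v, w)) \<partial>lborel) \<le> norm (?a v * (\<integral>w. ?b w \<partial>lborel))"
          using le[of v] unfolding real_norm_def split
          by (subst abs_of_nonneg) (auto intro: order_trans[OF _ abs_ge_self] Bochner_Integration.integral_nonneg)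
      qed
    qed
  qed (use iD in simp)
qed

text \<open>Replacing p by 1 - p exchanges the exponents of v and w, so Fubini's theorem gives the
  claim. In terms of Macdonald functions this is evenness in the order, since 1/2 - p changes
  sign.\<close>

lemma Phi_reflect:
  assumes p: "0 < Re p" "Re p < 1" and y: "y > 0"
  shows "Phi (1 - p) y = Phi p y"
proof -
  let ?D = "\<lambda>p v w. if 0 < v \<and> 0 < w then of_real (exp (- v - w - v * w * y)) * rpow v (- p) * rpow w (p - 1) else 0"
  have sym: "?D (1 - p) v w = ?D p w v" for v w
    by (simp add: algebra_simps)
  have "Phi (1 - p) y = rGamma (1 - p) * rGamma p * (\<integral>v. (\<integral>w. ?D (1 - p) v w \<partial>lborel) \<partial>lborel)"
    using Phi_double_integral(1)[of "1 - p" y] p y by simp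
  also have "(\<integral>v. (\<integral>w. ?D (1 - p) v w \<partial>lborel) \<partial>lborel) = (\<integral>v. (\<integral>w. ?D p w v \<partial>lborel) \<partial>lborel)"
    unfolding sym ..
  also have "\<dots> = (\<integral>w. (\<integral>v. ?D p w v \<partial>lborel) \<partial>lborel)"
    by (rule lborel_pair.Fubini_integral[OF Phi_double_integral(2)[OF p y]])
  finally show ?thesis unfolding Phi_double_integral(1)[OF p y] by (simp only: mult.commute[of "rGamma p"])
qed

text \<open>The modulus of the integrand depends on p only through a power of v (1 + v y). According
  to whether this base is at least or below 1, the power is dominated by the one at
  \<open>Re p0 - r\<close> or at \<open>Re p0 + r\<close>; their sum dominates throughout.\<close>

lemma holomorphic_Phi:
  assumes y: "y > 0"
  shows "(\<lambda>p. Phi p y) holomorphic_on {p. Re p < 1}"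
proof -
  let ?F = "\<lambda>p v. indicator {0<..} v *\<^sub>R (of_real (exp (- v)) * rpow v (- p) * rpow (1 + v * y) (- p))"
  have "(\<lambda>p. \<integral>v. ?F p v \<partial>lborel) holomorphic_on {p. Re p < 1}"
  proof (rule holomorphic_on_integral)
    show "open {p. Re p < 1}" by (rule open_halfspace_Re_lt)
    fix p0 :: complex assume "p0 \<in> {p. Re p < 1}"
    then have p0: "Re p0 < 1" by simp
    define r where "r = (1 - Re p0) / 2"
    have r: "r > 0" "Re p0 + r < 1" using p0 by (auto simp: r_def field_simps)
    let ?g = "\<lambda>v. norm (?F (of_real (Re p0 + r)) v) + norm (?F (of_real (Re p0 - r)) v)"
    have "integrable lborel ?g"
      using set_integrable_Phi[of "of_real (Re p0 + r)" y] set_integrable_Phi[of "of_real (Re p0 - r)" y] y r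
      unfolding set_integrable_def by (intro Bochner_Integration.integrable_add integrable_norm) auto
    moreover have "norm (?F p v) \<le> ?g v" if p: "p \<in> ball p0 r" for p v
    proof (cases "v > 0")
      case True
      have u: "1 + v * y > 0" using True y by (intro add_pos_pos) auto
      have n: "norm (?F p v) = exp (- v) * (v * (1 + v * y)) powr (- Re p)" for p
        using True u by (simp add: norm_mult norm_rpow powr_mult)
      have R: "\<bar>Re p - Re p0\<bar> < r"
        using p abs_Re_le_cmod[of "p - p0"] by (simp add: dist_norm norm_minus_commute)
      have "(v * (1 + v * y)) powr (- Re p) \<le> (v * (1 + v * y)) powr (- (Re p0 + r)) + (v * (1 + v * y)) powr (- (Re p0 - r))"
      proof (cases "v * (1 + v * y) \<ge> 1")
        case t: True
        have "(v * (1 + v * y)) powr (- Re p) \<le> (v * (1 + v * y)) powr (- (Re p0 - r))"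
          using t R by (intro powr_mono) auto
        then show ?thesis by (simp add: add_increasing)
      next
        case False
        then have "(v * (1 + v * y)) powr (- Re p) \<le> (v * (1 + v * y)) powr (- (Re p0 + r))"
          using R True u by (intro powr_mono') auto
        then show ?thesis by (simp add: add_increasing2)
      qed
      from mult_left_mono[OF this, of "exp (- v)"] show ?thesis
        unfolding n by (simp add: ring_distribs)
    qed simp
    ultimately show "\<exists>r>0. \<exists>g. integrable lborel g \<and> (\<forall>p\<in>ball p0 r \<inter> {p. Re p < 1}. \<forall>v\<in>space lborel. norm (?F p v) \<le> g v)"
      using r(1) by (intro exI[of _ r] exI[of _ ?g] conjI ballI) blast+
  qed (auto intro!: holomorphic_intros)
  then show ?thesis
    unfolding Phi_def set_lebesgue_integral_def by (intro holomorphic_intros)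
qed

section \<open>The Bessel series as an entire function of the order\<close>

lemma norm_rGamma_shift_le:
  assumes "Re z \<ge> 1"
  shows "norm (rGamma (z + of_nat k)) \<le> norm (rGamma (z :: complex))"
proof (induction k)
  case (Suc k)
  have "1 \<le> norm (z + of_nat k)" using assms abs_Re_le_cmod[of "z + of_nat k"] by simp
  then have "norm (rGamma (z + of_nat (Suc k))) \<le> norm (z + of_nat k) * norm (rGamma (z + of_nat (Suc k)))"
    by (simp add: mult_le_cancel_right1)
  also have "\<dots> = norm (rGamma (z + of_nat k))"
    using rGamma_plus1[of "z + of_nat k"] by (simp add: norm_mult [symmetric] add_ac)
  finally show ?case using Suc.IH by simp
qed simp

text \<open>Weierstrass test on unit discs. From an index \<open>K\<close> with
  \<open>norm \<nu>0 + 1 \<le> real K\<close> on, the argument of \<open>rGamma\<close> has real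
  part at least 1, where each further shift by one can only decrease the modulus; the bound at
  \<open>K\<close> thus serves for all later terms.\<close>

lemma holomorphic_Bessel_series:
  "(\<lambda>\<nu>. \<Sum>k. of_real (x ^ (2 * k) / fact k) * rGamma (of_nat k + \<nu> + 1)) holomorphic_on UNIV"
proof (rule holomorphic_uniform_sequence[where f = "\<lambda>N \<nu>. \<Sum>k<N. of_real (x ^ (2 * k) / fact k) * rGamma (of_nat k + \<nu> + 1)"])
  show "\<exists>d>0. cball \<nu>0 d \<subseteq> UNIV \<and> uniform_limit (cball \<nu>0 d)
      (\<lambda>N \<nu>. \<Sum>k<N. of_real (x ^ (2 * k) / fact k) * rGamma (of_nat k + \<nu> + 1))
      (\<lambda>\<nu>. \<Sum>k. of_real (x ^ (2 * k) / fact k) * rGamma (of_nat k + \<nu> + 1)) sequentially" for \<nu>0 :: complex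
  proof -
    obtain K :: nat where K: "norm \<nu>0 + 1 \<le> real K" using real_arch_simple by blast
    have "compact ((\<lambda>\<nu>. rGamma (of_nat K + \<nu> + 1)) ` cball \<nu>0 1)"
      by (intro compact_continuous_image continuous_intros holomorphic_on_imp_continuous_on holomorphic_intros compact_cball)
    then have "bounded ((\<lambda>\<nu>. rGamma (of_nat K + \<nu> + 1)) ` cball \<nu>0 1)" by (rule compact_imp_bounded)
    then obtain C where C: "\<And>\<nu>. \<nu> \<in> cball \<nu>0 1 \<Longrightarrow> norm (rGamma (of_nat K + \<nu> + 1)) \<le> C"
      unfolding bounded_iff by blast
    have bd: "norm (rGamma (of_nat k + \<nu> + 1)) \<le> C" if "\<nu> \<in> cball \<nu>0 1" "k \<ge> K" for \<nu> :: complex and k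
    proof -
      have "- Re \<nu> \<le> norm \<nu>" using abs_Re_le_cmod[of \<nu>] by simp
      also have "norm \<nu> \<le> norm \<nu>0 + 1"
        using that(1) norm_triangle_ineq[of \<nu>0 "\<nu> - \<nu>0"] by (simp add: dist_norm norm_minus_commute)
      finally have "Re (of_nat K + \<nu> + 1) \<ge> 1" using K by simp
      from norm_rGamma_shift_le[OF this, of "k - K"] have "norm (rGamma (of_nat k + \<nu> + 1)) \<le> norm (rGamma (of_nat K + \<nu> + 1))"
        using that(2) by (simp add: of_nat_diff add_ac)
      then show ?thesis using C[OF that(1)] by linarith
    qed
    have "uniform_limit (cball \<nu>0 1)
      (\<lambda>N \<nu>. \<Sum>k<N. of_real (x ^ (2 * k) / fact k) * rGamma (of_nat k + \<nu> + 1))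
      (\<lambda>\<nu>. \<Sum>k. of_real (x ^ (2 * k) / fact k) * rGamma (of_nat k + \<nu> + 1)) sequentially"
    proof (rule Weierstrass_m_test_ev)
      show "\<forall>\<^sub>F k in sequentially. \<forall>\<nu>\<in>cball \<nu>0 1. norm (of_real (x ^ (2 * k) / fact k) * rGamma (of_nat k + \<nu> + 1)) \<le> (x\<^sup>2) ^ k / fact k * C"
      proof (rule eventually_sequentiallyI[of K], intro ballI)
        fix k \<nu> assume "K \<le> k" "\<nu> \<in> cball \<nu>0 1"
        then have "norm (complex_of_real (x ^ (2 * k) / fact k)) * norm (rGamma (of_nat k + \<nu> + 1)) \<le> norm (complex_of_real (x ^ (2 * k) / fact k)) * C"
          by (intro mult_left_mono bd) auto
        then show "norm (of_real (x ^ (2 * k) / fact k) * rGamma (of_nat k + \<nu> + 1)) \<le> (x\<^sup>2) ^ k / fact k * C"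
          by (simp only: norm_mult norm_of_real power_mult) simp
      qed
      show "summable (\<lambda>k. (x\<^sup>2) ^ k / fact k * C)"
        using summable_exp[of "x\<^sup>2"] by (intro summable_mult2) (simp add: field_simps)
    qed
    then show ?thesis by (intro exI[of _ 1]) auto
  qed
qed (auto intro!: holomorphic_intros)

text \<open>This is I of order \<open>\<nu>\<close> at the positive point x, and by
  \<open>besselI_at_negative_real\<close> also the left-hand side of the theorem; in this form it is
  entire in \<open>\<nu>\<close>.\<close>

definition bessel_series :: "real \<Rightarrow> complex \<Rightarrow> complex" where
  "bessel_series x \<nu> = rpow (x / 2) \<nu> * (\<Sum>k. of_real ((x / 2) ^ (2 * k) / fact k) * rGamma (of_nat k + \<nu> + 1))"

text \<open>The limit identity with X = 2 x and Poisson's integral replaced by the Bessel series;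
  \<open>Re p < 1\<close> is the condition for Poisson's integral at order 1/2 - p.\<close>

lemma bessel_series_eq_limit:
  assumes x: "x > 0" and p: "p \<notin> \<int>" "Re p < 1" "Re p + real n > 0" and n: "n > 0"
  shows "(\<lambda>i. LINT t:{0<..}|lborel. of_real (t ^ (n - 1) * exp (- (2 * x) * t) * ((1 - t) / ((1 - t)\<^sup>2 + (1 / real (Suc i))\<^sup>2))) * Phi p (1 / (2 * x * t)))
    \<longlonglongrightarrow> of_real pi / sin (of_real pi * p) *
      (bessel_series x (1/2 - p) / of_real (exp x / sqrt (2 * pi * x))
       + cos (of_real pi * p) * (of_real (exp (- (2 * x))) * Phi p (1 / (2 * x)))
       - (\<Sum>k<n. pochhammer p k / fact k * pochhammer (1 - p) k / of_real (2 * x) ^ k))"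
proof -
  have b: "bessel_series x (1/2 - p) = of_real (exp x / sqrt (2 * pi * x)) * (rpow (2 * x) (1 - p) * rGamma (1 - p) *
      (LINT s:{0<..<1}|lborel. of_real (exp (- (2 * x) * s)) * (rpow s (- p) * rpow (1 - s) (- p))))"
    using besselI_poisson[OF x, of "1/2 - p"] besselI_at_negative_real[OF x, of "1/2 - p"] p
    by (simp add: bessel_series_def)
  have nz: "complex_of_real (exp x / sqrt (2 * pi * x)) \<noteq> 0" using x by simp
  have c: "bessel_series x (1/2 - p) / of_real (exp x / sqrt (2 * pi * x)) = rpow (2 * x) (1 - p) * rGamma (1 - p) *
      (LINT s:{0<..<1}|lborel. of_real (exp (- (2 * x) * s)) * (rpow s (- p) * rpow (1 - s) (- p)))"
    unfolding b using nz by (rule nonzero_mult_div_cancel_left)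
  show ?thesis unfolding c using x by (intro Phi_hyperterminant_limit p n) auto
qed

text \<open>In the strip both p and 1 - p are admissible. With n = 1 the two principal value
  integrals coincide by \<open>Phi_reflect\<close>, sin (pi p) is unchanged and cos (pi p) changes
  sign, so uniqueness of the limit yields the classical formula I_(-\<mu>) - I_\<mu> = (2 / pi) sin
  (pi \<mu>) K_\<mu> with \<mu> = 1/2 - p.\<close>

lemma bessel_connection_strip:
  assumes x: "x > 0" and p: "0 < Re p" "Re p < 1"
  shows "bessel_series x (p - 1/2) - bessel_series x (1/2 - p)
    = of_real (exp x / sqrt (2 * pi * x)) * (2 * cos (of_real pi * p) * (of_real (exp (- (2 * x))) * Phi p (1 / (2 * x))))"
proof -
  have pZ: "p \<notin> \<int>" "1 - p \<notin> \<int>"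
  proof -
    show 1: "p \<notin> \<int>" using p by (auto elim!: Ints_cases)
    show "1 - p \<notin> \<int>" using 1 Ints_diff[of 1 "1 - p"] by auto
  qed
  define E where "E = complex_of_real (exp x / sqrt (2 * pi * x))"
  have E: "E \<noteq> 0" using x by (simp add: E_def)
  let ?V = "\<lambda>p i. LINT t:{0<..}|lborel. of_real (t ^ (1 - 1) * exp (- (2 * x) * t) * ((1 - t) / ((1 - t)\<^sup>2 + (1 / real (Suc i))\<^sup>2))) * Phi p (1 / (2 * x * t))"
  have V: "?V (1 - p) i = ?V p i" for i
    using x by (intro set_lebesgue_integral_cong allI impI) (auto simp: Phi_reflect[OF p])
  have s: "sin (of_real pi * (1 - p)) = sin (of_real pi * p)" "cos (of_real pi * (1 - p)) = - cos (of_real pi * p)"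
    by (simp_all add: sin_diff cos_diff right_diff_distrib)
  have sin0: "sin (of_real pi * p) \<noteq> 0"
  proof
    assume "sin (of_real pi * p) = 0"
    then obtain k :: int where "of_real pi * p = of_real (of_int k * pi)"
      unfolding sin_eq_0 by (auto simp: mult_ac)
    then have "p = of_int k" by (simp add: field_simps)
    then show False using pZ by simp
  qed
  have L1: "?V p \<longlonglongrightarrow> of_real pi / sin (of_real pi * p) *
      (bessel_series x (1/2 - p) / E + cos (of_real pi * p) * (of_real (exp (- (2 * x))) * Phi p (1 / (2 * x))) - 1)"
    using bessel_series_eq_limit[OF x pZ(1), of 1] p by (simp add: E_def)
  have L2: "?V (1 - p) \<longlonglongrightarrow> of_real pi / sin (of_real pi * p) *
      (bessel_series x (p - 1/2) / E - cos (of_real pi * p) * (of_real (exp (- (2 * x))) * Phi p (1 / (2 * x))) - 1)"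
    using bessel_series_eq_limit[OF x pZ(2), of 1] p x unfolding s by (simp add: E_def Phi_reflect[OF p])
  have "of_real pi / sin (of_real pi * p) *
      (bessel_series x (1/2 - p) / E + cos (of_real pi * p) * (of_real (exp (- (2 * x))) * Phi p (1 / (2 * x))) - 1)
    = of_real pi / sin (of_real pi * p) *
      (bessel_series x (p - 1/2) / E - cos (of_real pi * p) * (of_real (exp (- (2 * x))) * Phi p (1 / (2 * x))) - 1)"
    using LIMSEQ_unique[OF L1] L2 unfolding V by blast
  then have "bessel_series x (1/2 - p) / E + cos (of_real pi * p) * (of_real (exp (- (2 * x))) * Phi p (1 / (2 * x))) - 1
     = bessel_series x (p - 1/2) / E - cos (of_real pi * p) * (of_real (exp (- (2 * x))) * Phi p (1 / (2 * x))) - 1"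
    using sin0 by simp
  then have "bessel_series x (p - 1/2) / E - bessel_series x (1/2 - p) / E
     = 2 * cos (of_real pi * p) * (of_real (exp (- (2 * x))) * Phi p (1 / (2 * x)))"
    by (simp add: algebra_simps)
  then have "(bessel_series x (p - 1/2) - bessel_series x (1/2 - p)) / E
     = 2 * cos (of_real pi * p) * (of_real (exp (- (2 * x))) * Phi p (1 / (2 * x)))"
    by (simp add: diff_divide_distrib)
  then show ?thesis using E unfolding E_def [symmetric] by (simp add: field_simps)
qed

text \<open>Both sides are holomorphic in p on \<open>Re p < 1\<close>, hence agree there. The gain
  is the range \<open>Re p \<le> 0\<close>, that is, orders p - 1/2 for which Poisson's integral
  diverges.\<close>

lemma bessel_connection:
  assumes x: "x > 0" and p: "Re p < 1"
  shows "bessel_series x (p - 1/2) - bessel_series x (1/2 - p)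
    = of_real (exp x / sqrt (2 * pi * x)) * (2 * cos (of_real pi * p) * (of_real (exp (- (2 * x))) * Phi p (1 / (2 * x))))"
proof -
  have hol: "bessel_series x holomorphic_on UNIV"
    unfolding bessel_series_def by (intro holomorphic_intros holomorphic_Bessel_series)
  have h1: "(\<lambda>p. bessel_series x (p - 1/2)) holomorphic_on A" "(\<lambda>p. bessel_series x (1/2 - p)) holomorphic_on A" for A
  proof -
    have "(\<lambda>p. p - 1/2) holomorphic_on A" "(\<lambda>p. 1/2 - p) holomorphic_on A" by (intro holomorphic_intros)+
    from this[THEN holomorphic_on_compose_gen, OF hol]
    show "(\<lambda>p. bessel_series x (p - 1/2)) holomorphic_on A" "(\<lambda>p. bessel_series x (1/2 - p)) holomorphic_on A"
      by (simp_all add: o_def)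
  qed
  have "{p. 0 < Re p \<and> Re p < 1} = {p. 0 < Re p} \<inter> {p. Re p < 1}" by auto
  then have op: "open {p. 0 < Re p \<and> Re p < 1}"
    by (simp add: open_Int open_halfspace_Re_gt open_halfspace_Re_lt)
  have ne: "{p. 0 < Re p \<and> Re p < 1} \<noteq> {}" by (auto intro!: exI[of _ "1/2"])
  show ?thesis
  proof (rule analytic_continuation_open[of "{p. 0 < Re p \<and> Re p < 1}" "{p. Re p < 1}"
      "\<lambda>p. bessel_series x (p - 1/2) - bessel_series x (1/2 - p)"
      "\<lambda>p. of_real (exp x / sqrt (2 * pi * x)) * (2 * cos (of_real pi * p) * (of_real (exp (- (2 * x))) * Phi p (1 / (2 * x))))"])
    show "connected {p. Re p < 1}" by (intro convex_connected convex_halfspace_Re_lt)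
    show "(\<lambda>p. of_real (exp x / sqrt (2 * pi * x)) * (2 * cos (of_real pi * p) * (of_real (exp (- (2 * x))) * Phi p (1 / (2 * x))))) holomorphic_on {p. Re p < 1}"
      using x by (intro holomorphic_intros holomorphic_Phi) auto
  qed (use op ne p in \<open>auto intro!: holomorphic_on_diff h1 open_halfspace_Re_lt simp del: of_real_divide simp: bessel_connection_strip[OF x]\<close>)
qed

section \<open>Taylor remainders of the Macdonald function\<close>

definition binomial_remainder :: "complex \<Rightarrow> nat \<Rightarrow> real \<Rightarrow> complex" where
  "binomial_remainder q N u = rpow (1 + u) (- q) - (\<Sum>j<N. (-1) ^ j * pochhammer q j / fact j * of_real u ^ j)"

lemma binomial_remainder_0: "binomial_remainder q (Suc N) 0 = 0"
  by (simp add: binomial_remainder_def power_0_left sum.lessThan_Suc_shift del: sum.lessThan_Suc)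

text \<open>Differentiation raises q by one and removes one Taylor term, so the remainders form a
  chain along which bounds can be integrated.\<close>

lemma binomial_remainder_has_vector_derivative:
  assumes u: "u > -1"
  shows "(binomial_remainder q (Suc N) has_vector_derivative (- q * binomial_remainder (q + 1) N u)) (at u within S)"
proof -
  have ln: "((\<lambda>u. ln (1 + u)) has_real_derivative 1 / (1 + u)) (at u within S)"
    using u by (auto intro!: derivative_eq_intros)
  have "((\<lambda>u. - q * of_real (ln (1 + u))) has_vector_derivative (- q * of_real (1 / (1 + u)))) (at u within S)"
    using has_vector_derivative_of_real[OF ln] by (intro has_vector_derivative_mult_right) 
  then have 1: "((\<lambda>u. rpow (1 + u) (- q)) has_vector_derivative (- q * of_real (1 / (1 + u)) * exp (- q * of_real (ln (1 + u))))) (at u within S)"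
    unfolding rpow_def by (intro field_vector_diff_chain_within[where g = exp, unfolded o_def]) (auto intro!: DERIV_exp has_field_derivative_at_within)
  have "rpow (1 + u) (- (q + 1)) = rpow (1 + u) (- q) / of_real (1 + u)"
    using u rpow_diff[of "1 + u" "- q" 1] by simp
  then have e1: "- q * of_real (1 / (1 + u)) * exp (- q * of_real (ln (1 + u))) = - q * rpow (1 + u) (- (q + 1))"
    by (simp add: rpow_def)
  have 2: "((\<lambda>u. \<Sum>j<Suc N. (-1) ^ j * pochhammer q j / fact j * of_real u ^ j) has_vector_derivative
      (\<Sum>j<Suc N. (-1) ^ j * pochhammer q j / fact j * (of_nat j * of_real u ^ (j - 1)))) (at u within S)"
    by (intro has_vector_derivative_sum has_vector_derivative_mult_right has_vector_derivative_real_field)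
       (auto intro!: derivative_eq_intros)
  have e2: "(\<Sum>j<Suc N. (-1) ^ j * pochhammer q j / fact j * (of_nat j * of_real u ^ (j - 1))) =
     - q * (\<Sum>j<N. (-1) ^ j * pochhammer (q + 1) j / fact j * of_real u ^ j)"
  proof -
    have "(-1) ^ Suc j * pochhammer q (Suc j) / fact (Suc j) * (of_nat (Suc j) * of_real u ^ (Suc j - 1)) =
      - q * ((-1) ^ j * pochhammer (q + 1) j / fact j * of_real u ^ j)" for j
    proof -
      have "of_nat (Suc j) \<noteq> (0 :: complex)" by (rule of_nat_neq_0)
      then show ?thesis by (simp add: pochhammer_rec del: of_nat_Suc)
    qed
    then show ?thesis
      by (subst sum.lessThan_Suc_shift) (simp add: sum_distrib_left del: of_nat_Suc fact_Suc pochhammer_Suc power_Suc)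
  qed
  have "(binomial_remainder q (Suc N) has_vector_derivative
     (- q * rpow (1 + u) (- (q + 1)) - (- q * (\<Sum>j<N. (-1) ^ j * pochhammer (q + 1) j / fact j * of_real u ^ j)))) (at u within S)"
    using has_vector_derivative_diff[OF 1 2] unfolding e1 e2 binomial_remainder_def .
  then show ?thesis by (simp add: binomial_remainder_def algebra_simps)
qed

text \<open>Mean value inequality along the chain. The factor \<open>u2 - u1\<close> is kept:
  setting \<open>u1 = 0\<close> gives a bound on the size, but the increment is what survives
  division by 1 - t later.\<close>

lemma binomial_remainder_lipschitz_step:
  assumes K: "\<And>u. u \<ge> 0 \<Longrightarrow> norm (binomial_remainder (q + 1) N u) \<le> K * u ^ N" "K \<ge> 0"
    and u: "0 \<le> u1" "u1 \<le> u2"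
  shows "norm (binomial_remainder q (Suc N) u2 - binomial_remainder q (Suc N) u1) \<le> norm q * K * u2 ^ N * (u2 - u1)"
proof (cases "u1 = u2")
  case False
  have cont: "continuous_on {u1..u2} (binomial_remainder q (Suc N))"
    unfolding binomial_remainder_def rpow_def using u by (intro continuous_intros) auto
  have "norm (binomial_remainder q (Suc N) u2 - binomial_remainder q (Suc N) u1) \<le> norm q * K * u2 ^ N * u2 - norm q * K * u2 ^ N * u1"
  proof (rule differentiable_bound_general[where \<phi> = "\<lambda>t. norm q * K * u2 ^ N * t" and \<phi>' = "\<lambda>_. norm q * K * u2 ^ N"
        and f' = "\<lambda>t. - q * binomial_remainder (q + 1) N t", OF _ cont])
    show "u1 < u2" using False u by simp
    fix t assume t: "u1 < t" "t < u2"
    show "(binomial_remainder q (Suc N) has_vector_derivative - q * binomial_remainder (q + 1) N t) (at t)"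
      using t u by (intro binomial_remainder_has_vector_derivative) auto
    show "((\<lambda>t. norm q * K * u2 ^ N * t) has_vector_derivative norm q * K * u2 ^ N) (at t)"
      by (auto intro!: derivative_eq_intros simp: has_real_derivative_iff_has_vector_derivative[symmetric])
    have "norm (binomial_remainder (q + 1) N t) \<le> K * t ^ N" using t u by (intro K) auto
    also have "\<dots> \<le> K * u2 ^ N" using t u K(2) by (intro mult_left_mono power_mono) auto
    finally show "norm (- q * binomial_remainder (q + 1) N t) \<le> norm q * K * u2 ^ N"
      by (simp add: norm_mult mult.assoc mult_left_mono)
  qed (auto intro!: continuous_intros)
  then show ?thesis by (simp add: algebra_simps)
qed simp

text \<open>After \<open>N\<close> differentiations the exponent is q + N, and the hypothesis says
  that (1 + u)^(-(q + N)) is then bounded by 1. From there the bound is integrated back up.\<close>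

lemma binomial_remainder_bound:
  assumes "Re q + real N \<ge> 0"
  shows "\<exists>K\<ge>0. \<forall>u\<ge>0. norm (binomial_remainder q N u) \<le> K * u ^ N"
  using assms
proof (induction N arbitrary: q)
  case 0
  have "norm (rpow (1 + u) (- q)) \<le> 1" if "u \<ge> 0" for u
  proof -
    have "(1 + u) powr (- Re q) \<le> (1 + u) powr 0" using that 0 by (intro powr_mono) auto
    then show ?thesis using that by (simp add: norm_rpow)
  qed
  then show ?case by (intro exI[of _ 1]) (auto simp: binomial_remainder_def)
next
  case (Suc N)
  then have "Re (q + 1) + real N \<ge> 0" by simp
  then obtain K where K: "K \<ge> 0" "\<And>u. u \<ge> 0 \<Longrightarrow> norm (binomial_remainder (q + 1) N u) \<le> K * u ^ N"
    using Suc.IH[of "q + 1"] by blast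
  show ?case
  proof (intro exI[of _ "norm q * K"] conjI allI impI)
    fix u :: real assume "u \<ge> 0"
    then show "norm (binomial_remainder q (Suc N) u) \<le> norm q * K * u ^ Suc N"
      using binomial_remainder_lipschitz_step[where q = q and ?u1.0 = 0 and ?u2.0 = u, OF K(2,1)] by (simp add: binomial_remainder_0 mult_ac)
  qed (use K in auto)
qed

text \<open>The coefficients of the asymptotic expansion of \<open>Phi p\<close> at 0. Symmetry in p
  and 1 - p makes them the same for both choices of \<open>p\<close>, namely 2^j a_j(\<nu>).\<close>

definition Phi_coeff :: "complex \<Rightarrow> nat \<Rightarrow> complex" where
  "Phi_coeff p j = (-1) ^ j * pochhammer p j * pochhammer (1 - p) j / fact j"

lemma Phi_remainder_integral:
  assumes p: "Re p < 1" and y: "y \<ge> 0"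
  shows "set_integrable lborel {0<..} (\<lambda>v. of_real (exp (- v)) * rpow v (- p) * binomial_remainder p N (v * y))"
    and "Phi p y - (\<Sum>j<N. Phi_coeff p j * of_real y ^ j) =
      rGamma (1 - p) * (LINT v:{0<..}|lborel. of_real (exp (- v)) * rpow v (- p) * binomial_remainder p N (v * y))"
proof -
  let ?W = "\<lambda>v. of_real (exp (- v)) * rpow v (- p)"
  let ?c = "\<lambda>j. (-1) ^ j * pochhammer p j / fact j * of_real y ^ j"
  have eq: "?W v * binomial_remainder p N (v * y) = ?W v * rpow (1 + v * y) (- p) - (\<Sum>j<N. ?c j * (?W v * of_real v ^ j))" for v
    by (simp add: binomial_remainder_def right_diff_distrib sum_distrib_left power_mult_distrib mult_ac)
  have i1: "set_integrable lborel {0<..} (\<lambda>v. ?c j * (?W v * of_real v ^ j))" for j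
    using Gamma_power_term(1)[OF p, of 1 j] by (intro set_integrable_mult_right) simp
  have i2: "set_integrable lborel {0<..} (\<lambda>v. \<Sum>j<N. ?c j * (?W v * of_real v ^ j))"
    using i1 unfolding set_integrable_def scaleR_sum_right by (intro Bochner_Integration.integrable_sum)
  show "set_integrable lborel {0<..} (\<lambda>v. ?W v * binomial_remainder p N (v * y))"
    unfolding eq by (intro set_integral_diff(1) set_integrable_Phi p y i2)
  have "(LINT v:{0<..}|lborel. ?W v * binomial_remainder p N (v * y)) =
    (LINT v:{0<..}|lborel. ?W v * rpow (1 + v * y) (- p)) - (LINT v:{0<..}|lborel. \<Sum>j<N. ?c j * (?W v * of_real v ^ j))"
    unfolding eq by (intro set_integral_diff(2) set_integrable_Phi p y i2)
  also have "(LINT v:{0<..}|lborel. \<Sum>j<N. ?c j * (?W v * of_real v ^ j)) = (\<Sum>j<N. LINT v:{0<..}|lborel. ?c j * (?W v * of_real v ^ j))"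
    using i1 unfolding set_lebesgue_integral_def set_integrable_def scaleR_sum_right
    by (intro Bochner_Integration.integral_sum) auto
  also have "\<dots> = (\<Sum>j<N. ?c j * (Gamma (1 - p) * pochhammer (1 - p) j))"
    using Gamma_power_term(2)[OF p, of 1] by (intro sum.cong refl, subst set_integral_mult_right) simp
  finally have "rGamma (1 - p) * (LINT v:{0<..}|lborel. ?W v * binomial_remainder p N (v * y)) =
     Phi p y - (\<Sum>j<N. rGamma (1 - p) * (?c j * (Gamma (1 - p) * pochhammer (1 - p) j)))"
    by (simp add: Phi_def right_diff_distrib sum_distrib_left)
  also have "(\<Sum>j<N. rGamma (1 - p) * (?c j * (Gamma (1 - p) * pochhammer (1 - p) j))) = (\<Sum>j<N. Phi_coeff p j * of_real y ^ j)"
    using p Gamma_nonzero_right_halfplane[of "1 - p"] by (intro sum.cong refl) (simp add: Phi_coeff_def rGamma_inverse_Gamma)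
  finally show "Phi p y - (\<Sum>j<N. Phi_coeff p j * of_real y ^ j) =
      rGamma (1 - p) * (LINT v:{0<..}|lborel. ?W v * binomial_remainder p N (v * y))" ..
qed

text \<open>The binomial estimate is integrated against the exponential weight. It will be applied
  at y = 1 / (2 x t) and y = 1 / (2 x), whose difference is (1 - t) / (2 x t): this supplies the
  factor that cancels the pole and one more power of 1 / x.\<close>

lemma Phi_remainder_lipschitz:
  assumes p: "Re p < 1" and N: "Re p + real (Suc N) \<ge> 0"
  defines "E \<equiv> \<lambda>y. Phi p y - (\<Sum>j<Suc N. Phi_coeff p j * of_real y ^ j)"
  shows "\<exists>C\<ge>0. \<forall>y1 y2. 0 \<le> y1 \<longrightarrow> y1 \<le> y2 \<longrightarrow> norm (E y2 - E y1) \<le> C * y2 ^ N * (y2 - y1)"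
proof -
  have "Re (p + 1) + real N \<ge> 0" using N by simp
  then obtain K where K: "K \<ge> 0" "\<And>u. u \<ge> 0 \<Longrightarrow> norm (binomial_remainder (p + 1) N u) \<le> K * u ^ N"
    using binomial_remainder_bound[of "p + 1" N] by blast
  let ?W = "\<lambda>v. of_real (exp (- v)) * rpow v (- p)"
  let ?I = "\<integral>v. norm (indicator {0<..} v *\<^sub>R (?W v * of_real v ^ Suc N)) \<partial>lborel"
  have iI: "integrable lborel (\<lambda>v. norm (indicator {0<..} v *\<^sub>R (?W v * of_real v ^ Suc N)))"
    using Gamma_power_term(1)[OF p, of 1 "Suc N"] unfolding set_integrable_def by (intro integrable_norm) simp
  define C where "C = norm (rGamma (1 - p)) * (norm p * K * ?I)"
  have "norm (E y2 - E y1) \<le> C * y2 ^ N * (y2 - y1)" if y: "0 \<le> y1" "y1 \<le> y2" for y1 y2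
  proof -
    let ?f = "\<lambda>y v. indicator {0<..} v *\<^sub>R (?W v * binomial_remainder p (Suc N) (v * y))"
    have i: "integrable lborel (?f y1)" "integrable lborel (?f y2)"
      using Phi_remainder_integral(1)[OF p, of y1 "Suc N"] Phi_remainder_integral(1)[OF p, of y2 "Suc N"] y
      by (auto simp: set_integrable_def)
    have Ee: "E y = rGamma (1 - p) * (\<integral>v. ?f y v \<partial>lborel)" if "y \<ge> 0" for y
      unfolding E_def by (subst Phi_remainder_integral(2)[OF p that]) (simp add: set_lebesgue_integral_def)
    have "E y2 - E y1 = rGamma (1 - p) * (\<integral>v. ?f y2 v - ?f y1 v \<partial>lborel)"
      using i Ee[of y1] Ee[of y2] y by (simp add: right_diff_distrib)
    then have eq: "norm (E y2 - E y1) = norm (rGamma (1 - p)) * norm (\<integral>v. ?f y2 v - ?f y1 v \<partial>lborel)"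
      by (simp add: norm_mult)
    have "norm (\<integral>v. ?f y2 v - ?f y1 v \<partial>lborel) \<le> (\<integral>v. norm p * K * y2 ^ N * (y2 - y1) * norm (indicator {0<..} v *\<^sub>R (?W v * of_real v ^ Suc N)) \<partial>lborel)"
    proof (rule Bochner_Integration.integral_norm_bound_integral[OF Bochner_Integration.integrable_diff[OF i(2,1)] integrable_mult_right[OF iI]])
      fix v :: real
      show "norm (?f y2 v - ?f y1 v) \<le> norm p * K * y2 ^ N * (y2 - y1) * norm (indicator {0<..} v *\<^sub>R (?W v * of_real v ^ Suc N))"
      proof (cases "v > 0")
        case v: True
        have "norm (binomial_remainder p (Suc N) (v * y2) - binomial_remainder p (Suc N) (v * y1)) \<le> norm p * K * (v * y2) ^ N * (v * y2 - v * y1)"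
          using y v by (intro binomial_remainder_lipschitz_step K) (auto intro: mult_left_mono)
        also have "\<dots> = norm p * K * y2 ^ N * (y2 - y1) * v ^ Suc N" by (simp add: power_mult_distrib algebra_simps)
        finally have "norm (?W v) * norm (binomial_remainder p (Suc N) (v * y2) - binomial_remainder p (Suc N) (v * y1))
          \<le> norm (?W v) * (norm p * K * y2 ^ N * (y2 - y1) * v ^ Suc N)" by (rule mult_left_mono) simp
        moreover have "?f y2 v - ?f y1 v = ?W v * (binomial_remainder p (Suc N) (v * y2) - binomial_remainder p (Suc N) (v * y1))"
          using v by (simp add: right_diff_distrib)
        moreover have "norm (indicator {0<..} v *\<^sub>R (?W v * of_real v ^ Suc N)) = norm (?W v) * v ^ Suc N"
          using v by (simp add: norm_mult norm_power)
        ultimately show ?thesis by (simp only: norm_mult mult_ac)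
      next
        case False
        then show ?thesis by simp
      qed
    qed
    also have "\<dots> = norm p * K * y2 ^ N * (y2 - y1) * ?I" by (rule integral_mult_right_zero)
    finally have "norm (rGamma (1 - p)) * norm (\<integral>v. ?f y2 v - ?f y1 v \<partial>lborel) \<le> norm (rGamma (1 - p)) * (norm p * K * y2 ^ N * (y2 - y1) * ?I)"
      by (rule mult_left_mono) simp
    then show ?thesis unfolding eq C_def by (simp only: mult_ac)
  qed
  moreover have "C \<ge> 0" using K by (auto simp: C_def intro!: mult_nonneg_nonneg Bochner_Integration.integral_nonneg)
  ultimately show ?thesis by blast
qed

lemma Phi_0: "Re p < 1 \<Longrightarrow> Phi p 0 = 1"
  using Phi_remainder_integral(2)[of p 0 1] by (simp add: binomial_remainder_0[of p 0, simplified] Phi_coeff_def)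

text \<open>For the region t -> 0, where the argument 1 / (2 x t) is unbounded and the expansion at
  0 says nothing.\<close>

lemma Phi_growth:
  assumes p: "Re p < 1"
  shows "\<exists>N C. C \<ge> 0 \<and> (\<forall>y\<ge>0. norm (Phi p y) \<le> C * (1 + y) ^ N)"
proof -
  obtain N :: nat where N: "- Re p \<le> real N" using real_arch_simple by blast
  let ?W = "\<lambda>v. of_real (exp (- v) * (1 + v) ^ N) * rpow v (- p)"
  have iW: "integrable lborel (\<lambda>v. norm (indicator {0<..} v *\<^sub>R ?W v))"
    using set_integrable_power_weight[OF p, of 1 N] unfolding set_integrable_def by (intro integrable_norm) simp
  let ?I = "\<integral>v. norm (indicator {0<..} v *\<^sub>R ?W v) \<partial>lborel"
  have "norm (Phi p y) \<le> norm (rGamma (1 - p)) * ?I * (1 + y) ^ N" if y: "y \<ge> 0" for y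
  proof -
    have "norm (\<integral>v. indicator {0<..} v *\<^sub>R (of_real (exp (- v)) * rpow v (- p) * rpow (1 + v * y) (- p)) \<partial>lborel)
      \<le> (\<integral>v. (1 + y) ^ N * norm (indicator {0<..} v *\<^sub>R ?W v) \<partial>lborel)"
    proof (rule Bochner_Integration.integral_norm_bound_integral[OF set_integrable_Phi[OF p y, unfolded set_integrable_def] integrable_mult_right[OF iW]])
      fix v :: real
      show "norm (indicator {0<..} v *\<^sub>R (of_real (exp (- v)) * rpow v (- p) * rpow (1 + v * y) (- p)))
        \<le> (1 + y) ^ N * norm (indicator {0<..} v *\<^sub>R ?W v)"
      proof (cases "v > 0")
        case v: True
        from mult_left_mono[OF norm_rpow_one_plus_mult_le[of v y p N], of "exp (- v) * norm (rpow v (- p))"]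
        show ?thesis using v y N by (simp add: norm_mult abs_mult mult_ac del: of_real_add of_real_mult of_real_power)
      qed simp
    qed
    also have "\<dots> = (1 + y) ^ N * ?I" by (rule integral_mult_right_zero)
    finally have "norm (rGamma (1 - p)) * norm (LINT v:{0<..}|lborel. of_real (exp (- v)) * rpow v (- p) * rpow (1 + v * y) (- p))
      \<le> norm (rGamma (1 - p)) * ((1 + y) ^ N * ?I)"
      unfolding set_lebesgue_integral_def by (rule mult_left_mono) simp
    then show ?thesis by (simp only: Phi_def norm_mult mult_ac)
  qed
  moreover have "norm (rGamma (1 - p)) * ?I \<ge> 0" by (intro mult_nonneg_nonneg Bochner_Integration.integral_nonneg) auto
  ultimately show ?thesis by blast
qed

lemma borel_measurable_Phi [measurable]: "Phi p \<in> borel_measurable borel"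
proof -
  have "(\<lambda>y. \<integral>v. indicator {0<..} v *\<^sub>R (of_real (exp (- v)) * rpow v (- p) * rpow (1 + v * y) (- p)) \<partial>lborel) \<in> borel_measurable borel"
    by measurable
  then show ?thesis unfolding Phi_def [abs_def] set_lebesgue_integral_def by measurable
qed

section \<open>The branch of the saddle point substitution\<close>

text \<open>The power series of 2 (u - Ln (1 + u)) / u^2, with the singularity at u = 0 already
  removed.\<close>

definition q_series :: "complex \<Rightarrow> complex" where
  "q_series u = (\<Sum>n. 2 * (-1) ^ n / of_nat (n + 2) * u ^ n)"

lemma
  assumes u: "norm u < 1"
  shows q_series_sums: "(\<lambda>n. 2 * (-1) ^ n / of_nat (n + 2) * u ^ n) sums q_series u"
    and q_series_eq: "u\<^sup>2 * q_series u = 2 * (u - Ln (1 + u))"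
proof -
  let ?f = "\<lambda>n. (-1) ^ Suc n / of_nat n * u ^ n"
  have "(\<lambda>n. ?f (n + 2)) sums (Ln (1 + u) - (\<Sum>n<2. ?f n))"
    by (rule sums_split_initial_segment[OF Ln_series[OF u]])
  from sums_mult[OF this, of "-2"]
  have s: "(\<lambda>n. u\<^sup>2 * (2 * (-1) ^ n / of_nat (n + 2) * u ^ n)) sums (2 * (u - Ln (1 + u)))"
    by (simp add: numeral_2_eq_2 power2_eq_square mult_ac)
  show 1: "(\<lambda>n. 2 * (-1) ^ n / of_nat (n + 2) * u ^ n) sums q_series u"
  proof (cases "u = 0")
    case True
    show ?thesis unfolding q_series_def True by (intro summable_sums sums_summable[OF powser_sums_zero])
  next
    case False
    have "summable (\<lambda>n. 2 * (-1) ^ n / of_nat (n + 2) * u ^ n)"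
      using sums_summable[OF s] False by (subst (asm) summable_cmult_iff) simp
    then show ?thesis unfolding q_series_def by (rule summable_sums)
  qed
  show "u\<^sup>2 * q_series u = 2 * (u - Ln (1 + u))"
    by (rule sums_unique2[OF sums_mult[OF 1] s])
qed

lemma q_series_0: "q_series 0 = 1"
  using sums_unique2[OF q_series_sums[of 0] powser_sums_zero[of "\<lambda>n. 2 * (-1) ^ n / of_nat (n + 2)"]] by simp

lemma holomorphic_q_series: "q_series holomorphic_on ball 0 1"
  by (rule power_series_holomorphic[where a = "\<lambda>n. 2 * (-1) ^ n / of_nat (n + 2)"]) (use q_series_sums in auto)

lemma cnj_q_series:
  assumes "norm u < 1"
  shows "q_series (cnj u) = cnj (q_series u)"
proof -
  have "(\<lambda>n. cnj (2 * (-1) ^ n / of_nat (n + 2) * u ^ n)) sums cnj (q_series u)"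
    unfolding sums_cnj by (rule q_series_sums[OF assms])
  moreover have "cnj (2 * (-1) ^ n / of_nat (n + 2) * u ^ n) = 2 * (-1) ^ n / of_nat (n + 2) * cnj u ^ n" for n
    by simp
  ultimately have "(\<lambda>n. 2 * (-1) ^ n / of_nat (n + 2) * cnj u ^ n) sums cnj (q_series u)" by (simp only:)
  moreover have "(\<lambda>n. 2 * (-1) ^ n / of_nat (n + 2) * cnj u ^ n) sums q_series (cnj u)"
    using assms by (intro q_series_sums) simp
  ultimately show ?thesis by (metis sums_unique2)
qed

text \<open>With u = tau - 1 this is w as a function of tau. Since \<open>q_series\<close> is 1 at
  0, the principal root picks the branch w ~ u.\<close>

definition w_branch :: "complex \<Rightarrow> complex" where
  "w_branch u = u * csqrt (q_series u)"

text \<open>Near 0 the real part of \<open>q_series\<close> is positive, so the root is holomorphic;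
  the derivative at 0 is 1, so the map is locally invertible. Compatibility with conjugation is
  recorded in order to see later that real w give real tau.\<close>

lemma w_branch_local:
  obtains r g where "0 < r" "r < 1" "w_branch holomorphic_on ball 0 r" "inj_on w_branch (ball 0 r)"
    "open (w_branch ` ball 0 r)" "g holomorphic_on (w_branch ` ball 0 r)"
    "\<And>u. u \<in> ball 0 r \<Longrightarrow> g (w_branch u) = u" "deriv g 0 = 1"
    "\<And>u. u \<in> ball 0 r \<Longrightarrow> (w_branch u)\<^sup>2 = 2 * (u - Ln (1 + u))"
    "\<And>u. u \<in> ball 0 r \<Longrightarrow> w_branch (cnj u) = cnj (w_branch u)"
    "(w_branch has_field_derivative 1) (at 0)"
proof -
  have "isCont q_series 0"
    using holomorphic_on_imp_continuous_on[OF holomorphic_q_series] by (simp add: continuous_on_eq_continuous_at)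
  then have "q_series \<midarrow>0\<rightarrow> 1" by (simp add: isCont_def q_series_0)
  then obtain \<rho> where \<rho>: "\<rho> > 0" "\<And>u. u \<noteq> 0 \<Longrightarrow> dist u 0 < \<rho> \<Longrightarrow> dist (q_series u) 1 < 1"
    unfolding LIM_def by (metis zero_less_one)
  define r0 where "r0 = min \<rho> (1/2)"
  have r0: "r0 > 0" "r0 < 1" using \<rho> by (auto simp: r0_def)
  have Rq: "Re (q_series u) > 0" if "u \<in> ball 0 r0" for u
  proof (cases "u = 0")
    case False
    then have "norm (q_series u - 1) < 1" using \<rho>(2)[of u] that by (simp add: r0_def dist_norm)
    then show ?thesis using abs_Re_le_cmod[of "q_series u - 1"] by simp
  qed (simp add: q_series_0)
  have nn: "q_series u \<notin> \<real>\<^sub>\<le>\<^sub>0" if "u \<in> ball 0 r0" for u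
    using Rq[OF that] by (auto simp: complex_nonpos_Reals_iff)
  have hq: "q_series holomorphic_on ball 0 r0"
    using r0 by (intro holomorphic_on_subset[OF holomorphic_q_series]) auto
  have hs: "(\<lambda>u. csqrt (q_series u)) holomorphic_on ball 0 r0"
    using nn by (intro holomorphic_on_csqrt' hq) auto
  have hw: "w_branch holomorphic_on ball 0 r0"
    unfolding w_branch_def [abs_def] by (intro holomorphic_intros hs)
  have "(\<lambda>u. csqrt (q_series u)) field_differentiable at 0"
    using hs r0 holomorphic_on_imp_differentiable_at[OF hs open_ball] by simp
  then have "((\<lambda>u. csqrt (q_series u)) has_field_derivative deriv (\<lambda>u. csqrt (q_series u)) 0) (at 0)"
    by (rule field_differentiable_derivI)
  from DERIV_mult[OF DERIV_ident this]
  have dw: "(w_branch has_field_derivative 1) (at 0)"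
    unfolding w_branch_def [abs_def] by (simp add: q_series_0)
  then have dw': "deriv w_branch 0 = 1" by (rule DERIV_imp_deriv)
  obtain r where r: "r > 0" "ball 0 r \<subseteq> ball (0::complex) r0" "open (w_branch ` ball 0 r)" "inj_on w_branch (ball 0 r)"
    using has_complex_derivative_locally_invertible[OF hw _ open_ball, of 0] dw' r0 by auto
  have hwr: "w_branch holomorphic_on ball 0 r" using hw r(2) by (rule holomorphic_on_subset)
  obtain g where g: "g holomorphic_on (w_branch ` ball 0 r)"
    "\<And>u. u \<in> ball 0 r \<Longrightarrow> deriv w_branch u * deriv g (w_branch u) = 1"
    "\<And>u. u \<in> ball 0 r \<Longrightarrow> g (w_branch u) = u"
    using holomorphic_has_inverse[OF hwr open_ball r(4)] by blast
  have w0: "w_branch 0 = 0" by (simp add: w_branch_def)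
  show ?thesis
  proof (rule that[OF r(1) _ hwr r(4) r(3) g(1) g(3)])
    have "r \<le> r0" using r(1,2) by (simp add: ball_subset_ball_iff)
    then show "r < 1" using r0 by simp
    show "deriv g 0 = 1" using g(2)[of 0] r(1) dw' w0 by simp
    show "(w_branch has_field_derivative 1) (at 0)" by (rule dw)
    fix u :: complex assume u: "u \<in> ball 0 r"
    then have u0: "u \<in> ball 0 r0" using r(2) by blast
    then have u1: "norm u < 1" using r0 by simp
    show "(w_branch u)\<^sup>2 = 2 * (u - Ln (1 + u))"
      using q_series_eq[OF u1] by (simp add: w_branch_def power_mult_distrib)
    have "csqrt (cnj (q_series u)) = cnj (csqrt (q_series u))"
    proof -
      have "q_series u \<noteq> 0" using Rq[OF u0] by auto
      then show ?thesis
        using cnj_Ln[OF nn[OF u0]] by (simp add: csqrt_exp_Ln exp_cnj)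
    qed
    then show "w_branch (cnj u) = cnj (w_branch u)"
      by (simp add: w_branch_def cnj_q_series[OF u1])
  qed
qed

text \<open>The witness is 1 plus the local inverse of \<open>w_branch\<close>. This legitimises the
  choice operator in the definition of \<open>tau\<close>.\<close>

lemma is_tau_branch_exists: "\<exists>\<tau>. is_tau_branch \<tau>"
proof (rule w_branch_local)
  fix r g assume r: "0 < r" "r < 1" and hw: "w_branch holomorphic_on ball 0 r" and inj: "inj_on w_branch (ball 0 r)"
    and op: "open (w_branch ` ball 0 r)" and hg: "g holomorphic_on (w_branch ` ball 0 r)"
    and gw: "\<And>u. u \<in> ball 0 r \<Longrightarrow> g (w_branch u) = u" and dg: "deriv g 0 = 1"
    and sq: "\<And>u. u \<in> ball 0 r \<Longrightarrow> (w_branch u)\<^sup>2 = 2 * (u - Ln (1 + u))"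
  have w0: "w_branch 0 = 0" by (simp add: w_branch_def)
  have mem: "0 \<in> w_branch ` ball 0 r" using r w0 by force
  have g0: "g 0 = 0" using gw[of 0] r w0 by simp
  have an: "g analytic_on {0}" using hg op mem analytic_at by blast
  have "(g has_field_derivative 1) (at 0)"
    using holomorphic_derivI[OF hg op mem] dg by simp
  then have lim: "(\<lambda>w. g w / w) \<midarrow>0\<rightarrow> 1" by (simp add: has_field_derivative_iff g0)
  have "is_tau_branch (\<lambda>w. 1 + g w)"
    unfolding is_tau_branch_def
  proof (intro conjI)
    show "(\<lambda>w. 1 + g w) analytic_on {0}" using an by (intro analytic_intros)
    show "1 + g 0 = 1" using g0 by simp
    have "\<forall>\<^sub>F w in nhds 0. w \<in> w_branch ` ball 0 r" using op mem by (rule eventually_nhds_in_open)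
    then show "\<forall>\<^sub>F w in nhds 0. w\<^sup>2 / 2 = 1 + g w - Ln (1 + g w) - 1"
    proof eventually_elim
      case (elim w)
      then obtain u where "u \<in> ball 0 r" "w = w_branch u" by blast
      then show ?case using gw[of u] sq[of u] by simp
    qed
    have "(\<lambda>w. (1 + g w - 1)) \<sim>[at 0] (\<lambda>w. w)"
      by (rule asymp_equivI'_const[where c = 1, simplified]) (use lim in simp_all)
    then show "(\<lambda>w. w) \<sim>[at 0] (\<lambda>w. 1 + g w - 1)" by (simp add: asymp_equiv_sym)
  qed
  then show ?thesis by blast
qed

section \<open>Local properties of the chosen branch\<close>

lemma is_tau_branch_tau: "is_tau_branch tau"
  unfolding tau_def using is_tau_branch_exists by (rule someI_ex)

text \<open>\<open>tau\<close> is an arbitrary choice, so everything must follow from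
  \<open>is_tau_branch\<close>. The point is that near 0 it inverts \<open>w_branch\<close>;
  injectivity of \<open>w_branch\<close> and its behaviour under conjugation then force real values
  on the real axis.\<close>

lemma tau_local:
  obtains R :: real where "R > 0" "tau holomorphic_on ball 0 R" "tau 0 = 1" "deriv tau 0 = 1"
    "\<And>w. w \<in> ball 0 R \<Longrightarrow> w\<^sup>2 / 2 = tau w - Ln (tau w) - 1"
    "\<And>w. w \<in> ball 0 R \<Longrightarrow> norm (tau w - 1) < 1/2"
    "\<And>w. w \<in> ball 0 R \<Longrightarrow> Re (deriv tau w) > 0"
    "\<And>w. w \<in> ball 0 R \<Longrightarrow> w \<noteq> 0 \<Longrightarrow> tau w \<noteq> 1"
    "\<And>w. w \<in> ball 0 R \<Longrightarrow> w \<in> \<real> \<Longrightarrow> tau w \<in> \<real>"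
proof (rule w_branch_local)
  fix r g assume r: "0 < r" "r < 1" and hw: "w_branch holomorphic_on ball 0 r" and inj: "inj_on w_branch (ball 0 r)"
    and op: "open (w_branch ` ball 0 r)" and hg: "g holomorphic_on (w_branch ` ball 0 r)"
    and gw: "\<And>u. u \<in> ball 0 r \<Longrightarrow> g (w_branch u) = u" and dg: "deriv g 0 = 1"
    and sq: "\<And>u. u \<in> ball 0 r \<Longrightarrow> (w_branch u)\<^sup>2 = 2 * (u - Ln (1 + u))"
    and cn: "\<And>u. u \<in> ball 0 r \<Longrightarrow> w_branch (cnj u) = cnj (w_branch u)"
    and dw: "(w_branch has_field_derivative 1) (at 0)"
  have t: "tau analytic_on {0}" "tau 0 = 1" "\<forall>\<^sub>F w in nhds 0. w\<^sup>2 / 2 = tau w - Ln (tau w) - 1"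
    "(\<lambda>w. w) \<sim>[at 0] (\<lambda>w. tau w - 1)"
    using is_tau_branch_tau unfolding is_tau_branch_def by auto
  have ct: "isCont tau 0" using t(1) by (simp add: analytic_at_imp_isCont)
  have ev1: "\<forall>\<^sub>F w in nhds 0. norm (tau w - 1) < s" if "s > 0" for s
  proof -
    have "(tau \<longlongrightarrow> 1) (nhds 0)" using ct t(2) tendsto_at_iff_tendsto_nhds[of tau 0] by (simp add: isCont_def)
    from tendstoD[OF this that] show ?thesis by (simp add: dist_norm)
  qed
  have fl: "filterlim (\<lambda>w. tau w - 1) (at 0) (at 0)"
  proof -
    have "\<forall>\<^sub>F w in at 0. tau w - 1 \<noteq> 0"
      using asymp_equiv_eventually_zeros[OF t(4)] unfolding eventually_at_filter
      by eventually_elim auto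
    moreover have "((\<lambda>w. tau w - 1) \<longlongrightarrow> 0) (at 0)"
      using ct t(2) by (auto simp: isCont_def LIM_zero_iff)
    ultimately show ?thesis by (simp add: filterlim_at)
  qed
  have lim1: "((\<lambda>w. (tau w - 1) / w) \<longlongrightarrow> 1) (at 0)"
    using asymp_equiv_symI[OF t(4)] by (intro asymp_equivD_strong) (auto simp: eventually_at_filter)
  have "((\<lambda>u. w_branch u / u) \<longlongrightarrow> 1) (at 0)"
    using dw by (simp add: has_field_derivative_iff w_branch_def)
  from filterlim_compose[OF this fl]
  have "((\<lambda>w. w_branch (tau w - 1) / (tau w - 1)) \<longlongrightarrow> 1) (at 0)" .
  from tendsto_mult[OF this lim1]
  have "((\<lambda>w. w_branch (tau w - 1) / (tau w - 1) * ((tau w - 1) / w)) \<longlongrightarrow> 1) (at 0)" by simp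
  moreover have "\<forall>\<^sub>F w in at 0. w_branch (tau w - 1) / (tau w - 1) * ((tau w - 1) / w) = w_branch (tau w - 1) / w"
    using fl by (auto simp: filterlim_at elim: eventually_mono)
  ultimately have "((\<lambda>w. w_branch (tau w - 1) / w) \<longlongrightarrow> 1) (at 0)"
    by (rule Lim_transform_eventually)
  from tendstoD[OF this, of 1] have "\<forall>\<^sub>F w in at 0. dist (w_branch (tau w - 1) / w) 1 < 1" by simp
  then have ne: "\<forall>\<^sub>F w in nhds 0. w \<noteq> 0 \<longrightarrow> dist (w_branch (tau w - 1) / w) 1 < 1"
    by (simp add: eventually_at_filter)
  \<comment> \<open>The squares of both sides agree by the defining equation, which leaves a sign.
    The quotient by w lies within distance 1 of 1, whereas the wrong sign would make it -1.\<close>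
  have key: "\<forall>\<^sub>F w in nhds 0. w_branch (tau w - 1) = w \<and> tau w - 1 \<in> ball 0 r"
    using ne t(3) ev1[OF r(1)]
  proof eventually_elim
    case (elim w)
    then have m: "tau w - 1 \<in> ball 0 r" by simp
    have "(w_branch (tau w - 1))\<^sup>2 = w\<^sup>2" using sq[OF m] elim(2) by simp
    then have "w_branch (tau w - 1) = w \<or> w_branch (tau w - 1) = - w" by (simp add: power2_eq_iff)
    moreover have "w_branch (tau w - 1) \<noteq> - w" if "w \<noteq> 0"
    proof
      assume "w_branch (tau w - 1) = - w"
      then show False using elim(1) that by (simp add: dist_norm)
    qed
    ultimately show ?case using m by (cases "w = 0") auto
  qed
  have dt: "(tau has_field_derivative 1) (at 0)"
    using lim1 t(2) by (simp add: has_field_derivative_iff)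
  obtain R0 where R0: "R0 > 0" "tau holomorphic_on ball 0 R0"
    using t(1) by (auto simp: analytic_on_def)
  have "isCont (deriv tau) 0"
  proof -
    have "deriv tau holomorphic_on ball 0 R0" using R0(2) by (rule holomorphic_deriv) simp
    then show ?thesis using R0(1) by (meson centre_in_ball continuous_on_eq_continuous_at holomorphic_on_imp_continuous_on open_ball)
  qed
  then have "(deriv tau \<longlongrightarrow> 1) (nhds 0)"
    using DERIV_imp_deriv[OF dt] tendsto_at_iff_tendsto_nhds[of "deriv tau" 0] by (simp add: isCont_def)
  from tendstoD[OF this, of 1] have ev2: "\<forall>\<^sub>F w in nhds 0. dist (deriv tau w) 1 < 1" by simp
  have "\<forall>\<^sub>F w in nhds 0. w\<^sup>2 / 2 = tau w - Ln (tau w) - 1 \<and> norm (tau w - 1) < 1/2 \<and> dist (deriv tau w) 1 < 1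
     \<and> (w_branch (tau w - 1) = w \<and> tau w - 1 \<in> ball 0 r)"
    using t(3) ev1[of "1/2", simplified] ev2 key by eventually_elim simp
  then obtain R1 where R1: "R1 > 0" "\<And>w. dist w 0 < R1 \<Longrightarrow> w\<^sup>2 / 2 = tau w - Ln (tau w) - 1 \<and> norm (tau w - 1) < 1/2 \<and> dist (deriv tau w) 1 < 1
     \<and> (w_branch (tau w - 1) = w \<and> tau w - 1 \<in> ball 0 r)"
    unfolding eventually_nhds_metric by blast
  define R where "R = min R0 R1"
  have R: "w\<^sup>2 / 2 = tau w - Ln (tau w) - 1" "norm (tau w - 1) < 1/2" "dist (deriv tau w) 1 < 1"
     "w_branch (tau w - 1) = w" "tau w - 1 \<in> ball 0 r" if "w \<in> ball 0 R" for w
    using R1(2)[of w] that by (auto simp: R_def)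
  show thesis
  proof (rule that[of R])
    show "R > 0" using R0 R1 by (simp add: R_def)
    show "tau holomorphic_on ball 0 R" using R0 by (intro holomorphic_on_subset[OF R0(2)]) (auto simp: R_def)
    show "tau 0 = 1" by fact
    show "deriv tau 0 = 1" by (rule DERIV_imp_deriv[OF dt])
    fix w :: complex assume w: "w \<in> ball 0 R"
    show "w\<^sup>2 / 2 = tau w - Ln (tau w) - 1" "norm (tau w - 1) < 1/2" using R[OF w] by auto
    show "Re (deriv tau w) > 0"
      using R(3)[OF w] abs_Re_le_cmod[of "deriv tau w - 1"] by (simp add: dist_norm)
    show "tau w \<noteq> 1" if "w \<noteq> 0" using R(1)[OF w] that by auto
    show "tau w \<in> \<real>" if "w \<in> \<real>"
    proof -
      \<comment> \<open>For real w, \<open>tau w - 1\<close> and its conjugate have the same image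
        under the injective \<open>w_branch\<close>.\<close>
      have "w_branch (cnj (tau w - 1)) = cnj w" using cn[OF R(5)[OF w]] R(4)[OF w] by simp
      also have "cnj w = w" using that by (simp add: Reals_cnj_iff)
      finally have "w_branch (cnj (tau w - 1)) = w_branch (tau w - 1)" using R(4)[OF w] by simp
      moreover have "cnj (tau w - 1) \<in> ball 0 r" using R(5)[OF w] by (simp add: norm_complex_def)
      ultimately have "cnj (tau w - 1) = tau w - 1" using inj R(5)[OF w] by (auto dest: inj_onD)
      then have "cnj (tau w) = tau w" by simp
      then show ?thesis by (simp add: Reals_cnj_iff)
    qed
  qed
qed

text \<open>Fixed once, so that all later estimates refer to one disc on which every local property
  holds simultaneously.\<close>

definition tau_radius :: real where
  "tau_radius = (SOME R. R > 0 \<and> tau holomorphic_on ball 0 R \<and> tau 0 = 1 \<and> deriv tau 0 = 1 \<and>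
    (\<forall>w\<in>ball 0 R. w\<^sup>2 / 2 = tau w - Ln (tau w) - 1 \<and> norm (tau w - 1) < 1/2 \<and> Re (deriv tau w) > 0 \<and>
      (w \<noteq> 0 \<longrightarrow> tau w \<noteq> 1) \<and> (w \<in> \<real> \<longrightarrow> tau w \<in> \<real>)))"

lemma tau_radius:
  shows tau_radius_pos: "tau_radius > 0"
    and holomorphic_tau: "tau holomorphic_on ball 0 tau_radius"
    and tau_0: "tau 0 = 1" and deriv_tau_0: "deriv tau 0 = 1"
    and tau_eq: "\<And>w. w \<in> ball 0 tau_radius \<Longrightarrow> w\<^sup>2 / 2 = tau w - Ln (tau w) - 1"
    and tau_close: "\<And>w. w \<in> ball 0 tau_radius \<Longrightarrow> norm (tau w - 1) < 1/2"
    and Re_deriv_tau_pos: "\<And>w. w \<in> ball 0 tau_radius \<Longrightarrow> Re (deriv tau w) > 0"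
    and tau_neq_1: "\<And>w. w \<in> ball 0 tau_radius \<Longrightarrow> w \<noteq> 0 \<Longrightarrow> tau w \<noteq> 1"
    and tau_real: "\<And>w. w \<in> ball 0 tau_radius \<Longrightarrow> w \<in> \<real> \<Longrightarrow> tau w \<in> \<real>"
proof -
  let ?P = "\<lambda>R. R > 0 \<and> tau holomorphic_on ball 0 R \<and> tau 0 = 1 \<and> deriv tau 0 = 1 \<and>
    (\<forall>w\<in>ball 0 R. w\<^sup>2 / 2 = tau w - Ln (tau w) - 1 \<and> norm (tau w - 1) < 1/2 \<and> Re (deriv tau w) > 0 \<and>
      (w \<noteq> 0 \<longrightarrow> tau w \<noteq> 1) \<and> (w \<in> \<real> \<longrightarrow> tau w \<in> \<real>))"
  have "\<exists>R. ?P R" by (rule tau_local) blast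
  then have P: "?P tau_radius" unfolding tau_radius_def by (rule someI_ex)
  show "tau_radius > 0" "tau holomorphic_on ball 0 tau_radius" "tau 0 = 1" "deriv tau 0 = 1"
    using P by blast+
  fix w :: complex assume "w \<in> ball 0 tau_radius"
  then show "w\<^sup>2 / 2 = tau w - Ln (tau w) - 1" "norm (tau w - 1) < 1/2" "Re (deriv tau w) > 0"
    "w \<noteq> 0 \<Longrightarrow> tau w \<noteq> 1" "w \<in> \<real> \<Longrightarrow> tau w \<in> \<real>"
    using P by blast+
qed

lemma tau_not_nonpos:
  assumes "w \<in> ball 0 tau_radius"
  shows "tau w \<notin> \<real>\<^sub>\<le>\<^sub>0"
  using tau_close[OF assms] abs_Re_le_cmod[of "tau w - 1"] by (auto simp: complex_nonpos_Reals_iff)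

section \<open>The coefficients of the regular part\<close>

definition tau_quotient :: "complex \<Rightarrow> complex" where
  "tau_quotient w = (if w = 0 then 1 else (tau w - 1) / w)"

lemma holomorphic_tau_quotient: "tau_quotient holomorphic_on ball 0 tau_radius"
proof (rule pole_theorem_0[where g = "\<lambda>w. tau w - 1" and a = 0])
  show "(\<lambda>w. tau w - 1) holomorphic_on ball 0 tau_radius"
    by (intro holomorphic_intros holomorphic_tau)
  have "tau field_differentiable at 0"
    using holomorphic_on_imp_differentiable_at[OF holomorphic_tau open_ball] tau_radius_pos by simp
  then have "(tau has_field_derivative 1) (at 0)"
    using field_differentiable_derivI deriv_tau_0 by fastforce
  then have "((\<lambda>w. tau w - 1) has_field_derivative 1) (at 0)"
    by (auto intro!: derivative_eq_intros)
  then show "tau_quotient 0 = deriv (\<lambda>w. tau w - 1) 0"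
    by (simp add: tau_quotient_def DERIV_imp_deriv)
qed (auto simp: tau_quotient_def tau_0 tau_radius_pos)

lemma tau_quotient_nonzero: "w \<in> ball 0 tau_radius \<Longrightarrow> tau_quotient w \<noteq> 0"
  using tau_neq_1[of w] by (auto simp: tau_quotient_def)

text \<open>This is 1 + w f(w) away from 0, where f is the function whose Laurent coefficients are
  the g_k. It vanishes at 0 because f has residue -1 there.\<close>

definition pole_numerator :: "real \<Rightarrow> complex \<Rightarrow> complex" where
  "pole_numerator \<gamma> w = 1 - exp (of_real (\<gamma> - 1) * Ln (tau w)) * deriv tau w / tau_quotient w"

definition pole_regular :: "real \<Rightarrow> complex \<Rightarrow> complex" where
  "pole_regular \<gamma> w = (if w = 0 then deriv (pole_numerator \<gamma>) 0 else pole_numerator \<gamma> w / w)"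

lemma holomorphic_pole_numerator: "pole_numerator \<gamma> holomorphic_on ball 0 tau_radius"
  unfolding pole_numerator_def [abs_def]
  using tau_not_nonpos tau_quotient_nonzero
  by (intro holomorphic_intros holomorphic_tau holomorphic_tau_quotient holomorphic_deriv) auto

lemma holomorphic_pole_regular: "pole_regular \<gamma> holomorphic_on ball 0 tau_radius"
proof (rule pole_theorem_0[OF holomorphic_pole_numerator])
  show "0 \<in> interior (ball (0::complex) tau_radius)" by (simp add: tau_radius_pos)
  show "pole_numerator \<gamma> 0 = 0"
    by (simp add: pole_numerator_def tau_0 deriv_tau_0 tau_quotient_def)
qed (auto simp: pole_regular_def)

lemma pole_regular_eq:
  assumes w: "w \<in> ball 0 tau_radius" "w \<noteq> 0"
  shows "pole_regular \<gamma> w = tau w powr (of_real \<gamma> - 1) / (1 - tau w) * deriv tau w + 1 / w"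
proof -
  have "tau w \<noteq> 0" using tau_not_nonpos[OF w(1)] by auto
  then have p: "tau w powr (of_real \<gamma> - 1) = exp (of_real (\<gamma> - 1) * Ln (tau w))" by (simp add: powr_def)
  have "1 - tau w \<noteq> 0" using tau_neq_1[OF w] by simp
  then show ?thesis
    unfolding p using w by (simp add: pole_regular_def pole_numerator_def tau_quotient_def field_simps)
qed

text \<open>Adding 1 / w removes the whole principal part and leaves the coefficients of index k >=
  0 alone. The g_k thus become Taylor coefficients, accessible to Cauchy estimates.\<close>

lemma g_coeff_eq: "g_coeff \<alpha> k j = (deriv ^^ k) (pole_regular (\<alpha> - real j)) 0 / fact k"
proof -
  let ?\<gamma> = "\<alpha> - real j"
  let ?f = "\<lambda>w. tau w powr (of_real ?\<gamma> - 1) / (1 - tau w) * deriv tau w"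
  have "pole_regular ?\<gamma> analytic_on {0}"
    using holomorphic_pole_regular tau_radius_pos analytic_at by (metis centre_in_ball open_ball)
  then have "pole_regular ?\<gamma> has_laurent_expansion fps_to_fls (fps_expansion (pole_regular ?\<gamma>) 0)"
    by (intro has_laurent_expansion_fps analytic_at_imp_has_fps_expansion_0)
  then have "(\<lambda>w. pole_regular ?\<gamma> w - inverse w) has_laurent_expansion
     fps_to_fls (fps_expansion (pole_regular ?\<gamma>) 0) - fls_X_inv"
    by (intro has_laurent_expansion_diff has_laurent_expansion_fls_X_inv)
  moreover have ev: "\<forall>\<^sub>F w in at 0. pole_regular ?\<gamma> w - inverse w = ?f w"
  proof -
    have "\<forall>\<^sub>F w in at 0. w \<in> ball 0 tau_radius \<and> w \<noteq> (0::complex)"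
      using eventually_at_in_open[OF open_ball, of "0::complex" 0 tau_radius] tau_radius_pos by (auto simp: dist_norm)
    then show ?thesis by eventually_elim (auto simp: pole_regular_eq divide_inverse)
  qed
  ultimately have "?f has_laurent_expansion fps_to_fls (fps_expansion (pole_regular ?\<gamma>) 0) - fls_X_inv"
    by (simp only: has_laurent_expansion_cong[OF ev refl])
  then have "laurent_expansion ?f 0 = fps_to_fls (fps_expansion (pole_regular ?\<gamma>) 0) - fls_X_inv"
    by (rule laurent_expansion_0_eqI)
  then show ?thesis
    by (simp add: g_coeff_def fps_expansion_def)
qed

text \<open>Cauchy's estimates bound the tail by a geometric series of ratio at most 1/2, hence the
  factor 2. The constants depend on f only through its supremum on one circle, so a bound there that
  is uniform in a parameter makes the whole expansion uniform.\<close>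

lemma holomorphic_Taylor_remainder:
  assumes f: "f holomorphic_on ball 0 R" and r: "0 < r" "r < R"
    and C: "\<And>w. norm w = r \<Longrightarrow> norm (f w) \<le> C"
  shows "norm ((deriv ^^ k) f 0 / fact k) \<le> C / r ^ k"
    and "norm w \<le> r / 2 \<Longrightarrow> norm (f w - (\<Sum>k<K. (deriv ^^ k) f 0 / fact k * w ^ k)) \<le> 2 * C / r ^ K * norm w ^ K"
proof -
  let ?a = "\<lambda>k. (deriv ^^ k) f 0 / fact k"
  have a: "norm (?a k) \<le> C / r ^ k" for k
  proof -
    have "norm ((deriv ^^ k) f 0) \<le> fact k * C / r ^ k"
      using r C by (intro Cauchy_inequality holomorphic_on_subset[OF f] holomorphic_on_imp_continuous_on) auto
    then show ?thesis by (simp add: norm_divide field_simps)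
  qed
  then show "norm (?a k) \<le> C / r ^ k" .
  assume w: "norm w \<le> r / 2"
  have C0: "C \<ge> 0" using order_trans[OF norm_ge_zero C[of "of_real r"]] r by simp
  have "(\<lambda>k. ?a k * (w - 0) ^ k) sums f w"
    using w r by (intro holomorphic_power_series[OF f]) auto
  then have s: "(\<lambda>k. ?a (k + K) * w ^ (k + K)) sums (f w - (\<Sum>k<K. ?a k * w ^ k))"
    using sums_split_initial_segment by fastforce
  have "norm (f w - (\<Sum>k<K. ?a k * w ^ k)) \<le> (\<Sum>k. C / r ^ K * norm w ^ K * (1/2) ^ k)"
    unfolding sums_unique[OF s]
  proof (rule norm_suminf_le)
    show "summable (\<lambda>k. C / r ^ K * norm w ^ K * (1/2) ^ k)"
      by (intro summable_mult summable_geometric) simp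
    fix k
    have "norm (?a (k + K) * w ^ (k + K)) \<le> C / r ^ (k + K) * norm w ^ (k + K)"
      unfolding norm_mult norm_power by (intro mult_right_mono a) auto
    also have "\<dots> = C / r ^ K * norm w ^ K * (norm w / r) ^ k"
      by (simp add: power_add power_divide field_simps)
    also have "\<dots> \<le> C / r ^ K * norm w ^ K * (1/2) ^ k"
      using w r C0 by (intro mult_left_mono power_mono) (auto simp: field_simps)
    finally show "norm (?a (k + K) * w ^ (k + K)) \<le> C / r ^ K * norm w ^ K * (1/2) ^ k" .
  qed
  also have "\<dots> = C / r ^ K * norm w ^ K * 2"
    by (subst suminf_mult) (auto simp: suminf_geometric summable_geometric)
  finally show "norm (f w - (\<Sum>k<K. ?a k * w ^ k)) \<le> 2 * C / r ^ K * norm w ^ K"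
    by (simp add: mult_ac)
qed

text \<open>The parameter enters only through exp ((\<gamma> - 1) Ln tau), and Ln tau is bounded on
  the compact disc. Evaluating on the circle |w| = r avoids the removable singularity at 0.\<close>

lemma pole_regular_bound:
  assumes r: "0 < r" "r < tau_radius"
  shows "\<exists>C\<ge>0. \<forall>\<gamma> w. \<bar>\<gamma>\<bar> \<le> A \<longrightarrow> norm w = r \<longrightarrow> norm (pole_regular \<gamma> w) \<le> C"
proof -
  have sub: "cball 0 r \<subseteq> ball (0::complex) tau_radius" using r by auto
  have "compact ((\<lambda>w. Ln (tau w)) ` cball 0 r)"
    using tau_not_nonpos sub
    by (intro compact_continuous_image compact_cball holomorphic_on_imp_continuous_on holomorphic_on_subset[OF _ sub] holomorphic_intros holomorphic_tau) auto
  then have "bounded ((\<lambda>w. Ln (tau w)) ` cball 0 r)" by (rule compact_imp_bounded)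
  then obtain L where L: "\<And>w. w \<in> cball 0 r \<Longrightarrow> norm (Ln (tau w)) \<le> L"
    unfolding bounded_iff by blast
  have "compact ((\<lambda>w. deriv tau w / tau_quotient w) ` cball 0 r)"
    using tau_quotient_nonzero sub
    by (intro compact_continuous_image compact_cball holomorphic_on_imp_continuous_on holomorphic_on_subset[OF _ sub]
        holomorphic_on_divide holomorphic_deriv holomorphic_tau holomorphic_tau_quotient) auto
  then have "bounded ((\<lambda>w. deriv tau w / tau_quotient w) ` cball 0 r)" by (rule compact_imp_bounded)
  then obtain D where D: "\<And>w. w \<in> cball 0 r \<Longrightarrow> norm (deriv tau w / tau_quotient w) \<le> D"
    unfolding bounded_iff by blast
  have L0: "L \<ge> 0" and D0: "D \<ge> 0"
    using order_trans[OF norm_ge_zero L[of 0]] order_trans[OF norm_ge_zero D[of 0]] r by simp_all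
  show ?thesis
  proof (intro exI[of _ "(1 + exp ((A + 1) * L) * D) / r"] conjI allI impI)
    show "0 \<le> (1 + exp ((A + 1) * L) * D) / r" using D0 r by simp
    fix \<gamma> :: real and w :: complex assume \<gamma>: "\<bar>\<gamma>\<bar> \<le> A" and w: "norm w = r"
    then have wc: "w \<in> cball 0 r" "w \<noteq> 0" using r by auto
    have "norm (exp (of_real (\<gamma> - 1) * Ln (tau w))) \<le> exp (norm (of_real (\<gamma> - 1) * Ln (tau w)))"
      by (rule norm_exp)
    also have "\<dots> \<le> exp ((A + 1) * L)"
      unfolding norm_mult exp_le_cancel_iff using \<gamma> L0
      by (intro mult_mono L wc) (simp_all only: norm_of_real, auto)
    finally have "norm (exp (of_real (\<gamma> - 1) * Ln (tau w)) * (deriv tau w / tau_quotient w)) \<le> exp ((A + 1) * L) * D"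
      unfolding norm_mult using D[OF wc(1)] by (intro mult_mono) auto
    then have "norm (pole_numerator \<gamma> w) \<le> 1 + exp ((A + 1) * L) * D"
      unfolding pole_numerator_def times_divide_eq_right [symmetric]
      using norm_triangle_ineq4[of 1 "exp (of_real (\<gamma> - 1) * Ln (tau w)) * (deriv tau w / tau_quotient w)"] by simp
    then show "norm (pole_regular \<gamma> w) \<le> (1 + exp ((A + 1) * L) * D) / r"
      using wc w r by (simp add: pole_regular_def norm_divide divide_right_mono)
  qed
qed

lemma g_coeff_bound: "\<exists>C\<ge>0. \<forall>\<alpha>. \<bar>\<alpha>\<bar> \<le> A \<longrightarrow> norm (g_coeff \<alpha> k j) \<le> C"
proof -
  define r where "r = tau_radius / 2"
  have r: "0 < r" "r < tau_radius" using tau_radius_pos by (auto simp: r_def)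
  obtain C where C: "C \<ge> 0" "\<And>\<gamma> w. \<bar>\<gamma>\<bar> \<le> A + real j \<Longrightarrow> norm w = r \<Longrightarrow> norm (pole_regular \<gamma> w) \<le> C"
    using pole_regular_bound[OF r, of "A + real j"] by blast
  have "norm (g_coeff \<alpha> k j) \<le> C / r ^ k" if "\<bar>\<alpha>\<bar> \<le> A" for \<alpha>
    unfolding g_coeff_eq using that
    by (intro holomorphic_Taylor_remainder(1)[OF holomorphic_pole_regular r] C) auto
  then show ?thesis using C(1) r by (intro exI[of _ "C / r ^ k"]) auto
qed

text \<open>The supremum is taken on the circle of radius \<open>tau_radius / 2\<close>, and the
  Taylor estimate is valid up to half of it; hence \<open>tau_radius / 4\<close>.\<close>

lemma pole_regular_Taylor:
  "\<exists>C\<ge>0. \<forall>\<alpha> w. \<bar>\<alpha>\<bar> \<le> A \<longrightarrow> norm w \<le> tau_radius / 4 \<longrightarrow>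
     norm (pole_regular (\<alpha> - real j) w - (\<Sum>k<K. g_coeff \<alpha> k j * w ^ k)) \<le> C * norm w ^ K"
proof -
  define r where "r = tau_radius / 2"
  have r: "0 < r" "r < tau_radius" using tau_radius_pos by (auto simp: r_def)
  obtain C where C: "C \<ge> 0" "\<And>\<gamma> w. \<bar>\<gamma>\<bar> \<le> A + real j \<Longrightarrow> norm w = r \<Longrightarrow> norm (pole_regular \<gamma> w) \<le> C"
    using pole_regular_bound[OF r, of "A + real j"] by blast
  have "norm (pole_regular (\<alpha> - real j) w - (\<Sum>k<K. g_coeff \<alpha> k j * w ^ k)) \<le> 2 * C / r ^ K * norm w ^ K"
    if "\<bar>\<alpha>\<bar> \<le> A" "norm w \<le> tau_radius / 4" for \<alpha> w
    unfolding g_coeff_eq using that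
    by (intro holomorphic_Taylor_remainder(2)[OF holomorphic_pole_regular r] C) (auto simp: r_def)
  then show ?thesis using C(1) r by (intro exI[of _ "2 * C / r ^ K"]) auto
qed

section \<open>The principal value in the saddle point variable\<close>

text \<open>By \<open>tau_real\<close>, \<open>tau\<close> is real on the real part of the disc, so
  taking the real part only changes the type there; the same holds for the derivative.\<close>

definition tau_R :: "real \<Rightarrow> real" where "tau_R w = Re (tau (of_real w))"
definition dtau_R :: "real \<Rightarrow> real" where "dtau_R w = Re (deriv tau (of_real w))"

lemma of_real_in_ball: "\<bar>w\<bar> < r \<Longrightarrow> complex_of_real w \<in> ball 0 r"
  by simp

lemma of_real_tau_R: "\<bar>w\<bar> < tau_radius \<Longrightarrow> of_real (tau_R w) = tau (of_real w)"
  using tau_real[OF of_real_in_ball] by (simp add: tau_R_def complex_is_Real_iff complex_eq_iff)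

lemma holomorphic_imp_Re_Im_derivative:
  assumes f: "f holomorphic_on ball 0 r" and w: "\<bar>w\<bar> < r"
  shows "((\<lambda>x. Re (f (of_real x))) has_real_derivative Re (deriv f (of_real w))) (at w within S)"
    and "((\<lambda>x. Im (f (of_real x))) has_real_derivative Im (deriv f (of_real w))) (at w within S)"
proof -
  have "(f has_field_derivative deriv f (of_real w)) (at (of_real w))"
    using holomorphic_derivI[OF f open_ball of_real_in_ball[OF w]] .
  then have v: "((\<lambda>x. f (of_real x)) has_vector_derivative deriv f (of_real w)) (at w within S)"
    by (rule has_vector_derivative_real_field)
  show "((\<lambda>x. Re (f (of_real x))) has_real_derivative Re (deriv f (of_real w))) (at w within S)"
    using bounded_linear.has_vector_derivative[OF bounded_linear_Re v]
    by (simp add: has_real_derivative_iff_has_vector_derivative)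
  show "((\<lambda>x. Im (f (of_real x))) has_real_derivative Im (deriv f (of_real w))) (at w within S)"
    using bounded_linear.has_vector_derivative[OF bounded_linear_Im v]
    by (simp add: has_real_derivative_iff_has_vector_derivative)
qed

lemma tau_R_deriv: "\<bar>w\<bar> < tau_radius \<Longrightarrow> (tau_R has_real_derivative dtau_R w) (at w within S)"
  unfolding tau_R_def [abs_def] dtau_R_def
  by (rule holomorphic_imp_Re_Im_derivative(1)[OF holomorphic_tau])

lemma of_real_dtau_R:
  assumes w: "\<bar>w\<bar> < tau_radius"
  shows "of_real (dtau_R w) = deriv tau (of_real w)"
proof -
  have "((\<lambda>x. Im (tau (of_real x))) has_real_derivative Im (deriv tau (of_real w))) (at w)"
    by (rule holomorphic_imp_Re_Im_derivative(2)[OF holomorphic_tau w])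
  moreover have "((\<lambda>x. Im (tau (of_real x))) has_real_derivative 0) (at w)"
  proof (rule has_field_derivative_transform_within[OF DERIV_const])
    show "0 < tau_radius - \<bar>w\<bar>" using w by simp
    show "w \<in> UNIV" by simp
    fix y assume "dist y w < tau_radius - \<bar>w\<bar>"
    then have "\<bar>y\<bar> < tau_radius" by (auto simp: dist_real_def)
    from tau_real[OF of_real_in_ball[OF this]] show "0 = Im (tau (of_real y))"
      by (simp add: complex_is_Real_iff)
  qed
  ultimately have "Im (deriv tau (of_real w)) = 0" by (rule DERIV_unique)
  then show ?thesis by (simp add: dtau_R_def complex_eq_iff)
qed

lemma dtau_R_pos: "\<bar>w\<bar> < tau_radius \<Longrightarrow> dtau_R w > 0"
  unfolding dtau_R_def by (rule Re_deriv_tau_pos[OF of_real_in_ball])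

lemma tau_R_0: "tau_R 0 = 1"
  by (simp add: tau_R_def tau_0)

lemma tau_R_bounds:
  assumes "\<bar>w\<bar> < tau_radius"
  shows "1/2 < tau_R w" "tau_R w < 3/2"
  using tau_close[OF of_real_in_ball[OF assms]] abs_Re_le_cmod[of "tau (of_real w) - 1"]
  by (auto simp: tau_R_def)

lemma tau_R_eq:
  assumes "\<bar>w\<bar> < tau_radius"
  shows "w\<^sup>2 / 2 = tau_R w - ln (tau_R w) - 1"
proof -
  have "complex_of_real (w\<^sup>2 / 2) = of_real (tau_R w) - Ln (of_real (tau_R w)) - 1"
    using tau_eq[OF of_real_in_ball[OF assms]] by (simp add: of_real_tau_R[OF assms])
  also have "\<dots> = of_real (tau_R w - ln (tau_R w) - 1)"
    using tau_R_bounds[OF assms] by (simp add: Ln_of_real)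
  finally show ?thesis by (simp only: of_real_eq_iff)
qed

lemma tau_R_strict_mono:
  assumes "\<bar>u\<bar> < tau_radius" "\<bar>v\<bar> < tau_radius" "u < v"
  shows "tau_R u < tau_R v"
proof (rule DERIV_pos_imp_increasing[OF assms(3)])
  fix x assume "u \<le> x" "x \<le> v"
  then have "\<bar>x\<bar> < tau_radius" using assms by auto
  then show "\<exists>y. (tau_R has_real_derivative y) (at x) \<and> 0 < y"
    using tau_R_deriv dtau_R_pos by blast
qed

lemma tau_R_neq_1: "\<bar>w\<bar> < tau_radius \<Longrightarrow> w \<noteq> 0 \<Longrightarrow> tau_R w \<noteq> 1"
  using tau_R_strict_mono[of 0 w] tau_R_strict_mono[of w 0] tau_radius_pos tau_R_0
  by (cases "w > 0") auto

lemma continuous_on_tau_R: "S \<subseteq> {-tau_radius<..<tau_radius} \<Longrightarrow> continuous_on S tau_R"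
  by (rule DERIV_continuous_on[OF tau_R_deriv]) (auto simp: abs_less_iff subset_iff)

lemma continuous_on_dtau_R:
  assumes "S \<subseteq> {-tau_radius<..<tau_radius}"
  shows "continuous_on S dtau_R"
proof -
  have d: "deriv tau holomorphic_on ball 0 tau_radius" by (intro holomorphic_deriv holomorphic_tau open_ball)
  show ?thesis unfolding dtau_R_def [abs_def]
    by (rule DERIV_continuous_on[OF holomorphic_imp_Re_Im_derivative(1)[OF d]]) (use assms in \<open>auto simp: abs_less_iff subset_iff\<close>)
qed

text \<open>\<open>l\<close> is minus the logarithmic derivative of (tau - 1) / w. It extends dtau /
  (1 - tau) + 1 / w continuously across w = 0 and has an elementary antiderivative; at the end
  points - \<delta> and \<delta> the contributions ln \<delta> cancel. The value is the principal
  value of the integral of 1 / (1 - t) over the image interval.\<close>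

lemma log_integral:
  assumes \<delta>: "0 < \<delta>" "\<delta> < tau_radius"
  defines "l \<equiv> \<lambda>w. - Re (deriv tau_quotient (of_real w)) / Re (tau_quotient (of_real w))"
  shows "continuous_on {-\<delta>..\<delta>} l"
    and "\<And>w. w \<in> {-\<delta>..\<delta>} \<Longrightarrow> w \<noteq> 0 \<Longrightarrow> l w = dtau_R w / (1 - tau_R w) + 1 / w"
    and "(LINT w:{-\<delta>..\<delta>}|lborel. l w) = ln (1 - tau_R (-\<delta>)) - ln (tau_R \<delta> - 1)"
proof -
  let ?k = "\<lambda>w. Re (tau_quotient (of_real w))"
  have lt: "\<bar>w\<bar> < tau_radius" if "w \<in> {-\<delta>..\<delta>}" for w using that \<delta> by auto
  have kd: "(?k has_real_derivative Re (deriv tau_quotient (of_real w))) (at w within S)" if "w \<in> {-\<delta>..\<delta>}" for w S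
    by (rule holomorphic_imp_Re_Im_derivative(1)[OF holomorphic_tau_quotient lt[OF that]])
  have ke: "?k w = (tau_R w - 1) / w" if "w \<noteq> 0" for w
    using that by (simp add: tau_quotient_def tau_R_def Re_divide_of_real)
  have kpos: "?k w > 0" if w: "w \<in> {-\<delta>..\<delta>}" for w
  proof (cases "w = 0")
    case True then show ?thesis by (simp add: tau_quotient_def)
  next
    case False
    show ?thesis unfolding ke[OF False]
      using False tau_R_strict_mono[of 0 w] tau_R_strict_mono[of w 0] lt[OF w] tau_radius_pos tau_R_0
      by (cases "w > 0") (auto simp: divide_pos_pos divide_neg_neg)
  qed
  have dc: "continuous_on {-\<delta>..\<delta>} (\<lambda>w. Re (deriv tau_quotient (of_real w)))"
  proof -
    have d: "deriv tau_quotient holomorphic_on ball 0 tau_radius"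
      by (intro holomorphic_deriv holomorphic_tau_quotient open_ball)
    show ?thesis by (rule DERIV_continuous_on[OF holomorphic_imp_Re_Im_derivative(1)[OF d lt]]) simp
  qed
  have kc: "continuous_on {-\<delta>..\<delta>} ?k" by (rule DERIV_continuous_on[OF kd]) simp
  show lc: "continuous_on {-\<delta>..\<delta>} l"
    unfolding l_def by (intro continuous_on_divide continuous_on_minus dc kc ballI less_imp_neq[THEN not_sym] kpos)
  show "l w = dtau_R w / (1 - tau_R w) + 1 / w" if w: "w \<in> {-\<delta>..\<delta>}" "w \<noteq> 0" for w
  proof -
    have "((\<lambda>w. (tau_R w - 1) / w) has_real_derivative (dtau_R w * w - (tau_R w - 1)) / (w * w)) (at w)"
      using w tau_R_deriv[OF lt[OF w(1)]] by (auto intro!: derivative_eq_intros)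
    moreover have "(?k has_real_derivative Re (deriv tau_quotient (of_real w))) (at w)"
      by (rule kd[OF w(1)])
    then have "((\<lambda>w. (tau_R w - 1) / w) has_real_derivative Re (deriv tau_quotient (of_real w))) (at w)"
      by (rule has_field_derivative_transform_within[where d = "\<bar>w\<bar>"]) (use w ke in \<open>auto simp: dist_real_def\<close>)
    ultimately have e: "Re (deriv tau_quotient (of_real w)) = (dtau_R w * w - (tau_R w - 1)) / (w * w)"
      by (rule DERIV_unique[symmetric])
    have "tau_R w \<noteq> 1" using tau_R_neq_1[OF lt[OF w(1)] w(2)] .
    then show ?thesis unfolding l_def e ke[OF w(2)] using w(2) by (simp add: divide_simps) (simp add: algebra_simps)
  qed
  have "(LINT w:{-\<delta>..\<delta>}|lborel. l w) = - ln (?k \<delta>) - - ln (?k (-\<delta>))"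
    unfolding set_lebesgue_integral_def
  proof (rule integral_FTC_atLeastAtMost[OF _ _ lc])
    show "- \<delta> \<le> \<delta>" using \<delta> by simp
    fix w assume "- \<delta> \<le> w" "w \<le> \<delta>"
    then have w: "w \<in> {-\<delta>..\<delta>}" by simp
    have "((\<lambda>w. - ln (?k w)) has_real_derivative l w) (at w within {-\<delta>..\<delta>})"
      using DERIV_minus[OF DERIV_chain2[OF DERIV_ln_divide[OF kpos[OF w]] kd[OF w]]] by (simp add: l_def)
    then show "((\<lambda>w. - ln (?k w)) has_vector_derivative l w) (at w within {-\<delta>..\<delta>})"
      by (simp add: has_real_derivative_iff_has_vector_derivative)
  qed
  also have "\<dots> = ln (1 - tau_R (-\<delta>)) - ln (tau_R \<delta> - 1)"
  proof -
    have "tau_R (-\<delta>) < 1" "tau_R \<delta> > 1"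
      using tau_R_strict_mono[of "-\<delta>" 0] tau_R_strict_mono[of 0 \<delta>] \<delta> tau_R_0 by auto
    moreover have "?k \<delta> = (tau_R \<delta> - 1) / \<delta>" "?k (-\<delta>) = (1 - tau_R (-\<delta>)) / \<delta>"
      using ke[of \<delta>] ke[of "-\<delta>"] \<delta> by (simp_all add: divide_simps)
    ultimately show ?thesis using \<delta> by (simp add: ln_div)
  qed
  finally show "(LINT w:{-\<delta>..\<delta>}|lborel. l w) = ln (1 - tau_R (-\<delta>)) - ln (tau_R \<delta> - 1)" .
qed

text \<open>The real part of 1 / (z - t) for z on the vertical line through 1, at height 1 / (i +
  1).\<close>

definition pv_kernel :: "nat \<Rightarrow> real \<Rightarrow> real" where
  "pv_kernel i t = (1 - t) / ((1 - t)\<^sup>2 + (1 / real (Suc i))\<^sup>2)"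

lemma pv_kernel_denominator: "(1 - t)\<^sup>2 + (1 / real (Suc i))\<^sup>2 > 0"
  by (intro add_nonneg_pos) auto

lemma pv_kernel_mult_le: "\<bar>pv_kernel i t\<bar> * \<bar>1 - t\<bar> \<le> 1"
proof -
  have "\<bar>pv_kernel i t\<bar> * \<bar>1 - t\<bar> = (1 - t)\<^sup>2 / ((1 - t)\<^sup>2 + (1 / real (Suc i))\<^sup>2)"
    using pv_kernel_denominator[of t i] by (simp add: pv_kernel_def abs_mult [symmetric] power2_eq_square)
  also have "\<dots> \<le> 1" using pv_kernel_denominator[of t i] by (subst divide_le_eq_1_pos) auto
  finally show ?thesis .
qed

lemma pv_kernel_tendsto: "t \<noteq> 1 \<Longrightarrow> (\<lambda>i. pv_kernel i t) \<longlonglongrightarrow> 1 / (1 - t)"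
proof -
  assume t: "t \<noteq> 1"
  have "(\<lambda>i. 1 / real (Suc i)) \<longlonglongrightarrow> 0" by (rule LIMSEQ_Suc[OF lim_1_over_n])
  then have "(\<lambda>i. pv_kernel i t) \<longlonglongrightarrow> (1 - t) / ((1 - t)\<^sup>2 + 0\<^sup>2)"
    unfolding pv_kernel_def using t by (intro tendsto_intros) auto
  then show ?thesis using t by (simp add: power2_eq_square)
qed

lemma continuous_on_pv_kernel: "continuous_on S (pv_kernel i)"
  unfolding pv_kernel_def [abs_def] using pv_kernel_denominator
  by (intro continuous_intros) (auto simp: less_imp_neq[THEN not_sym])

lemma pv_kernel_log_integral:
  assumes \<delta>: "0 < \<delta>" "\<delta> < tau_radius"
  shows "(LINT w:{-\<delta>..\<delta>}|lborel. dtau_R w * pv_kernel i (tau_R w)) =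
     ln ((1 - tau_R (-\<delta>))\<^sup>2 + (1 / real (Suc i))\<^sup>2) / 2 - ln ((1 - tau_R \<delta>)\<^sup>2 + (1 / real (Suc i))\<^sup>2) / 2"
proof -
  let ?L = "\<lambda>w. - ln ((1 - tau_R w)\<^sup>2 + (1 / real (Suc i))\<^sup>2) / 2"
  have sub: "{-\<delta>..\<delta>} \<subseteq> {-tau_radius<..<tau_radius}" using \<delta> by auto
  have "(LINT w:{-\<delta>..\<delta>}|lborel. dtau_R w * pv_kernel i (tau_R w)) = ?L \<delta> - ?L (-\<delta>)"
    unfolding set_lebesgue_integral_def
  proof (rule integral_FTC_atLeastAtMost)
    show "- \<delta> \<le> \<delta>" using \<delta> by simp
    show "continuous_on {-\<delta>..\<delta>} (\<lambda>w. dtau_R w * pv_kernel i (tau_R w))"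
      by (intro continuous_on_mult continuous_on_dtau_R sub continuous_on_compose2[OF continuous_on_pv_kernel[of UNIV] continuous_on_tau_R[OF sub]]) auto
    fix w assume "- \<delta> \<le> w" "w \<le> \<delta>"
    then have w: "\<bar>w\<bar> < tau_radius" using \<delta> by auto
    let ?D = "\<lambda>w. (1 - tau_R w)\<^sup>2 + (1 / real (Suc i))\<^sup>2"
    have "(?D has_real_derivative 2 * (1 - tau_R w) * (- dtau_R w)) (at w within {-\<delta>..\<delta>})"
      by (auto intro!: derivative_eq_intros tau_R_deriv[OF w])
    note D = DERIV_cdivide[OF DERIV_minus[OF DERIV_chain2[OF DERIV_ln_divide[OF pv_kernel_denominator] this]], of 2]
    have "- (1 / E * (2 * A * (- d))) / 2 = d * (A / E)" for A d E :: real by simp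
    from DERIV_cong[OF D this]
    have "(?L has_real_derivative dtau_R w * pv_kernel i (tau_R w)) (at w within {-\<delta>..\<delta>})"
      unfolding pv_kernel_def .
    then show "(?L has_vector_derivative dtau_R w * pv_kernel i (tau_R w)) (at w within {-\<delta>..\<delta>})"
      by (simp add: has_real_derivative_iff_has_vector_derivative)
  qed
  then show ?thesis by simp
qed

text \<open>Near the pole, F is split into F - F(1) and the constant F(1). The Lipschitz bound
  cancels the singularity of the kernel, so the first part converges dominatedly; the second is an
  explicit logarithm. Away from the pole the kernel is dominated by 1 / |1 - t|. In the variable w
  the pole is compensated by \<open>F 1 / of_real w\<close>, whose own principal value over the
  symmetric interval is zero.\<close>

lemma principal_value_limit:
  fixes F :: "real \<Rightarrow> complex"
  assumes \<delta>: "0 < \<delta>" "\<delta> < tau_radius"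
  defines "a \<equiv> tau_R (-\<delta>)" and "b \<equiv> tau_R \<delta>"
  assumes cF: "continuous_on {0<..} F"
    and lip: "\<And>t. t \<in> {a..b} \<Longrightarrow> norm (F t - F 1) \<le> L * \<bar>t - 1\<bar>"
    and int: "\<And>i. set_integrable lborel {0<..} (\<lambda>t. of_real (pv_kernel i t) * F t)"
    and far: "set_integrable lborel ({0<..} - {a..b}) (\<lambda>t. F t / of_real (1 - t))"
  shows "(\<lambda>i. LINT t:{0<..}|lborel. of_real (pv_kernel i t) * F t) \<longlonglongrightarrow>
    (LINT w:{-\<delta>..\<delta>}|lborel. F (tau_R w) * of_real (dtau_R w / (1 - tau_R w)) + F 1 / of_real w) +
    (LINT t:{0<..} - {a..b}|lborel. F t / of_real (1 - t))"
proof -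
  let ?I = "{-\<delta>..\<delta>}"
  have sub: "?I \<subseteq> {-tau_radius<..<tau_radius}" using \<delta> by auto
  have lt: "\<bar>w\<bar> < tau_radius" if "w \<in> ?I" for w using that \<delta> by auto
  have ab: "1/2 < a" "a < 1" "1 < b" "b < 3/2"
    using tau_R_strict_mono[of "-\<delta>" 0] tau_R_strict_mono[of 0 \<delta>] \<delta> tau_R_0 tau_R_bounds[of \<delta>] tau_R_bounds[of "-\<delta>"]
    by (auto simp: a_def b_def)
  have Tab: "tau_R w \<in> {a..b}" if "w \<in> ?I" for w
  proof -
    have "tau_R (-\<delta>) \<le> tau_R w" using that lt[OF that] \<delta> tau_R_strict_mono[of "-\<delta>" w] by (cases "w = -\<delta>") auto
    moreover have "tau_R w \<le> tau_R \<delta>" using that lt[OF that] \<delta> tau_R_strict_mono[of w \<delta>] by (cases "w = \<delta>") auto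
    ultimately show ?thesis by (simp add: a_def b_def)
  qed
  have L0: "L \<ge> 0"
  proof -
    have "0 \<le> L * \<bar>b - 1\<bar>" using lip[of b] ab norm_ge_zero order_trans by (metis atLeastAtMost_iff less_imp_le order_refl order_less_trans)
    then show ?thesis using ab by (simp add: zero_le_mult_iff)
  qed
  have cFT: "continuous_on ?I (\<lambda>w. F (tau_R w))"
    using Tab ab by (intro continuous_on_compose2[OF cF continuous_on_tau_R[OF sub]]) force
  have cK: "continuous_on ?I (\<lambda>w. pv_kernel i (tau_R w))" for i
    by (rule continuous_on_compose2[OF continuous_on_pv_kernel[of UNIV] continuous_on_tau_R[OF sub]]) auto
  have cd: "continuous_on ?I dtau_R" by (rule continuous_on_dtau_R[OF sub])
  let ?g = "\<lambda>i w. of_real (dtau_R w * pv_kernel i (tau_R w)) * (F (tau_R w) - F 1)"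
  let ?G = "\<lambda>w. of_real (dtau_R w / (1 - tau_R w)) * (F (tau_R w) - F 1)"
  have near: "(LINT t:{a..b}|lborel. of_real (pv_kernel i t) * F t) =
    (LINT w:?I|lborel. ?g i w) + F 1 * of_real (LINT w:?I|lborel. dtau_R w * pv_kernel i (tau_R w))" for i
  proof -
    have ci: "continuous_on {a..b} (\<lambda>t. of_real (pv_kernel i t) * F t)"
      using ab by (intro continuous_on_mult continuous_on_of_real continuous_on_pv_kernel continuous_on_subset[OF cF]) auto
    have "(LINT t:{a..b}|lborel. of_real (pv_kernel i t) * F t) = (LBINT t=a..b. of_real (pv_kernel i t) * F t)"
      using ab by (simp add: interval_integral_Icc)
    also have "\<dots> = (LBINT w=-\<delta>..\<delta>. dtau_R w *\<^sub>R (of_real (pv_kernel i (tau_R w)) * F (tau_R w)))"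
      unfolding a_def b_def
    proof (rule interval_integral_substitution_finite[symmetric])
      show "- \<delta> \<le> \<delta>" using \<delta> by simp
      show "(tau_R has_real_derivative dtau_R w) (at w within {-\<delta>..\<delta>})" if "-\<delta> \<le> w" "w \<le> \<delta>" for w
        using that by (intro tau_R_deriv lt) auto
      show "continuous_on (tau_R ` {-\<delta>..\<delta>}) (\<lambda>t. of_real (pv_kernel i t) * F t)"
        using Tab by (intro continuous_on_subset[OF ci]) auto
      show "continuous_on {-\<delta>..\<delta>} dtau_R" by (rule cd)
    qed
    also have "\<dots> = (LINT w:?I|lborel. dtau_R w *\<^sub>R (of_real (pv_kernel i (tau_R w)) * F (tau_R w)))"
      using \<delta> interval_integral_Icc[of "-\<delta>" \<delta>] by simp
    also have "\<dots> = (LINT w:?I|lborel. ?g i w + F 1 * of_real (dtau_R w * pv_kernel i (tau_R w)))"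
      by (intro set_lebesgue_integral_cong) (auto simp: scaleR_conv_of_real algebra_simps)
    also have "\<dots> = (LINT w:?I|lborel. ?g i w) + (LINT w:?I|lborel. F 1 * of_real (dtau_R w * pv_kernel i (tau_R w)))"
    proof (rule set_integral_add(2))
      show "set_integrable lborel ?I (?g i)" "set_integrable lborel ?I (\<lambda>w. F 1 * of_real (dtau_R w * pv_kernel i (tau_R w)))"
        by (intro borel_integrable_atLeastAtMost' continuous_intros cK cd cFT)+
    qed
    also have "(LINT w:?I|lborel. F 1 * of_real (dtau_R w * pv_kernel i (tau_R w))) = F 1 * of_real (LINT w:?I|lborel. dtau_R w * pv_kernel i (tau_R w))"
      by (simp only: set_integral_mult_right set_integral_complex_of_real)
    finally show ?thesis .
  qed
  have bnd: "set_integrable lborel ?I (\<lambda>w. L * dtau_R w)"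
    by (intro borel_integrable_atLeastAtMost' continuous_intros cd)
  have mT: "(\<lambda>w. indicator ?I w *\<^sub>R tau_R w) \<in> borel_measurable borel"
     "(\<lambda>w. indicator ?I w *\<^sub>R dtau_R w) \<in> borel_measurable borel"
     "(\<lambda>w. indicator ?I w *\<^sub>R F (tau_R w)) \<in> borel_measurable borel"
    by (intro borel_measurable_continuous_on_indicator continuous_on_tau_R sub cd cFT; simp)+
  have Gm: "(\<lambda>w. indicator ?I w *\<^sub>R ?G w) \<in> borel_measurable lborel"
  proof -
    have "(\<lambda>w. of_real ((indicator ?I w *\<^sub>R dtau_R w) / (1 - indicator ?I w *\<^sub>R tau_R w)) * ((indicator ?I w *\<^sub>R F (tau_R w)) - F 1)) \<in> borel_measurable borel"
      using mT by measurable
    also have "(\<lambda>w. of_real ((indicator ?I w *\<^sub>R dtau_R w) / (1 - indicator ?I w *\<^sub>R tau_R w)) * ((indicator ?I w *\<^sub>R F (tau_R w)) - F 1)) = (\<lambda>w. indicator ?I w *\<^sub>R ?G w)"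
      by (auto simp: fun_eq_iff indicator_def)
    finally show ?thesis by simp
  qed
  have gm: "(\<lambda>w. indicator ?I w *\<^sub>R ?g i w) \<in> borel_measurable lborel" for i
  proof -
    have "continuous_on ?I (?g i)" by (intro continuous_intros cK cd cFT)
    then show ?thesis using borel_measurable_continuous_on_indicator[of ?I "?g i"] by simp
  qed
  have conv: "AE w in lborel. (\<lambda>i. indicator ?I w *\<^sub>R ?g i w) \<longlonglongrightarrow> indicator ?I w *\<^sub>R ?G w"
    using AE_lborel_singleton[of "0::real"]
  proof eventually_elim
    case (elim w)
    show ?case
    proof (cases "w \<in> ?I")
      case True
      have "(\<lambda>i. of_real (dtau_R w * pv_kernel i (tau_R w)) * (F (tau_R w) - F 1)) \<longlonglongrightarrow> of_real (dtau_R w * (1 / (1 - tau_R w))) * (F (tau_R w) - F 1)"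
        by (intro tendsto_intros pv_kernel_tendsto tau_R_neq_1 lt True elim)
      then show ?thesis using True by simp
    qed simp
  qed
  have dom: "norm (indicator ?I w *\<^sub>R ?g i w) \<le> indicator ?I w *\<^sub>R (L * dtau_R w)" for i w
  proof (cases "w \<in> ?I")
    case True
    have d: "dtau_R w \<ge> 0" using dtau_R_pos[OF lt[OF True]] by simp
    have "norm (?g i w) = dtau_R w * (\<bar>pv_kernel i (tau_R w)\<bar> * norm (F (tau_R w) - F 1))"
      using d by (simp add: norm_mult abs_mult)
    also have "\<dots> \<le> dtau_R w * (\<bar>pv_kernel i (tau_R w)\<bar> * (L * \<bar>tau_R w - 1\<bar>))"
      using d by (intro mult_left_mono lip Tab True) auto
    also have "\<dots> = L * dtau_R w * (\<bar>pv_kernel i (tau_R w)\<bar> * \<bar>1 - tau_R w\<bar>)"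
      by (simp add: abs_minus_commute)
    also have "\<dots> \<le> L * dtau_R w * 1"
      using d L0 by (intro mult_left_mono pv_kernel_mult_le) auto
    finally show ?thesis using True by simp
  qed simp
  have lim1: "(\<lambda>i. LINT w:?I|lborel. ?g i w) \<longlonglongrightarrow> (LINT w:?I|lborel. ?G w)"
    unfolding set_lebesgue_integral_def
    by (rule integral_dominated_convergence[OF Gm gm bnd[unfolded set_integrable_def] conv]) (use dom in auto)
  have iG: "set_integrable lborel ?I ?G"
    unfolding set_integrable_def
    by (rule integrable_dominated_convergence[OF Gm gm bnd[unfolded set_integrable_def] conv]) (use dom in auto)
  define l where "l = (\<lambda>w. - Re (deriv tau_quotient (of_real w)) / Re (tau_quotient (of_real w)))"
  note l = log_integral[OF \<delta>, folded l_def]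
  \<comment> \<open>The smoothed logarithms converge to precisely the value found in
    \<open>log_integral\<close>. Hence passing from the principal value in t to the symmetric
    interval in w creates no additional multiple of \<open>F 1\<close>.\<close>
  have lim2: "(\<lambda>i. LINT w:?I|lborel. dtau_R w * pv_kernel i (tau_R w)) \<longlonglongrightarrow> (LINT w:?I|lborel. l w)"
  proof -
    have e: "(\<lambda>i. 1 / real (Suc i)) \<longlonglongrightarrow> 0" by (rule LIMSEQ_Suc[OF lim_1_over_n])
    have "(\<lambda>i. ln ((1 - a)\<^sup>2 + (1 / real (Suc i))\<^sup>2) / 2 - ln ((1 - b)\<^sup>2 + (1 / real (Suc i))\<^sup>2) / 2)
       \<longlonglongrightarrow> ln ((1 - a)\<^sup>2 + 0\<^sup>2) / 2 - ln ((1 - b)\<^sup>2 + 0\<^sup>2) / 2"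
      using ab by (intro tendsto_intros e) auto
    also have "ln ((1 - a)\<^sup>2 + 0\<^sup>2) / 2 - ln ((1 - b)\<^sup>2 + 0\<^sup>2) / 2 = ln (1 - a) - ln (b - 1)"
    proof -
      have "(1 - b)\<^sup>2 = (b - 1)\<^sup>2" by (simp add: power2_commute)
      then show ?thesis using ab ln_realpow[of "1 - a" 2] ln_realpow[of "b - 1" 2] by simp
    qed
    finally show ?thesis
      unfolding pv_kernel_log_integral[OF \<delta>] l(3) a_def b_def .
  qed
  have nearval: "(LINT w:?I|lborel. ?G w) + F 1 * of_real (LINT w:?I|lborel. l w) =
    (LINT w:?I|lborel. F (tau_R w) * of_real (dtau_R w / (1 - tau_R w)) + F 1 / of_real w)"
  proof -
    have il: "set_integrable lborel ?I (\<lambda>w. F 1 * of_real (l w))"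
      by (intro borel_integrable_atLeastAtMost' continuous_intros l(1))
    have "(LINT w:?I|lborel. ?G w) + F 1 * of_real (LINT w:?I|lborel. l w) = (LINT w:?I|lborel. ?G w) + (LINT w:?I|lborel. F 1 * of_real (l w))"
      by (simp only: set_integral_mult_right set_integral_complex_of_real)
    also have "\<dots> = (LINT w:?I|lborel. ?G w + F 1 * of_real (l w))"
      by (rule set_integral_add(2)[OF iG il, symmetric])
    also have "\<dots> = (LINT w:?I|lborel. F (tau_R w) * of_real (dtau_R w / (1 - tau_R w)) + F 1 / of_real w)"
      unfolding set_lebesgue_integral_def
    \<comment> \<open>At w = 0 the divisions take the default value 0, whereas \<open>l\<close> has
      its continuous value; one point is a null set.\<close>
    proof (rule integral_discrete_difference[where X = "{0}"])
      fix w :: real assume "w \<in> space lborel" "w \<notin> {0}"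
      then show "indicator ?I w *\<^sub>R (?G w + F 1 * of_real (l w)) = indicator ?I w *\<^sub>R (F (tau_R w) * of_real (dtau_R w / (1 - tau_R w)) + F 1 / of_real w)"
      proof (cases "w \<in> ?I")
        case True
        have "l w = dtau_R w / (1 - tau_R w) + 1 / w"
          using log_integral(2)[OF \<delta> True] \<open>w \<notin> {0}\<close> by (simp add: l_def)
        then have lw: "complex_of_real (l w) = of_real (dtau_R w / (1 - tau_R w)) + 1 / of_real w" by simp
        have "c * (A - B) + B * (c + 1 / d) = A * c + B / d" for A B c d :: complex
          by (simp add: algebra_simps)
        then show ?thesis unfolding lw by (simp only:)
      qed simp
    qed auto
    finally show ?thesis .
  qed
  have limnear: "(\<lambda>i. LINT t:{a..b}|lborel. of_real (pv_kernel i t) * F t) \<longlonglongrightarrow>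
     (LINT w:?I|lborel. F (tau_R w) * of_real (dtau_R w / (1 - tau_R w)) + F 1 / of_real w)"
    unfolding near nearval [symmetric] by (intro tendsto_intros lim1 lim2)
  have ifar: "set_integrable lborel ({0<..} - {a..b}) (\<lambda>t. of_real (pv_kernel i t) * F t)" for i
    by (rule set_integrable_subset[OF int]) auto
  have inear: "set_integrable lborel {a..b} (\<lambda>t. of_real (pv_kernel i t) * F t)" for i
    by (rule set_integrable_subset[OF int]) (use ab in auto)
  have limfar: "(\<lambda>i. LINT t:{0<..} - {a..b}|lborel. of_real (pv_kernel i t) * F t) \<longlonglongrightarrow>
     (LINT t:{0<..} - {a..b}|lborel. F t / of_real (1 - t))"
    unfolding set_lebesgue_integral_def
  proof (rule integral_dominated_convergence)
    show "integrable lborel (\<lambda>t. norm (indicator ({0<..} - {a..b}) t *\<^sub>R (F t / of_real (1 - t))))"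
      using far unfolding set_integrable_def by (rule integrable_norm)
    show "(\<lambda>t. indicator ({0<..} - {a..b}) t *\<^sub>R (F t / of_real (1 - t))) \<in> borel_measurable lborel"
      using far unfolding set_integrable_def by (rule borel_measurable_integrable)
    show "(\<lambda>t. indicator ({0<..} - {a..b}) t *\<^sub>R (of_real (pv_kernel i t) * F t)) \<in> borel_measurable lborel" for i
      using ifar[of i] unfolding set_integrable_def by (rule borel_measurable_integrable)
    show "AE t in lborel. (\<lambda>i. indicator ({0<..} - {a..b}) t *\<^sub>R (of_real (pv_kernel i t) * F t)) \<longlonglongrightarrow> indicator ({0<..} - {a..b}) t *\<^sub>R (F t / of_real (1 - t))"
    proof (rule AE_I2)
      fix t show "(\<lambda>i. indicator ({0<..} - {a..b}) t *\<^sub>R (of_real (pv_kernel i t) * F t)) \<longlonglongrightarrow> indicator ({0<..} - {a..b}) t *\<^sub>R (F t / of_real (1 - t))"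
      proof (cases "t \<in> {0<..} - {a..b}")
        case True
        then have "t \<noteq> 1" using ab by auto
        then have "(\<lambda>i. of_real (pv_kernel i t) * F t) \<longlonglongrightarrow> of_real (1 / (1 - t)) * F t"
          by (intro tendsto_intros pv_kernel_tendsto)
        then show ?thesis using True by simp
      qed simp
    qed
    show "AE t in lborel. norm (indicator ({0<..} - {a..b}) t *\<^sub>R (of_real (pv_kernel i t) * F t)) \<le> norm (indicator ({0<..} - {a..b}) t *\<^sub>R (F t / of_real (1 - t)))" for i
    proof (rule AE_I2)
      fix t show "norm (indicator ({0<..} - {a..b}) t *\<^sub>R (of_real (pv_kernel i t) * F t)) \<le> norm (indicator ({0<..} - {a..b}) t *\<^sub>R (F t / of_real (1 - t)))"
      proof (cases "t \<in> {0<..} - {a..b}")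
        case True
        then have t1: "\<bar>1 - t\<bar> > 0" using ab by auto
        then have "\<bar>pv_kernel i t\<bar> \<le> 1 / \<bar>1 - t\<bar>" using pv_kernel_mult_le[of i t] by (simp add: le_divide_eq)
        then have "\<bar>pv_kernel i t\<bar> * norm (F t) \<le> 1 / \<bar>1 - t\<bar> * norm (F t)" by (rule mult_right_mono) simp
        then show ?thesis using True by (simp add: norm_mult norm_divide del: of_real_diff)
      qed simp
    qed
  qed
  have split: "(LINT t:{0<..}|lborel. of_real (pv_kernel i t) * F t) =
     (LINT t:{a..b}|lborel. of_real (pv_kernel i t) * F t) + (LINT t:{0<..} - {a..b}|lborel. of_real (pv_kernel i t) * F t)" for i
  proof -
    have "{0<..} = {a..b} \<union> ({0<..} - {a..b})" using ab by auto
    then show ?thesis using set_integral_Un[OF _ inear[of i] ifar[of i]] by simp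
  qed
  show ?thesis unfolding split by (intro tendsto_add limnear limfar)
qed

section \<open>Laplace's method\<close>

text \<open>The moment of order 2 k of exp (- w^2) over the real line, that is Gamma (k + 1/2); it
  is the origin of the factor (1/2)_k in B_j.\<close>

definition gauss_moment :: "nat \<Rightarrow> real" where
  "gauss_moment k = sqrt pi * (fact (2 * k) / (2 ^ (2 * k) * fact k))"

lemma of_real_gauss_moment: "of_real (gauss_moment k) = of_real (sqrt pi) * pochhammer (1/2 :: complex) k"
proof -
  have "pochhammer (1/2 :: complex) k = Gamma (of_nat k + 1/2) / of_real (sqrt pi)"
    by (subst pochhammer_Gamma) (auto simp: Gamma_one_half_complex add.commute elim!: nonpos_Ints_cases simp: complex_eq_iff)
  then have "of_real (sqrt pi) * pochhammer (1/2 :: complex) k = fact (2 * k) * (Gamma (of_nat k + 1/2) / fact (2 * k))"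
    by simp
  then show ?thesis
    unfolding Gamma_half_over_fact by (simp add: gauss_moment_def power_mult)
qed

lemma gauss_even_moment:
  assumes x: "x > 0"
  shows "has_bochner_integral lborel (\<lambda>w. w ^ (2 * k) * exp (- x * w\<^sup>2)) (gauss_moment k / (x ^ k * sqrt x))"
proof -
  have 1: "integrable lborel (\<lambda>w::real. exp (- w\<^sup>2) * w ^ (2 * k))"
    "(\<integral>w. exp (- w\<^sup>2) * w ^ (2 * k) \<partial>lborel) = gauss_moment k"
    using has_bochner_integral_even_function[OF gaussian_moment_even_pos[of k]]
    by (simp_all add: gauss_moment_def has_bochner_integral_iff)
  have sx: "sqrt x ^ (2 * k) = x ^ k" "sqrt x ^ (k * 2) = x ^ k"
    using x by (simp_all add: power_mult mult.commute[of k 2])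
  have eq: "exp (- (0 + sqrt x * w)\<^sup>2) * (0 + sqrt x * w) ^ (2 * k) = x ^ k * (w ^ (2 * k) * exp (- x * w\<^sup>2))" for w
    using x by (simp add: power_mult_distrib sx mult_ac)
  have i: "integrable lborel (\<lambda>w. x ^ k * (w ^ (2 * k) * exp (- x * w\<^sup>2)))"
    using lborel_integrable_real_affine[OF 1(1), of "sqrt x" 0] x
    unfolding eq by simp
  have v: "gauss_moment k = sqrt x * (\<integral>w. x ^ k * (w ^ (2 * k) * exp (- x * w\<^sup>2)) \<partial>lborel)"
    using 1(2) x lborel_integral_real_affine[of "sqrt x" "\<lambda>w. exp (- w\<^sup>2) * w ^ (2 * k)" 0]
    unfolding eq by simp
  have "integrable lborel (\<lambda>w. w ^ (2 * k) * exp (- x * w\<^sup>2))"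
    using integrable_mult_right[OF i, of "inverse (x ^ k)"] x by (simp add: mult.assoc [symmetric])
  moreover have "(\<integral>w. w ^ (2 * k) * exp (- x * w\<^sup>2) \<partial>lborel) = gauss_moment k / (x ^ k * sqrt x)"
    using v x by (simp add: field_simps)
  ultimately show ?thesis by (simp add: has_bochner_integral_iff)
qed

lemma odd_integral_zero:
  fixes f :: "real \<Rightarrow> 'a :: {banach, second_countable_topology}"
  assumes "\<And>w. f (- w) = - f w"
  shows "(LINT w:{-\<delta>..\<delta>}|lborel. f w) = 0"
proof -
  have "(LINT w:{-\<delta>..\<delta>}|lborel. f w) = (\<integral>w. indicator {-\<delta>..\<delta>} (0 + -1 * w) *\<^sub>R f (0 + -1 * w) \<partial>lborel)"
    unfolding set_lebesgue_integral_def by (subst lborel_integral_real_affine[of "-1" _ 0]) simp_all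
  also have "\<dots> = (\<integral>w. - (indicator {-\<delta>..\<delta>} w *\<^sub>R f w) \<partial>lborel)"
    using assms by (intro Bochner_Integration.integral_cong) (auto simp: indicator_def)
  also have "\<dots> = - (LINT w:{-\<delta>..\<delta>}|lborel. f w)"
    unfolding set_lebesgue_integral_def by simp
  finally have "(LINT w:{-\<delta>..\<delta>}|lborel. f w) + (LINT w:{-\<delta>..\<delta>}|lborel. f w) = 0"
    by (simp add: eq_neg_iff_add_eq_0)
  then have "2 *\<^sub>R (LINT w:{-\<delta>..\<delta>}|lborel. f w) = 0" by (simp add: scaleR_2)
  then show ?thesis by simp
qed

text \<open>Outside the interval w^2 is at least \<delta>^2. One unit of x is withheld to keep the
  integral over the line convergent, and the remaining x - 1 produces the exponentially small
  factor.\<close>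

lemma truncated_even_moment:
  assumes x: "x \<ge> 1" and \<delta>: "\<delta> > 0"
  shows "\<bar>(LINT w:{-\<delta>..\<delta>}|lborel. w ^ (2 * k) * exp (- x * w\<^sup>2)) - gauss_moment k / (x ^ k * sqrt x)\<bar>
    \<le> exp (- (x - 1) * \<delta>\<^sup>2) * gauss_moment k"
    and "(LINT w:{-\<delta>..\<delta>}|lborel. w ^ (2 * k) * exp (- x * w\<^sup>2)) \<le> gauss_moment k / (x ^ k * sqrt x)"
proof -
  let ?f = "\<lambda>x w. w ^ (2 * k) * exp (- x * w\<^sup>2) :: real"
  have f0: "?f x w \<ge> 0" for x w by (simp add: power_mult)
  have i: "integrable lborel (?f x)" and v: "(\<integral>w. ?f x w \<partial>lborel) = gauss_moment k / (x ^ k * sqrt x)"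
    using gauss_even_moment[of x k] x by (auto simp: has_bochner_integral_iff)
  have i1: "integrable lborel (?f 1)" and v1: "(\<integral>w. ?f 1 w \<partial>lborel) = gauss_moment k"
    using gauss_even_moment[of 1 k] by (auto simp: has_bochner_integral_iff)
  have iI: "integrable lborel (\<lambda>w. indicator {-\<delta>..\<delta>} w *\<^sub>R ?f x w)"
    by (intro integrable_mult_indicator i) simp
  let ?d = "\<lambda>w. ?f x w - indicator {-\<delta>..\<delta>} w *\<^sub>R ?f x w"
  have d: "gauss_moment k / (x ^ k * sqrt x) - (LINT w:{-\<delta>..\<delta>}|lborel. ?f x w) = (\<integral>w. ?d w \<partial>lborel)"
    unfolding set_lebesgue_integral_def v [symmetric] using i iI by simp
  have d0: "(\<integral>w. ?d w \<partial>lborel) \<ge> 0"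
    by (intro Bochner_Integration.integral_nonneg) (auto simp: indicator_def f0)
  have "(\<integral>w. ?d w \<partial>lborel) \<le> (\<integral>w. exp (- (x - 1) * \<delta>\<^sup>2) * ?f 1 w \<partial>lborel)"
  proof (rule Bochner_Integration.integral_mono)
    fix w :: real
    show "?d w \<le> exp (- (x - 1) * \<delta>\<^sup>2) * ?f 1 w"
    proof (cases "w \<in> {-\<delta>..\<delta>}")
      case True
      then show ?thesis by (simp add: power_mult)
    next
      case False
      then have "\<delta> \<le> \<bar>w\<bar>" by auto
      then have "\<delta>\<^sup>2 \<le> w\<^sup>2" using \<delta> abs_le_square_iff[of \<delta> w] by simp
      then have "(x - 1) * \<delta>\<^sup>2 \<le> (x - 1) * w\<^sup>2" using x by (intro mult_left_mono) auto
      then have "exp (- x * w\<^sup>2) \<le> exp (- (x - 1) * \<delta>\<^sup>2) * exp (- 1 * w\<^sup>2)"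
        by (simp add: algebra_simps flip: exp_add)
      from mult_left_mono[OF this, of "w ^ (2 * k)"] show ?thesis using False by (simp add: power_mult mult_ac)
    qed
  qed (use i iI i1 in auto)
  also have "\<dots> = exp (- (x - 1) * \<delta>\<^sup>2) * gauss_moment k" by (simp only: integral_mult_right_zero v1)
  finally show "\<bar>(LINT w:{-\<delta>..\<delta>}|lborel. ?f x w) - gauss_moment k / (x ^ k * sqrt x)\<bar> \<le> exp (- (x - 1) * \<delta>\<^sup>2) * gauss_moment k"
    "(LINT w:{-\<delta>..\<delta>}|lborel. ?f x w) \<le> gauss_moment k / (x ^ k * sqrt x)"
    using d d0 by linarith+
qed

text \<open>The term of index \<open>N\<close> of the exponential series is a lower bound for its
  sum. The shift \<open>d\<close> allows a fixed share of the exponent to be withheld for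
  convergence.\<close>

lemma exp_decay_bound:
  fixes c d :: real
  assumes c: "c > 0"
  shows "\<exists>C\<ge>0. \<forall>x\<ge>1. exp (- c * (x - d)) \<le> C / x ^ N"
proof (intro exI[of _ "exp (c * d) * fact N / c ^ N"] conjI allI impI)
  show "0 \<le> exp (c * d) * fact N / c ^ N" using c by simp
  fix x :: real assume x: "x \<ge> 1"
  have "(c * x) ^ N / fact N \<le> exp (c * x)"
    unfolding exp_def using c x summable_exp_generic[of "c * x"]
    by (intro order_trans[OF _ sum_le_suminf[of _ "{N}"]]) (auto simp: divide_inverse mult.commute)
  then have "exp (- (c * x)) \<le> fact N / (c * x) ^ N"
    using c x by (simp add: exp_minus field_simps)
  from mult_left_mono[OF this, of "exp (c * d)"]
  have "exp (c * d) * exp (- (c * x)) \<le> exp (c * d) * fact N / c ^ N / x ^ N"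
    by (simp add: power_mult_distrib)
  moreover have "exp (- c * (x - d)) = exp (c * d) * exp (- (c * x))"
    by (simp add: algebra_simps flip: exp_add)
  ultimately show "exp (- c * (x - d)) \<le> exp (c * d) * fact N / c ^ N / x ^ N" by simp
qed

lemma continuous_on_pole_regular: "S \<subseteq> {-tau_radius<..<tau_radius} \<Longrightarrow> continuous_on S (\<lambda>w. pole_regular \<gamma> (of_real w))"
  by (rule continuous_on_compose2[OF holomorphic_on_imp_continuous_on[OF holomorphic_pole_regular]])
     (auto intro!: continuous_intros simp: abs_less_iff subset_iff)

lemma gauss_moment_nonneg: "gauss_moment k \<ge> 0"
  by (simp add: gauss_moment_def)

text \<open>Watson's lemma for the regular part: 2 K Taylor terms are kept, the odd ones integrate
  to zero, the even ones give Gaussian moments up to an exponentially small tail, and the Taylor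
  error is a moment of order 2 K. The constant depends on \<alpha> only through \<open>A\<close>, by
  the uniform Taylor estimate.\<close>

lemma pole_regular_Laplace:
  assumes \<delta>: "0 < \<delta>" "\<delta> \<le> tau_radius / 4"
  shows "\<exists>C\<ge>0. \<forall>x\<ge>1. \<forall>\<alpha>. \<bar>\<alpha>\<bar> \<le> A \<longrightarrow>
    norm ((LINT w:{-\<delta>..\<delta>}|lborel. of_real (exp (- x * w\<^sup>2)) * pole_regular (\<alpha> - real j) (of_real w)) -
      (\<Sum>k<K. g_coeff \<alpha> (2 * k) j * of_real (gauss_moment k / (x ^ k * sqrt x)))) \<le> C / x ^ K"
proof -
  obtain C1 where C1: "C1 \<ge> 0" "\<And>\<alpha> w. \<bar>\<alpha>\<bar> \<le> A \<Longrightarrow> norm w \<le> tau_radius / 4 \<Longrightarrow>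
     norm (pole_regular (\<alpha> - real j) w - (\<Sum>k<2*K. g_coeff \<alpha> k j * w ^ k)) \<le> C1 * norm w ^ (2*K)"
    using pole_regular_Taylor[of A j "2 * K"] by blast
  obtain C2 where C2: "C2 \<ge> 0" "\<And>x. x \<ge> 1 \<Longrightarrow> exp (- \<delta>\<^sup>2 * (x - 1)) \<le> C2 / x ^ K"
    using exp_decay_bound[of "\<delta>\<^sup>2" 1 K] \<delta> by auto
  have "\<exists>G. \<forall>k. G k \<ge> 0 \<and> (\<forall>\<alpha>. \<bar>\<alpha>\<bar> \<le> A \<longrightarrow> norm (g_coeff \<alpha> k j) \<le> G k)"
    using g_coeff_bound[of A _ j] by (intro choice) blast
  then obtain G where G: "\<And>k. G k \<ge> 0" "\<And>k \<alpha>. \<bar>\<alpha>\<bar> \<le> A \<Longrightarrow> norm (g_coeff \<alpha> k j) \<le> G k" by blast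
  define C where "C = C1 * gauss_moment K + (\<Sum>k<K. G (2 * k) * (C2 * gauss_moment k))"
  have "norm ((LINT w:{-\<delta>..\<delta>}|lborel. of_real (exp (- x * w\<^sup>2)) * pole_regular (\<alpha> - real j) (of_real w)) -
      (\<Sum>k<K. g_coeff \<alpha> (2 * k) j * of_real (gauss_moment k / (x ^ k * sqrt x)))) \<le> C / x ^ K"
    if x: "x \<ge> 1" and \<alpha>: "\<bar>\<alpha>\<bar> \<le> A" for x \<alpha>
  proof -
    let ?I = "{-\<delta>..\<delta>}"
    have sub: "?I \<subseteq> {-tau_radius<..<tau_radius}" using \<delta> by auto
    let ?e = "\<lambda>w. complex_of_real (exp (- x * w\<^sup>2))"
    let ?P = "\<lambda>w. pole_regular (\<alpha> - real j) (complex_of_real w)"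
    let ?S = "\<lambda>w. \<Sum>k<2*K. g_coeff \<alpha> k j * complex_of_real w ^ k"
    have iP: "set_integrable lborel ?I (\<lambda>w. ?e w * ?P w)"
      by (intro borel_integrable_atLeastAtMost' continuous_intros continuous_on_pole_regular sub)
    have iS: "set_integrable lborel ?I (\<lambda>w. ?e w * ?S w)"
      by (intro borel_integrable_atLeastAtMost' continuous_intros)
    have m: "(LINT w:?I|lborel. ?e w * ?S w) = (\<Sum>k<K. g_coeff \<alpha> (2 * k) j * of_real (LINT w:?I|lborel. w ^ (2 * k) * exp (- x * w\<^sup>2)))"
    proof -
      have "(LINT w:?I|lborel. ?e w * ?S w) = (\<Sum>k<2*K. LINT w:?I|lborel. g_coeff \<alpha> k j * of_real (w ^ k * exp (- x * w\<^sup>2)))"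
      proof -
        have "?e w * ?S w = (\<Sum>k<2*K. g_coeff \<alpha> k j * of_real (w ^ k * exp (- x * w\<^sup>2)))" for w
          by (simp add: sum_distrib_left mult_ac)
        moreover have "set_integrable lborel ?I (\<lambda>w. g_coeff \<alpha> k j * of_real (w ^ k * exp (- x * w\<^sup>2)))" for k
          by (intro borel_integrable_atLeastAtMost' continuous_intros)
        ultimately show ?thesis
          unfolding set_lebesgue_integral_def set_integrable_def
          by (simp only: scaleR_sum_right) (intro Bochner_Integration.integral_sum)
      qed
      also have "\<dots> = (\<Sum>k<2*K. g_coeff \<alpha> k j * of_real (LINT w:?I|lborel. w ^ k * exp (- x * w\<^sup>2)))"
        by (simp only: set_integral_mult_right set_integral_complex_of_real)
      also have "\<dots> = (\<Sum>k\<in>(\<lambda>k. 2 * k) ` {..<K}. g_coeff \<alpha> k j * of_real (LINT w:?I|lborel. w ^ k * exp (- x * w\<^sup>2)))"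
      proof (rule sum.mono_neutral_right)
        show "\<forall>k\<in>{..<2 * K} - (\<lambda>k. 2 * k) ` {..<K}. g_coeff \<alpha> k j * of_real (LINT w:?I|lborel. w ^ k * exp (- x * w\<^sup>2)) = 0"
        proof
          fix k assume k: "k \<in> {..<2 * K} - (\<lambda>k. 2 * k) ` {..<K}"
          then have "odd k" by (auto elim!: evenE)
          then have "(LINT w:?I|lborel. w ^ k * exp (- x * w\<^sup>2)) = 0"
            by (intro odd_integral_zero) simp
          then show "g_coeff \<alpha> k j * of_real (LINT w:?I|lborel. w ^ k * exp (- x * w\<^sup>2)) = 0" by simp
        qed
      qed auto
      also have "\<dots> = (\<Sum>k<K. g_coeff \<alpha> (2 * k) j * of_real (LINT w:?I|lborel. w ^ (2 * k) * exp (- x * w\<^sup>2)))"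
        by (subst sum.reindex) (auto simp: inj_on_def)
      finally show ?thesis .
    qed
    have 1: "norm ((LINT w:?I|lborel. ?e w * ?P w) - (LINT w:?I|lborel. ?e w * ?S w)) \<le> C1 * gauss_moment K / x ^ K"
    proof -
      have iM: "set_integrable lborel ?I (\<lambda>w. C1 * (w ^ (2 * K) * exp (- x * w\<^sup>2)))"
        by (intro borel_integrable_atLeastAtMost' continuous_intros)
      have "(LINT w:?I|lborel. ?e w * ?P w) - (LINT w:?I|lborel. ?e w * ?S w) = (LINT w:?I|lborel. ?e w * ?P w - ?e w * ?S w)"
        by (rule set_integral_diff(2)[OF iP iS, symmetric])
      also have "norm \<dots> \<le> (LINT w:?I|lborel. C1 * (w ^ (2 * K) * exp (- x * w\<^sup>2)))"
        unfolding set_lebesgue_integral_def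
      proof (rule Bochner_Integration.integral_norm_bound_integral)
        show "integrable lborel (\<lambda>w. indicator ?I w *\<^sub>R (?e w * ?P w - ?e w * ?S w))"
          using set_integral_diff(1)[OF iP iS] by (simp only: set_integrable_def)
        show "integrable lborel (\<lambda>w. indicator ?I w *\<^sub>R (C1 * (w ^ (2 * K) * exp (- x * w\<^sup>2))))"
          using iM by (simp only: set_integrable_def)
        fix w :: real
        show "norm (indicator ?I w *\<^sub>R (?e w * ?P w - ?e w * ?S w)) \<le> indicator ?I w *\<^sub>R (C1 * (w ^ (2 * K) * exp (- x * w\<^sup>2)))"
        proof (cases "w \<in> ?I")
          case True
          then have "norm (complex_of_real w) \<le> tau_radius / 4" using \<delta> by auto
          from C1(2)[OF \<alpha> this] have "norm (?P w - ?S w) \<le> C1 * w ^ (2 * K)"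
            by (simp add: power_even_abs)
          from mult_left_mono[OF this, of "exp (- x * w\<^sup>2)"]
          have "norm (?e w * (?P w - ?S w)) \<le> C1 * (w ^ (2 * K) * exp (- x * w\<^sup>2))"
            unfolding norm_mult by (simp add: mult_ac)
          then show ?thesis using True by (simp only: right_diff_distrib) simp
        qed simp
      qed
      also have "\<dots> = C1 * (LINT w:?I|lborel. w ^ (2 * K) * exp (- x * w\<^sup>2))" by (rule set_integral_mult_right)
      also have "\<dots> \<le> C1 * (gauss_moment K / (x ^ K * sqrt x))"
        using truncated_even_moment(2)[OF x \<delta>(1), of K] C1 by (intro mult_left_mono) auto
      also have "\<dots> \<le> C1 * (gauss_moment K / x ^ K)"
        using x C1 gauss_moment_nonneg[of K] by (intro mult_left_mono divide_left_mono) (auto simp: mult_le_cancel_left1)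
      finally show ?thesis by simp
    qed
    have 2: "norm ((LINT w:?I|lborel. ?e w * ?S w) - (\<Sum>k<K. g_coeff \<alpha> (2 * k) j * of_real (gauss_moment k / (x ^ k * sqrt x))))
      \<le> (\<Sum>k<K. G (2 * k) * (C2 * gauss_moment k)) / x ^ K"
    proof -
      have "(LINT w:?I|lborel. ?e w * ?S w) - (\<Sum>k<K. g_coeff \<alpha> (2 * k) j * of_real (gauss_moment k / (x ^ k * sqrt x)))
         = (\<Sum>k<K. g_coeff \<alpha> (2 * k) j * of_real ((LINT w:?I|lborel. w ^ (2 * k) * exp (- x * w\<^sup>2)) - gauss_moment k / (x ^ k * sqrt x)))"
        unfolding m by (simp only: sum_subtractf [symmetric] right_diff_distrib of_real_diff)
      also have "norm \<dots> \<le> (\<Sum>k<K. G (2 * k) * (C2 * gauss_moment k / x ^ K))"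
      proof (rule sum_norm_le)
        fix k assume "k \<in> {..<K}"
        have "\<bar>(LINT w:?I|lborel. w ^ (2 * k) * exp (- x * w\<^sup>2)) - gauss_moment k / (x ^ k * sqrt x)\<bar> \<le> exp (- (x - 1) * \<delta>\<^sup>2) * gauss_moment k"
          by (rule truncated_even_moment(1)[OF x \<delta>(1)])
        also have "\<dots> = exp (- \<delta>\<^sup>2 * (x - 1)) * gauss_moment k" by (simp add: algebra_simps)
        also have "\<dots> \<le> C2 / x ^ K * gauss_moment k"
          by (intro mult_right_mono C2 x gauss_moment_nonneg)
        finally have "\<bar>(LINT w:?I|lborel. w ^ (2 * k) * exp (- x * w\<^sup>2)) - gauss_moment k / (x ^ k * sqrt x)\<bar> \<le> C2 * gauss_moment k / x ^ K" by simp
        then show "norm (g_coeff \<alpha> (2 * k) j * of_real ((LINT w:?I|lborel. w ^ (2 * k) * exp (- x * w\<^sup>2)) - gauss_moment k / (x ^ k * sqrt x))) \<le> G (2 * k) * (C2 * gauss_moment k / x ^ K)"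
          unfolding norm_mult norm_of_real by (intro mult_mono G \<alpha>) auto
      qed
      finally show ?thesis by (simp add: sum_divide_distrib)
    qed
    have "norm ((LINT w:?I|lborel. ?e w * ?P w) - (\<Sum>k<K. g_coeff \<alpha> (2 * k) j * of_real (gauss_moment k / (x ^ k * sqrt x))))
      \<le> C1 * gauss_moment K / x ^ K + (\<Sum>k<K. G (2 * k) * (C2 * gauss_moment k)) / x ^ K"
      using norm_triangle_mono[OF 1 2] by simp
    then show ?thesis by (simp add: C_def add_divide_distrib)
  qed
  moreover have "C \<ge> 0" unfolding C_def
    by (intro add_nonneg_nonneg mult_nonneg_nonneg sum_nonneg C1 C2 G gauss_moment_nonneg)
  ultimately show ?thesis by blast
qed

section \<open>Regularity of the integrand of the principal value\<close>

lemma Phi_lipschitz: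
  assumes p: "Re p < 1"
  shows "\<exists>L\<ge>0. \<forall>y1 y2. 0 \<le> y1 \<longrightarrow> y1 \<le> y2 \<longrightarrow> y2 \<le> Y \<longrightarrow> norm (Phi p y2 - Phi p y1) \<le> L * (y2 - y1)"
proof -
  obtain N :: nat where "- Re p \<le> real N" using real_arch_simple by blast
  then have N: "Re p + real (Suc N) \<ge> 0" by simp
  define E where "E = (\<lambda>y. Phi p y - (\<Sum>j<Suc N. Phi_coeff p j * of_real y ^ j))"
  obtain C where C: "C \<ge> 0" "\<And>y1 y2. 0 \<le> y1 \<Longrightarrow> y1 \<le> y2 \<Longrightarrow> norm (E y2 - E y1) \<le> C * y2 ^ N * (y2 - y1)"
    using Phi_remainder_lipschitz[OF p N] unfolding E_def by blast
  let ?Q = "\<lambda>z. \<Sum>j<Suc N. Phi_coeff p j * z ^ j" and ?Q' = "\<lambda>z. \<Sum>j<Suc N. Phi_coeff p j * (of_nat j * z ^ (j - 1))"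
  have "compact (?Q' ` cball 0 Y)"
    by (intro compact_continuous_image compact_cball continuous_intros)
  then have "bounded (?Q' ` cball 0 Y)" by (rule compact_imp_bounded)
  then obtain D where D: "D > 0" "\<And>z. z \<in> cball 0 Y \<Longrightarrow> norm (?Q' z) \<le> D" unfolding bounded_pos by blast
  have Q: "norm (?Q u - ?Q v) \<le> D * norm (u - v)" if "u \<in> cball 0 Y" "v \<in> cball 0 Y" for u v
  proof (rule field_differentiable_bound[where f' = ?Q', OF convex_cball])
    show "(?Q has_field_derivative ?Q' z) (at z within cball 0 Y)" for z
      by (auto intro!: derivative_eq_intros sum.cong)
  qed (use that D in auto)
  have "norm (Phi p y2 - Phi p y1) \<le> (C * Y ^ N + D) * (y2 - y1)" if y: "0 \<le> y1" "y1 \<le> y2" "y2 \<le> Y" for y1 y2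
  proof -
    have "norm (E y2 - E y1) \<le> C * Y ^ N * (y2 - y1)"
      using C y by (intro order_trans[OF C(2)] mult_right_mono mult_left_mono power_mono) auto
    moreover have "norm (?Q (of_real y2) - ?Q (of_real y1)) \<le> D * (y2 - y1)"
      using Q[of "of_real y2" "of_real y1"] y by (simp only: of_real_diff [symmetric] norm_of_real) (auto simp: abs_of_nonneg)
    moreover have "Phi p y2 - Phi p y1 = (E y2 - E y1) + (?Q (of_real y2) - ?Q (of_real y1))" by (simp add: E_def)
    ultimately show ?thesis using norm_triangle_mono by (simp only: distrib_right) blast
  qed
  note bound = this
  show ?thesis
  proof (cases "Y \<ge> 0")
    case True
    then have "C * Y ^ N + D \<ge> 0" using C D by (intro add_nonneg_nonneg mult_nonneg_nonneg) auto
    then show ?thesis using bound by blast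
  next
    case False
    then show ?thesis by (intro exI[of _ 0]) auto
  qed
qed

lemma continuous_on_Phi:
  assumes p: "Re p < 1"
  shows "continuous_on {0<..} (Phi p)"
proof (rule continuous_at_imp_continuous_on, rule ballI)
  fix y :: real assume y: "y \<in> {0<..}"
  obtain L where L: "L \<ge> 0" "\<And>y1 y2. 0 \<le> y1 \<Longrightarrow> y1 \<le> y2 \<Longrightarrow> y2 \<le> y + 1 \<Longrightarrow> norm (Phi p y2 - Phi p y1) \<le> L * (y2 - y1)"
    using Phi_lipschitz[OF p, of "y + 1"] by blast
  have "L-lipschitz_on {0..y+1} (Phi p)"
  proof (rule lipschitz_onI[OF _ L(1)])
    fix u v :: real assume "u \<in> {0..y+1}" "v \<in> {0..y+1}"
    then show "dist (Phi p u) (Phi p v) \<le> L * dist u v"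
      using L(2)[of u v] L(2)[of v u] by (cases "u \<le> v") (auto simp: dist_norm norm_minus_commute)
  qed
  then have "continuous_on {0..y+1} (Phi p)" by (rule lipschitz_on_continuous_on)
  then show "isCont (Phi p) y" using y by (intro continuous_on_interior[of "{0..y+1}"]) auto
qed

text \<open>The integrand of the hyperterminant with X = 2 x, without the kernel that carries the
  pole.\<close>

definition stokes_integrand :: "complex \<Rightarrow> real \<Rightarrow> nat \<Rightarrow> real \<Rightarrow> complex" where
  "stokes_integrand p x n t = of_real (t ^ (n - 1) * exp (- (2 * x) * t)) * Phi p (1 / (2 * x * t))"

lemma continuous_on_stokes_integrand:
  assumes "Re p < 1" "x > 0"
  shows "continuous_on {0<..} (stokes_integrand p x n)"
  unfolding stokes_integrand_def using assms
  by (intro continuous_intros continuous_on_compose2[OF continuous_on_Phi]) auto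

text \<open>Here \<open>L\<close> may depend on x and n: it only licenses the passage to the limit
  in \<open>principal_value_limit\<close> and does not enter the asymptotic bounds.\<close>

lemma stokes_integrand_lipschitz:
  assumes p: "Re p < 1" and x: "x \<ge> 1"
  shows "\<exists>L. \<forall>t\<in>{1/2..3/2}. norm (stokes_integrand p x n t - stokes_integrand p x n 1) \<le> L * \<bar>t - 1\<bar>"
proof -
  let ?I = "{1/2..3/2::real}"
  let ?m = "\<lambda>t::real. t ^ (n - 1) * exp (- (2 * x) * t)"
  let ?m' = "\<lambda>t::real. real (n - 1) * t ^ (n - 1 - 1) * exp (- (2 * x) * t) + exp (- (2 * x) * t) * (- (2 * x)) * t ^ (n - 1)"
  have "compact (?m' ` ?I)" by (intro compact_continuous_image compact_Icc continuous_intros)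
  then have "bounded (?m' ` ?I)" by (rule compact_imp_bounded)
  then obtain D where D: "D > 0" "\<And>t. t \<in> ?I \<Longrightarrow> norm (?m' t) \<le> D" unfolding bounded_pos by blast
  have m: "norm (?m t - ?m 1) \<le> D * norm (t - 1)" if "t \<in> ?I" for t
  proof (rule field_differentiable_bound[where S = ?I and f' = ?m'])
    show "(?m has_field_derivative ?m' t) (at t within ?I)" for t
      by (auto intro!: derivative_eq_intros)
  qed (use that D in auto)
  obtain L where L: "L \<ge> 0" "\<And>y1 y2. 0 \<le> y1 \<Longrightarrow> y1 \<le> y2 \<Longrightarrow> y2 \<le> 1 \<Longrightarrow> norm (Phi p y2 - Phi p y1) \<le> L * (y2 - y1)"
    using Phi_lipschitz[OF p, of 1] by blast
  have Phi2: "norm (Phi p u - Phi p v) \<le> L * \<bar>u - v\<bar>" if "u \<in> {0..1}" "v \<in> {0..1}" for u v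
    using L(2)[of u v] L(2)[of v u] that by (cases "u \<le> v") (auto simp: norm_minus_commute)
  have "norm (stokes_integrand p x n t - stokes_integrand p x n 1) \<le> (D * (norm (Phi p 0) + L) + \<bar>?m 1\<bar> * (2 * L)) * \<bar>t - 1\<bar>"
    if t: "t \<in> ?I" for t
  proof -
    have y: "1 / (2 * x * t) \<in> {0..1}" "1 / (2 * x) \<in> {0..1}"
    proof -
      have "1 * 1 \<le> x * (2 * t)" using x t by (intro mult_mono) auto
      then show "1 / (2 * x * t) \<in> {0..1}" "1 / (2 * x) \<in> {0..1}" using x t by (auto simp: divide_le_eq)
    qed
    have "norm (Phi p (1 / (2 * x * t))) \<le> norm (Phi p 0) + L * \<bar>1 / (2 * x * t) - 0\<bar>"
      using Phi2[OF y(1), of 0] norm_triangle_sub[of "Phi p (1 / (2 * x * t))" "Phi p 0"] by simp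
    also have "\<dots> \<le> norm (Phi p 0) + L * 1" using y(1) L(1) by (intro add_left_mono mult_left_mono) auto
    finally have b: "norm (Phi p (1 / (2 * x * t))) \<le> norm (Phi p 0) + L" by simp
    have d: "\<bar>1 / (2 * x * t) - 1 / (2 * x)\<bar> \<le> 2 * \<bar>t - 1\<bar>"
    proof -
      have "1 / (2 * x * t) - 1 / (2 * x) = (1 - t) * (1 / (2 * x * t))" using x t by (simp add: field_simps)
      then have "\<bar>1 / (2 * x * t) - 1 / (2 * x)\<bar> = \<bar>t - 1\<bar> * (1 / (2 * x * t))"
        using y(1) by (simp only: abs_mult abs_minus_commute[of 1]) simp
      also have "\<dots> \<le> \<bar>t - 1\<bar> * 2" using y(1) by (intro mult_left_mono) auto
      finally show ?thesis by simp
    qed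
    have "stokes_integrand p x n t - stokes_integrand p x n 1 =
       of_real (?m t - ?m 1) * Phi p (1 / (2 * x * t)) + of_real (?m 1) * (Phi p (1 / (2 * x * t)) - Phi p (1 / (2 * x)))"
      by (simp add: stokes_integrand_def algebra_simps)
    also have "norm \<dots> \<le> norm (?m t - ?m 1) * norm (Phi p (1 / (2 * x * t))) + \<bar>?m 1\<bar> * norm (Phi p (1 / (2 * x * t)) - Phi p (1 / (2 * x)))"
      by (rule order_trans[OF norm_triangle_ineq]) (simp only: norm_mult norm_of_real real_norm_def)
    also have "\<dots> \<le> (D * norm (t - 1)) * (norm (Phi p 0) + L) + \<bar>?m 1\<bar> * (L * (2 * \<bar>t - 1\<bar>))"
    proof (intro add_mono mult_mono m t b mult_left_mono)
      show "norm (Phi p (1 / (2 * x * t)) - Phi p (1 / (2 * x))) \<le> L * (2 * \<bar>t - 1\<bar>)"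
        using Phi2[OF y] mult_left_mono[OF d L(1)] by linarith
    qed (use D in auto)
    finally show ?thesis by (simp add: algebra_simps)
  qed
  then show ?thesis by blast
qed

text \<open>Only 2 x of the exponent n goes into the phase, whose minimum is then exactly at t = 1;
  the bounded excess stays in the amplitude. Together with t^(-j) from the expansion of
  \<open>Phi\<close> this gives the exponent \<gamma>_j - 1 of the coefficients g_k(j).\<close>

lemma power_exp_eq:
  assumes t: "t > 0" and n: "n > 0" "real n = 2 * x + \<alpha>"
  shows "t ^ (n - 1) * exp (- (2 * x) * t) = exp (- (2 * x)) * exp (- (2 * x) * (t - 1 - ln t)) * t powr (\<alpha> - 1)"
proof -
  have "t ^ (n - 1) = t powr (real n - 1)"
    using t n by (simp add: powr_realpow [symmetric] of_nat_diff)
  also have "\<dots> = exp ((2 * x + \<alpha> - 1) * ln t)" using t n by (simp add: powr_def)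
  finally show ?thesis using t by (simp add: powr_def algebra_simps flip: exp_add)
qed

lemma punctured_integral_bound:
  fixes f :: "real \<Rightarrow> complex"
  assumes \<delta>: "\<delta> > 0" and f: "continuous_on ({-\<delta>..\<delta>} - {0}) f"
    and B: "\<And>w. w \<in> {-\<delta>..\<delta>} - {0} \<Longrightarrow> norm (f w) \<le> B" "B \<ge> 0"
  shows "set_integrable lborel ({-\<delta>..\<delta>} - {0}) f" "norm (LINT w:{-\<delta>..\<delta>} - {0}|lborel. f w) \<le> 2 * \<delta> * B"
proof -
  have c: "set_integrable lborel {-\<delta>..\<delta>} (\<lambda>_. B)"
    by (intro borel_integrable_atLeastAtMost' continuous_intros)
  show i: "set_integrable lborel ({-\<delta>..\<delta>} - {0}) f"
  proof (rule set_integrable_bound[OF set_integrable_subset[OF c]])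
    show "set_borel_measurable lborel ({-\<delta>..\<delta>} - {0}) f"
      unfolding set_borel_measurable_def using borel_measurable_continuous_on_indicator[OF _ f] by simp
    show "AE w in lborel. w \<in> {-\<delta>..\<delta>} - {0} \<longrightarrow> norm (f w) \<le> norm B" using B by (intro AE_I2) auto
  qed auto
  have "norm (LINT w:{-\<delta>..\<delta>} - {0}|lborel. f w) \<le> (LINT w:{-\<delta>..\<delta>}|lborel. B)"
    unfolding set_lebesgue_integral_def
  proof (rule Bochner_Integration.integral_norm_bound_integral[OF i[unfolded set_integrable_def] c[unfolded set_integrable_def]])
    fix w :: real
    show "norm (indicator ({-\<delta>..\<delta>} - {0}) w *\<^sub>R f w) \<le> indicator {-\<delta>..\<delta>} w *\<^sub>R B"
      using B by (cases "w \<in> {-\<delta>..\<delta>} - {0}") (auto simp: indicator_def)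
  qed
  also have "\<dots> = 2 * \<delta> * B" using \<delta> by (simp add: set_integral_const)
  finally show "norm (LINT w:{-\<delta>..\<delta>} - {0}|lborel. f w) \<le> 2 * \<delta> * B" .
qed

text \<open>After removal of exp (- 2 x) the integrand is the sum of three parts. \<open>f1\<close>
  carries the Taylor polynomial of \<open>Phi\<close>: its j-th term is the Gaussian times
  \<open>pole_regular (\<alpha> - real j)\<close>. \<open>er\<close> carries the Taylor error
  \<open>E\<close>, written as an increment of \<open>E\<close> over 1 - tau plus \<open>E\<close>
  at the pole times a regular function, so both pieces are bounded. \<open>f2\<close> compensates
  for \<open>stokes_integrand p x n 1 / of_real w\<close> having no Gaussian factor; it is
  odd.\<close>

lemma near_integral:
  assumes p: "Re p < 1" and N: "Re p + real (Suc N) \<ge> 0" and \<delta>: "0 < \<delta>" "\<delta> \<le> tau_radius / 4"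
  shows "\<exists>C\<ge>0. \<forall>x\<ge>1. \<forall>\<alpha> n. \<bar>\<alpha>\<bar> \<le> A \<longrightarrow> n > 0 \<longrightarrow> real n = 2 * x + \<alpha> \<longrightarrow>
    norm (of_real (exp (2 * x)) * (LINT w:{-\<delta>..\<delta>}|lborel. stokes_integrand p x n (tau_R w) * of_real (dtau_R w / (1 - tau_R w)) + stokes_integrand p x n 1 / of_real w)
      - (\<Sum>j<Suc N. Phi_coeff p j / of_real (2 * x) ^ j * (LINT w:{-\<delta>..\<delta>}|lborel. of_real (exp (- x * w\<^sup>2)) * pole_regular (\<alpha> - real j) (of_real w))))
    \<le> C / x ^ Suc N"
proof -
  define E where "E = (\<lambda>y. Phi p y - (\<Sum>j<Suc N. Phi_coeff p j * of_real y ^ j))"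
  obtain C1 where C1: "C1 \<ge> 0" "\<And>y1 y2. 0 \<le> y1 \<Longrightarrow> y1 \<le> y2 \<Longrightarrow> norm (E y2 - E y1) \<le> C1 * y2 ^ N * (y2 - y1)"
    using Phi_remainder_lipschitz[OF p N] unfolding E_def by blast
  obtain C3 where C3: "C3 \<ge> 0" "\<And>\<alpha> w. \<bar>\<alpha>\<bar> \<le> A \<Longrightarrow> norm w \<le> tau_radius / 4 \<Longrightarrow> norm (pole_regular \<alpha> w) \<le> C3"
    using pole_regular_Taylor[of A 0 0] by auto
  let ?I = "{-\<delta>..\<delta>}" and ?I' = "{-\<delta>..\<delta>} - {0::real}"
  have sub: "?I \<subseteq> {-tau_radius<..<tau_radius}" using \<delta> tau_radius_pos by auto
  have lt: "\<bar>w\<bar> < tau_radius" if "w \<in> ?I" for w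
    using subsetD[OF sub that] by (simp add: abs_less_iff)
  have "compact (dtau_R ` ?I)" by (intro compact_continuous_image compact_Icc continuous_on_dtau_R sub)
  then have "bounded (dtau_R ` ?I)" by (rule compact_imp_bounded)
  then obtain D where D: "D > 0" "\<And>w. w \<in> ?I \<Longrightarrow> norm (dtau_R w) \<le> D" unfolding bounded_pos by blast
  \<comment> \<open>On the interval the logarithm of tau is at most 1 in modulus, so exp (|A| + 1)
    bounds the amplitude; \<open>D\<close> bounds the derivative of tau, \<open>C1\<close> the
    increments of \<open>E\<close>, and \<open>C3\<close> the regular part.\<close>
  define B where "B = exp (\<bar>A\<bar> + 1) * D * C1 + C1 * C3"
  have B0: "B \<ge> 0" using D C1 C3 by (simp add: B_def)
  have E0: "E 0 = 0"
    by (simp add: E_def Phi_0[OF p] Phi_coeff_def power_0_left sum.lessThan_Suc_shift del: sum.lessThan_Suc)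
  have main: "norm (of_real (exp (2 * x)) * (LINT w:?I|lborel. stokes_integrand p x n (tau_R w) * of_real (dtau_R w / (1 - tau_R w)) + stokes_integrand p x n 1 / of_real w)
      - (\<Sum>j<Suc N. Phi_coeff p j / of_real (2 * x) ^ j * (LINT w:?I|lborel. of_real (exp (- x * w\<^sup>2)) * pole_regular (\<alpha> - real j) (of_real w))))
    \<le> 2 * \<delta> * B / x ^ Suc N"
    if x: "x \<ge> 1" and \<alpha>: "\<bar>\<alpha>\<bar> \<le> A" and n: "n > 0" "real n = 2 * x + \<alpha>" for x \<alpha> n
  proof -
    let ?e = "\<lambda>w. complex_of_real (exp (- x * w\<^sup>2))"
    let ?k = "\<lambda>w. dtau_R w / (1 - tau_R w)"
    let ?y = "\<lambda>w. 1 / (2 * x * tau_R w)" and ?y1 = "1 / (2 * x)"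
    let ?P = "\<lambda>j w. pole_regular (\<alpha> - real j) (complex_of_real w)"
    let ?F = "stokes_integrand p x n"
    define er where "er = (\<lambda>w. ?e w * (of_real (tau_R w powr (\<alpha> - 1)) * of_real (?k w) * (E (?y w) - E ?y1) + E ?y1 * pole_regular \<alpha> (of_real w)))"
    define f1 where "f1 = (\<lambda>w. \<Sum>j<Suc N. Phi_coeff p j / of_real (2 * x) ^ j * (?e w * ?P j w))"
    define f2 where "f2 = (\<lambda>w. Phi p ?y1 * of_real ((1 - exp (- x * w\<^sup>2)) / w))"
    have Fw: "?F (tau_R w) = of_real (exp (- (2 * x))) * (?e w * of_real (tau_R w powr (\<alpha> - 1)) * Phi p (?y w))"
      if w: "w \<in> ?I" for w
    proof -
      have "tau_R w > 0" using tau_R_bounds[OF lt[OF w]] by simp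
      moreover have "(2 * x) * (tau_R w - 1 - ln (tau_R w)) = x * w\<^sup>2"
      proof -
        have "tau_R w - 1 - ln (tau_R w) = w\<^sup>2 / 2" using tau_R_eq[OF lt[OF w]] by simp
        then show ?thesis by simp
      qed
      then have "exp (- (2 * x) * (tau_R w - 1 - ln (tau_R w))) = exp (- x * w\<^sup>2)" by (simp only: mult_minus_left)
      ultimately show ?thesis
        unfolding stokes_integrand_def by (simp only: power_exp_eq[OF _ n] of_real_mult mult.assoc)
    qed
    have F1: "?F 1 = of_real (exp (- (2 * x))) * Phi p ?y1"
      by (simp add: stokes_integrand_def)
    have id: "?F (tau_R w) * of_real (?k w) + ?F 1 / of_real w = of_real (exp (- (2 * x))) * (f1 w + er w + f2 w)"
      if w: "w \<in> ?I'" for w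
    proof -
      have w1: "w \<in> ?I" "w \<noteq> 0" using w by auto
      have T: "tau_R w > 0" "tau_R w \<noteq> 1" using tau_R_bounds[OF lt[OF w1(1)]] tau_R_neq_1[OF lt[OF w1(1)] w1(2)] by auto
      have P: "?P j w = of_real (tau_R w powr (\<alpha> - 1)) * of_real (?k w) / of_real (tau_R w) ^ j + 1 / of_real w" for j
      proof -
        have "?P j w = tau (of_real w) powr (of_real (\<alpha> - real j) - 1) / (1 - tau (of_real w)) * deriv tau (of_real w) + 1 / of_real w"
          using w1 lt by (intro pole_regular_eq) auto
        also have "\<dots> = of_real (tau_R w) powr (of_real (\<alpha> - real j - 1)) * of_real (?k w) + 1 / of_real w"
          by (simp add: of_real_tau_R[OF lt[OF w1(1)]] of_real_dtau_R[OF lt[OF w1(1)]])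
        also have "of_real (tau_R w) powr (of_real (\<alpha> - real j - 1)) = complex_of_real (tau_R w powr (\<alpha> - 1 - real j))"
        proof -
          have "\<alpha> - real j - 1 = \<alpha> - 1 - real j" by simp
          then show ?thesis using T by (simp only: powr_of_real less_imp_le)
        qed
        also have "tau_R w powr (\<alpha> - 1 - real j) = tau_R w powr (\<alpha> - 1) / tau_R w ^ j"
          using T by (simp add: powr_diff powr_realpow)
        finally show ?thesis by simp
      qed
      let ?c = "of_real (tau_R w powr (\<alpha> - 1)) * complex_of_real (?k w)"
      have f1w: "f1 w = ?e w * (?c * (Phi p (?y w) - E (?y w)) + (Phi p ?y1 - E ?y1) / of_real w)"
      proof -
        have "f1 w = ?e w * (?c * (\<Sum>j<Suc N. Phi_coeff p j * of_real (?y w) ^ j) + (\<Sum>j<Suc N. Phi_coeff p j * of_real ?y1 ^ j) / of_real w)"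
          unfolding f1_def P using T x
          by (simp add: sum_distrib_left sum_divide_distrib sum.distrib [symmetric] power_divide power_mult_distrib ring_distribs mult_ac
              del: sum.lessThan_Suc)
        then show ?thesis by (simp add: E_def)
      qed
      have "f1 w + er w + f2 w = ?e w * ?c * Phi p (?y w) + Phi p ?y1 / of_real w"
      proof -
        have P0: "pole_regular \<alpha> (of_real w) = ?c + 1 / of_real w" using P[of 0] by simp
        have alg: "e * (c * (A - Ey) + (Q - E1) / d) + e * (c * (Ey - E1) + E1 * (c + 1 / d)) + Q * ((1 - e) / d) = e * c * A + Q / d"
          for e c A Ey Q E1 d :: complex
          by (simp add: algebra_simps diff_divide_distrib)
        have "f2 w = Phi p ?y1 * ((1 - ?e w) / of_real w)" by (simp add: f2_def)
        then show ?thesis unfolding f1w er_def P0 by (simp only: alg)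
      qed
      then show ?thesis unfolding Fw[OF w1(1)] F1 by (simp add: ring_distribs mult_ac)
    qed
    have if1: "set_integrable lborel ?I f1"
      unfolding f1_def by (intro borel_integrable_atLeastAtMost' continuous_intros continuous_on_pole_regular sub) (use x in auto)
    have if1': "set_integrable lborel ?I' f1"
      by (rule set_integrable_subset[OF if1]) auto
    have cT: "continuous_on ?I' tau_R" and cdT: "continuous_on ?I' dtau_R"
      using sub by (intro continuous_on_tau_R continuous_on_dtau_R; blast)+
    have Tb: "1/2 < tau_R w" "tau_R w < 3/2" "tau_R w \<noteq> 1" if "w \<in> ?I'" for w
      using that tau_R_bounds[OF lt] tau_R_neq_1[OF lt] by auto
    have cE: "continuous_on {0<..} E"
      unfolding E_def by (intro continuous_intros continuous_on_Phi p)
    have cEy: "continuous_on ?I' (\<lambda>w. E (?y w))"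
    proof (rule continuous_on_compose2[OF cE])
      show "continuous_on ?I' ?y" using Tb x by (intro continuous_intros cT) fastforce
      show "?y ` ?I' \<subseteq> {0<..}"
      proof
        fix u assume "u \<in> ?y ` ?I'"
        then obtain w where "w \<in> ?I'" "u = ?y w" by blast
        then show "u \<in> {0<..}" using Tb(1)[of w] x by simp
      qed
    qed
    have cer: "continuous_on ?I' er"
    proof -
      have c1: "continuous_on ?I' (\<lambda>w. tau_R w powr (\<alpha> - 1))"
        using Tb by (intro continuous_on_powr cT continuous_intros) fastforce
      have c2: "continuous_on ?I' ?k" using Tb by (intro continuous_intros cT cdT) auto
      have c3: "continuous_on ?I' (\<lambda>w. pole_regular \<alpha> (of_real w))" using sub by (intro continuous_on_pole_regular) auto
      have c4: "continuous_on ?I' (\<lambda>w. exp (- x * w\<^sup>2))" by (intro continuous_intros)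
      show ?thesis unfolding er_def
        by (intro continuous_on_mult continuous_on_add continuous_on_diff continuous_on_of_real continuous_on_const cEy c1 c2 c3 c4)
    qed
    have ber: "norm (er w) \<le> B / x ^ Suc N" if w: "w \<in> ?I'" for w
    proof -
      have w1: "w \<in> ?I" using w by auto
      note T = Tb[OF w]
      have powr_le: "tau_R w powr (\<alpha> - 1) \<le> exp (\<bar>A\<bar> + 1)"
      proof -
        have "ln (tau_R w) \<le> tau_R w - 1" using T by (intro ln_le_minus_one) auto
        moreover have "- ln (tau_R w) \<le> 1"
        proof -
          have "ln (1 / tau_R w) \<le> 1 / tau_R w - 1" using T by (intro ln_le_minus_one) auto
          also have "\<dots> \<le> 1" using T by (simp add: divide_le_eq)
          finally show ?thesis using T by (simp add: ln_div)
        qed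
        ultimately have "\<bar>ln (tau_R w)\<bar> \<le> 1" using T by linarith
        then have "\<bar>(\<alpha> - 1) * ln (tau_R w)\<bar> \<le> (\<bar>A\<bar> + 1) * 1"
          unfolding abs_mult using \<alpha> by (intro mult_mono) auto
        then show ?thesis using T by (simp add: powr_def)
      qed
      have Ediff: "norm (E (?y w) - E ?y1) \<le> C1 / x ^ Suc N * \<bar>1 - tau_R w\<bar>"
      proof -
        have xt: "x \<le> 2 * x * tau_R w" using T x by simp
        have y0: "0 \<le> ?y w" "?y w \<le> 1 / x" using T x xt by (auto intro!: divide_left_mono mult_pos_pos)
        have y1: "0 \<le> ?y1" "?y1 \<le> 1 / x" using x by (auto intro!: divide_left_mono)
        have d: "\<bar>?y w - ?y1\<bar> \<le> \<bar>1 - tau_R w\<bar> * (1 / x)"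
        proof -
          have "?y w - ?y1 = (1 - tau_R w) * ?y w" using x T by (simp add: field_simps)
          then have "\<bar>?y w - ?y1\<bar> = \<bar>1 - tau_R w\<bar> * ?y w" using y0 by (simp only: abs_mult abs_of_nonneg)
          then show ?thesis using y0 by (simp only:) (intro mult_left_mono, auto)
        qed
        have "norm (E (?y w) - E ?y1) \<le> C1 * (1 / x) ^ N * \<bar>?y w - ?y1\<bar>"
        proof (cases "?y w \<le> ?y1")
          case True
          then have "norm (E ?y1 - E (?y w)) \<le> C1 * ?y1 ^ N * (?y1 - ?y w)" using y0 by (intro C1)
          also have "\<dots> \<le> C1 * (1 / x) ^ N * (?y1 - ?y w)" using True y1 C1(1)
            by (intro mult_right_mono mult_left_mono power_mono) auto
          finally show ?thesis using True by (simp only: norm_minus_commute abs_minus_commute[of "?y w"] abs_of_nonneg diff_ge_0_iff_ge)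
        next
          case False
          then have "norm (E (?y w) - E ?y1) \<le> C1 * ?y w ^ N * (?y w - ?y1)" using y1 by (intro C1) auto
          also have "\<dots> \<le> C1 * (1 / x) ^ N * (?y w - ?y1)" using False y0 C1(1)
            by (intro mult_right_mono mult_left_mono power_mono) auto
          finally show ?thesis using False by simp
        qed
        also have "\<dots> \<le> C1 * (1 / x) ^ N * (\<bar>1 - tau_R w\<bar> * (1 / x))"
          using C1(1) x by (intro mult_left_mono d) auto
        finally show ?thesis by (simp add: power_divide mult_ac)
      qed
      have E1: "norm (E ?y1) \<le> C1 / x ^ Suc N"
      proof -
        have "norm (E ?y1 - E 0) \<le> C1 * ?y1 ^ N * (?y1 - 0)" using x by (intro C1) auto
        also have "\<dots> \<le> C1 * (1 / x) ^ N * (1 / x)"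
          using x C1(1) by (intro mult_mono mult_left_mono power_mono) (auto intro!: divide_left_mono)
        finally show ?thesis by (simp add: E0 power_divide mult_ac)
      qed
      have k: "\<bar>?k w\<bar> * \<bar>1 - tau_R w\<bar> \<le> D" using T D(2)[OF w1] by (simp add: abs_divide)
      have "norm (of_real (tau_R w powr (\<alpha> - 1)) * of_real (?k w) * (E (?y w) - E ?y1)) \<le> tau_R w powr (\<alpha> - 1) * \<bar>?k w\<bar> * (C1 / x ^ Suc N * \<bar>1 - tau_R w\<bar>)"
        unfolding norm_mult norm_of_real using Ediff by (simp only: abs_of_nonneg[OF powr_ge_zero]) (intro mult_left_mono, auto)
      also have "\<dots> = tau_R w powr (\<alpha> - 1) * (\<bar>?k w\<bar> * \<bar>1 - tau_R w\<bar>) * (C1 / x ^ Suc N)" by (simp only: mult_ac)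
      also have "\<dots> \<le> exp (\<bar>A\<bar> + 1) * D * (C1 / x ^ Suc N)"
        using C1(1) x by (intro mult_right_mono mult_mono powr_le k) auto
      finally have t1: "norm (of_real (tau_R w powr (\<alpha> - 1)) * of_real (?k w) * (E (?y w) - E ?y1)) \<le> exp (\<bar>A\<bar> + 1) * D * (C1 / x ^ Suc N)" .
      have "norm (complex_of_real w) \<le> tau_radius / 4" using w1 \<delta> by auto
      from C3(2)[OF \<alpha> this] have t2: "norm (E ?y1 * pole_regular \<alpha> (of_real w)) \<le> C1 / x ^ Suc N * C3"
        unfolding norm_mult using E1 C1(1) x by (intro mult_mono) auto
      have "norm (er w) \<le> 1 * (exp (\<bar>A\<bar> + 1) * D * (C1 / x ^ Suc N) + C1 / x ^ Suc N * C3)"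
        unfolding er_def norm_mult[of "?e w"]
      proof (rule mult_mono)
        show "norm (?e w) \<le> 1" using x by simp
        show "norm (of_real (tau_R w powr (\<alpha> - 1)) * of_real (?k w) * (E (?y w) - E ?y1) + E ?y1 * pole_regular \<alpha> (of_real w)) \<le> exp (\<bar>A\<bar> + 1) * D * (C1 / x ^ Suc N) + C1 / x ^ Suc N * C3"
          by (rule norm_triangle_mono[OF t1 t2])
      qed auto
      then show ?thesis by (simp only: B_def add_divide_distrib times_divide_eq_left times_divide_eq_right mult_1_left)
    qed
    have er: "set_integrable lborel ?I' er" "norm (LINT w:?I'|lborel. er w) \<le> 2 * \<delta> * (B / x ^ Suc N)"
      using punctured_integral_bound[OF \<delta>(1) cer ber] B0 x by auto
    have if2': "set_integrable lborel ?I' f2"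
    proof (rule punctured_integral_bound(1)[OF \<delta>(1)])
      show "continuous_on ?I' f2" unfolding f2_def by (intro continuous_intros) auto
      show "0 \<le> norm (Phi p ?y1) * (x * \<delta>)" using x \<delta> by simp
      fix w assume w: "w \<in> ?I'"
      have "1 - exp (- x * w\<^sup>2) \<le> x * w\<^sup>2" using exp_ge_add_one_self[of "- x * w\<^sup>2"] by simp
      moreover have "1 - exp (- x * w\<^sup>2) \<ge> 0" using x by simp
      ultimately have "\<bar>(1 - exp (- x * w\<^sup>2)) / w\<bar> \<le> x * w\<^sup>2 / \<bar>w\<bar>"
        unfolding abs_divide by (intro divide_right_mono) auto
      also have "\<dots> = x * \<bar>w\<bar>" using w by (simp add: power2_eq_square abs_if)
      also have "\<dots> \<le> x * \<delta>" using w x by (intro mult_left_mono) auto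
      finally show "norm (f2 w) \<le> norm (Phi p ?y1) * (x * \<delta>)"
        unfolding f2_def norm_mult norm_of_real by (intro mult_left_mono) auto
    qed
    have rem: "(LINT w:?I|lborel. h w) = (LINT w:?I'|lborel. h w)" for h :: "real \<Rightarrow> complex"
      by (rule set_integral_discrete_difference[of "{0}"]) auto
    \<comment> \<open>Restoring the point 0 gives a symmetric interval, on which the odd function
      \<open>f2\<close> has integral zero.\<close>
    have f20: "(LINT w:?I'|lborel. f2 w) = 0"
      unfolding rem [symmetric] by (rule odd_integral_zero) (simp add: f2_def)
    have "(LINT w:?I|lborel. ?F (tau_R w) * of_real (?k w) + ?F 1 / of_real w) = (LINT w:?I'|lborel. of_real (exp (- (2 * x))) * (f1 w + er w + f2 w))"
      unfolding rem using id by (intro set_lebesgue_integral_cong) auto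
    also have "\<dots> = of_real (exp (- (2 * x))) * (LINT w:?I'|lborel. f1 w + er w + f2 w)"
      by (rule set_integral_mult_right)
    also have "(LINT w:?I'|lborel. f1 w + er w + f2 w) = (LINT w:?I'|lborel. f1 w) + (LINT w:?I'|lborel. er w)"
      using set_integral_add(2)[OF set_integral_add(1)[OF if1' er(1)] if2'] set_integral_add(2)[OF if1' er(1)] f20 by simp
    finally have "of_real (exp (2 * x)) * (LINT w:?I|lborel. ?F (tau_R w) * of_real (?k w) + ?F 1 / of_real w) =
       of_real (exp (2 * x)) * of_real (exp (- (2 * x))) * ((LINT w:?I'|lborel. f1 w) + (LINT w:?I'|lborel. er w))" by simp
    also have "complex_of_real (exp (2 * x)) * of_real (exp (- (2 * x))) = 1"
      by (simp only: of_real_mult [symmetric] exp_add [symmetric]) simp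
    finally have V: "of_real (exp (2 * x)) * (LINT w:?I|lborel. ?F (tau_R w) * of_real (?k w) + ?F 1 / of_real w) =
       (LINT w:?I|lborel. f1 w) + (LINT w:?I'|lborel. er w)" unfolding rem by simp
    have "(LINT w:?I|lborel. f1 w) = (\<Sum>j<Suc N. Phi_coeff p j / of_real (2 * x) ^ j * (LINT w:?I|lborel. ?e w * ?P j w))"
    proof -
      have "set_integrable lborel ?I (\<lambda>w. Phi_coeff p j / of_real (2 * x) ^ j * (?e w * ?P j w))" for j
        by (intro borel_integrable_atLeastAtMost' continuous_intros continuous_on_pole_regular sub) (use x in auto)
      then have "(LINT w:?I|lborel. f1 w) = (\<Sum>j<Suc N. LINT w:?I|lborel. Phi_coeff p j / of_real (2 * x) ^ j * (?e w * ?P j w))"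
        unfolding f1_def set_lebesgue_integral_def set_integrable_def scaleR_sum_right
        by (intro Bochner_Integration.integral_sum)
      then show ?thesis by (simp only: set_integral_mult_right)
    qed
    then show ?thesis unfolding V using er(2) by simp
  qed
  show ?thesis using main B0 \<delta> by (intro exI[of _ "2 * \<delta> * B"]) auto
qed

text \<open>t - 1 - ln t decreases on (0, 1) and increases beyond 1, and it equals \<delta>^2 / 2 at
  both end points tau(- \<delta>) and tau(\<delta>).\<close>

lemma tau_phase_ge:
  assumes \<delta>: "0 < \<delta>" "\<delta> < tau_radius" and t: "t > 0" "t \<notin> {tau_R (-\<delta>)..tau_R \<delta>}"
  shows "\<delta>\<^sup>2 / 2 \<le> t - 1 - ln t"
proof -
  have a: "\<delta>\<^sup>2 / 2 = tau_R (-\<delta>) - ln (tau_R (-\<delta>)) - 1" "0 < tau_R (-\<delta>)" "tau_R (-\<delta>) < 1"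
    using tau_R_eq[of "-\<delta>"] tau_R_bounds[of "-\<delta>"] tau_R_strict_mono[of "-\<delta>" 0] tau_R_0 \<delta> by auto
  have b: "\<delta>\<^sup>2 / 2 = tau_R \<delta> - ln (tau_R \<delta>) - 1" "1 < tau_R \<delta>"
    using tau_R_eq[of \<delta>] tau_R_strict_mono[of 0 \<delta>] tau_R_0 \<delta> by auto
  have mono: "u - ln u \<le> v - ln v" if "u > 0" "v > 0" "1 \<le> u \<and> u \<le> v \<or> v \<le> u \<and> u \<le> 1" for u v :: real
  proof -
    have "ln v - ln u = ln (v / u)" using that by (simp add: ln_div)
    also have "\<dots> \<le> v / u - 1" using that by (intro ln_le_minus_one) auto
    also have "\<dots> = (v - u) / u" using that by (simp add: field_simps)
    also have "\<dots> \<le> v - u"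
      using that(3)
    proof
      assume *: "1 \<le> u \<and> u \<le> v"
      then show ?thesis by (simp add: divide_le_eq mult_le_cancel_left1)
    next
      assume *: "v \<le> u \<and> u \<le> 1"
      have "(u - v) * u \<le> (u - v) * 1" using * by (intro mult_left_mono) auto
      then show ?thesis using that(1) by (simp only: pos_divide_le_eq) (simp add: algebra_simps)
    qed
    finally show ?thesis by simp
  qed
  show ?thesis
  proof (cases "t < 1")
    case True
    then have "t < tau_R (-\<delta>)" using t b by auto
    then show ?thesis using mono[of "tau_R (-\<delta>)" t] a t by auto
  next
    case False
    then have "t > tau_R \<delta>" using t a by auto
    then show ?thesis using mono[of "tau_R \<delta>" t] b t by auto
  qed
qed

text \<open>Off the saddle the phase is at least \<delta>^2 / 2. Of the factor 2 x in the exponent a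
  fixed amount \<open>s\<close> is withheld: the rest gives exponential decay in x, while exp (- s
  t) t^s makes the integral converge at infinity and, at t = 0, against the negative powers coming
  from \<alpha> and from the growth of \<open>Phi\<close>.\<close>

lemma far_integral:
  assumes p: "Re p < 1" and \<delta>: "0 < \<delta>" "\<delta> < tau_radius"
  shows "\<exists>C x1. C \<ge> 0 \<and> x1 \<ge> 1 \<and> (\<forall>x\<ge>x1. \<forall>\<alpha> n. \<bar>\<alpha>\<bar> \<le> real A \<longrightarrow> n > 0 \<longrightarrow> real n = 2 * x + \<alpha> \<longrightarrow>
    set_integrable lborel ({0<..} - {tau_R (-\<delta>)..tau_R \<delta>}) (\<lambda>t. stokes_integrand p x n t / of_real (1 - t)) \<and>
    norm (of_real (exp (2 * x)) * (LINT t:{0<..} - {tau_R (-\<delta>)..tau_R \<delta>}|lborel. stokes_integrand p x n t / of_real (1 - t))) \<le> C / x ^ N)"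
proof -
  let ?S = "{0<..} - {tau_R (-\<delta>)..tau_R \<delta>}"
  obtain N0 CP where CP: "CP \<ge> 0" "\<And>y. y \<ge> 0 \<Longrightarrow> norm (Phi p y) \<le> CP * (1 + y) ^ N0"
    using Phi_growth[OF p] by blast
  have ab: "tau_R (-\<delta>) < 1" "1 < tau_R \<delta>"
    using tau_R_strict_mono[of "-\<delta>" 0] tau_R_strict_mono[of 0 \<delta>] tau_R_0 \<delta> by auto
  define c where "c = min (1 - tau_R (-\<delta>)) (tau_R \<delta> - 1)"
  have c: "c > 0" using ab by (simp add: c_def)
  \<comment> \<open>Chosen so that t^s still leaves one positive power of t after multiplication by
    t^(- A - 1) and t^(- N0). The exponent \<open>q\<close> is the degree of the polynomial in 1 + t
    that then bounds everything.\<close>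
  define s where "s = A + N0 + 2"
  define q where "q = 2 * A + 1 + N0"
  let ?h = "\<lambda>t::real. (1 + t) ^ q * exp (- real s * t)"
  have ih: "set_integrable lborel {0<..} ?h"
  proof -
    have "set_integrable lborel {0<..} (\<lambda>t. complex_of_real (exp (- real s * t) * (1 + t) ^ q) * rpow t (- 0))"
      by (intro set_integrable_power_weight) (auto simp: s_def)
    from integrable_norm[OF this[unfolded set_integrable_def]]
    show ?thesis unfolding set_integrable_def
      by (rule Bochner_Integration.integrable_cong[THEN iffD1, rotated 2])
         (auto simp: indicator_def abs_mult mult_ac norm_mult simp del: of_real_add of_real_power of_real_mult)
  qed
  define H where "H = (LINT t:{0<..}|lborel. ?h t)"
  have H0: "H \<ge> 0" unfolding H_def set_lebesgue_integral_def
    by (intro Bochner_Integration.integral_nonneg) (auto simp: indicator_def)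
  obtain C2 where C2: "C2 \<ge> 0" "\<And>x. x \<ge> 1 \<Longrightarrow> exp (- \<delta>\<^sup>2 * (x - real s / 2)) \<le> C2 / x ^ N"
    using exp_decay_bound[of "\<delta>\<^sup>2" "real s / 2" N] \<delta> by auto
  define K where "K = 2 * CP * exp (real s) / c"
  have K0: "K \<ge> 0" using CP c by (simp add: K_def)
  have bound: "norm (stokes_integrand p x n t / of_real (1 - t)) \<le> exp (- (2 * x)) * (K * exp (- \<delta>\<^sup>2 * (x - real s / 2))) * ?h t"
    if x: "x \<ge> real s" and \<alpha>: "\<bar>\<alpha>\<bar> \<le> real A" and n: "n > 0" "real n = 2 * x + \<alpha>" and t: "t \<in> ?S" for x \<alpha> n t
  proof -
    have t0: "t > 0" using t by simp
    have x1: "x \<ge> 1" using x by (simp add: s_def)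
    have ph: "\<delta>\<^sup>2 / 2 \<le> t - 1 - ln t" using t by (intro tau_phase_ge \<delta>) auto
    have "c \<le> \<bar>1 - t\<bar>"
    proof (cases "t < 1")
      case True
      then have "t < tau_R (-\<delta>)" using t ab by auto
      then show ?thesis using True by (simp add: c_def)
    next
      case False
      then have "t > tau_R \<delta>" using t ab by auto
      then show ?thesis using False by (simp add: c_def)
    qed
    then have k: "1 / \<bar>1 - t\<bar> \<le> 1 / c" using c by (intro divide_left_mono) auto
    have e: "exp (- (2 * x) * (t - 1 - ln t)) \<le> exp (- \<delta>\<^sup>2 * (x - real s / 2)) * (exp (real s) * exp (- real s * t) * t ^ s)"
    proof -
      have "(2 * x - real s) * (\<delta>\<^sup>2 / 2) \<le> (2 * x - real s) * (t - 1 - ln t)" using x by (intro mult_left_mono ph) auto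
      then have "- (2 * x) * (t - 1 - ln t) \<le> - \<delta>\<^sup>2 * (x - real s / 2) + (real s + - real s * t + real s * ln t)"
        by (simp add: field_simps)
      then have "exp (- (2 * x) * (t - 1 - ln t)) \<le> exp (- \<delta>\<^sup>2 * (x - real s / 2) + (real s + - real s * t + real s * ln t))" by simp
      also have "\<dots> = exp (- \<delta>\<^sup>2 * (x - real s / 2)) * (exp (real s) * exp (- real s * t) * t ^ s)"
        using t0 by (simp only: exp_add exp_of_nat_mult exp_ln)
      finally show ?thesis .
    qed
    have pw: "t powr (\<alpha> - 1) \<le> t powr (- real A - 1) + t powr (real A - 1)"
    proof (cases "t \<ge> 1")
      case True
      then have "t powr (\<alpha> - 1) \<le> t powr (real A - 1)" using \<alpha> by (intro powr_mono) auto
      then show ?thesis by (simp add: add_increasing)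
    next
      case False
      then have "t powr (\<alpha> - 1) \<le> t powr (- real A - 1)" using \<alpha> t0 by (intro powr_mono') auto
      then show ?thesis by (simp add: add_increasing2)
    qed
    have Ph: "norm (Phi p (1 / (2 * x * t))) \<le> CP * ((1 + t) ^ N0 / t ^ N0)"
    proof -
      have "norm (Phi p (1 / (2 * x * t))) \<le> CP * (1 + 1 / (2 * x * t)) ^ N0" using x1 t0 by (intro CP) auto
      also have "\<dots> \<le> CP * (1 + 1 / t) ^ N0"
        using x1 t0 CP(1) by (intro mult_left_mono power_mono add_left_mono divide_left_mono) auto
      also have "1 + 1 / t = (1 + t) / t" using t0 by (simp add: field_simps)
      finally show ?thesis by (simp add: power_divide)
    qed
    have poly: "t ^ s * (t powr (- real A - 1) + t powr (real A - 1)) * ((1 + t) ^ N0 / t ^ N0) \<le> 2 * (1 + t) ^ q"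
    proof -
      have comb: "t ^ s * t powr r = t ^ k" if "real s + r = real k" for r k
        using t0 powr_add[of t "real s" r] by (simp only: that powr_realpow)
      have "t ^ s * t powr (- real A - 1) = t ^ (N0 + 1)"
        by (rule comb) (simp add: s_def)
      moreover have "t ^ s * t powr (real A - 1) = t ^ (2 * A + N0 + 1)"
        by (rule comb) (simp add: s_def)
      ultimately have "t ^ s * (t powr (- real A - 1) + t powr (real A - 1)) * ((1 + t) ^ N0 / t ^ N0) = (t ^ (N0 + 1) + t ^ (2 * A + N0 + 1)) / t ^ N0 * (1 + t) ^ N0"
        by (simp only: distrib_left) simp
      also have "(t ^ (N0 + 1) + t ^ (2 * A + N0 + 1)) / t ^ N0 = t + t ^ (2 * A + 1)"
        using t0 by (simp add: power_add field_simps)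
      also have "\<dots> * (1 + t) ^ N0 \<le> ((1 + t) ^ (2 * A + 1) + (1 + t) ^ (2 * A + 1)) * (1 + t) ^ N0"
      proof (intro mult_right_mono add_mono)
        show "t ^ (2 * A + 1) \<le> (1 + t) ^ (2 * A + 1)" using t0 by (intro power_mono) auto
        have "t \<le> (1 + t) ^ 1" by simp
        also have "\<dots> \<le> (1 + t) ^ (2 * A + 1)" using t0 by (intro power_increasing) auto
        finally show "t \<le> (1 + t) ^ (2 * A + 1)" .
      qed (use t0 in auto)
      also have "\<dots> = 2 * (1 + t) ^ q" by (simp add: q_def power_add)
      finally show ?thesis .
    qed
    define d where "d = exp (- \<delta>\<^sup>2 * (x - real s / 2))"
    have d0: "d > 0" by (simp add: d_def)
    have "norm (stokes_integrand p x n t / of_real (1 - t)) = exp (- (2 * x)) * (exp (- (2 * x) * (t - 1 - ln t)) * t powr (\<alpha> - 1)) * norm (Phi p (1 / (2 * x * t))) * (1 / \<bar>1 - t\<bar>)"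
      unfolding stokes_integrand_def power_exp_eq[OF t0 n] norm_divide norm_mult norm_of_real
      using t0 by (simp add: abs_mult)
    also have "\<dots> \<le> exp (- (2 * x)) * ((d * (exp (real s) * exp (- real s * t) * t ^ s)) * (t powr (- real A - 1) + t powr (real A - 1))) * (CP * ((1 + t) ^ N0 / t ^ N0)) * (1 / c)"
      using t0 d0 CP(1) e[folded d_def] pw Ph k
      by (intro mult_mono) (auto intro!: mult_nonneg_nonneg add_nonneg_nonneg divide_nonneg_nonneg)
    also have "\<dots> = exp (- (2 * x)) * d * exp (real s) * exp (- real s * t) * CP / c * (t ^ s * (t powr (- real A - 1) + t powr (real A - 1)) * ((1 + t) ^ N0 / t ^ N0))"
      by (simp only: mult_ac divide_inverse mult_1_left)
    also have "\<dots> \<le> exp (- (2 * x)) * d * exp (real s) * exp (- real s * t) * CP / c * (2 * (1 + t) ^ q)"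
      using d0 CP(1) c by (intro mult_left_mono poly) auto
    also have "\<dots> = exp (- (2 * x)) * (K * d) * ?h t"
      by (simp only: K_def mult_ac divide_inverse)
    finally show ?thesis unfolding d_def .
  qed
  have "set_integrable lborel ?S (\<lambda>t. stokes_integrand p x n t / of_real (1 - t)) \<and>
    norm (of_real (exp (2 * x)) * (LINT t:?S|lborel. stokes_integrand p x n t / of_real (1 - t))) \<le> K * C2 * H / x ^ N"
    if x: "x \<ge> real s" and \<alpha>: "\<bar>\<alpha>\<bar> \<le> real A" and n: "n > 0" "real n = 2 * x + \<alpha>" for x \<alpha> n
  proof
    let ?c = "exp (- (2 * x)) * (K * exp (- \<delta>\<^sup>2 * (x - real s / 2)))"
    have x1: "x \<ge> 1" using x by (simp add: s_def)
    have c0: "?c \<ge> 0" using K0 by simp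
    have ich: "set_integrable lborel {0<..} (\<lambda>t. ?c * ?h t)" by (intro set_integrable_mult_right ih)
    have meas: "(\<lambda>t. stokes_integrand p x n t / of_real (1 - t)) \<in> borel_measurable borel"
      unfolding stokes_integrand_def by measurable
    show i: "set_integrable lborel ?S (\<lambda>t. stokes_integrand p x n t / of_real (1 - t))"
    proof (rule set_integrable_bound[OF set_integrable_subset[OF ich]])
      show "set_borel_measurable lborel ?S (\<lambda>t. stokes_integrand p x n t / of_real (1 - t))"
        unfolding set_borel_measurable_def using meas by measurable
      show "AE t in lborel. t \<in> ?S \<longrightarrow> norm (stokes_integrand p x n t / of_real (1 - t)) \<le> norm (?c * ?h t)"
      proof (intro AE_I2 impI)
        fix t assume "t \<in> ?S"
        from order_trans[OF bound[OF that this] abs_ge_self]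
        show "norm (stokes_integrand p x n t / of_real (1 - t)) \<le> norm (?c * ?h t)"
          unfolding real_norm_def .
      qed
    qed auto
    have "norm (LINT t:?S|lborel. stokes_integrand p x n t / of_real (1 - t)) \<le> (LINT t:{0<..}|lborel. ?c * ?h t)"
      unfolding set_lebesgue_integral_def
    proof (rule Bochner_Integration.integral_norm_bound_integral[OF i[unfolded set_integrable_def] ich[unfolded set_integrable_def]])
      fix t :: real
      show "norm (indicator ?S t *\<^sub>R (stokes_integrand p x n t / of_real (1 - t))) \<le> indicator {0<..} t *\<^sub>R (?c * ?h t)"
      proof (cases "t \<in> ?S")
        case True
        then show ?thesis using bound[OF that True] by simp
      next
        case False
        then have "norm (indicator ?S t *\<^sub>R (stokes_integrand p x n t / of_real (1 - t))) = 0" by simp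
        also have "0 \<le> indicator {0<..} t *\<^sub>R (?c * ?h t)"
          using mult_nonneg_nonneg[OF c0, of "?h t"] by (cases "t > 0") simp_all
        finally show ?thesis .
      qed
    qed
    also have "\<dots> = ?c * H" unfolding H_def by (rule set_integral_mult_right)
    finally have "exp (2 * x) * norm (LINT t:?S|lborel. stokes_integrand p x n t / of_real (1 - t)) \<le> exp (2 * x) * (?c * H)"
      by (rule mult_left_mono) simp
    also have "\<dots> = (exp (2 * x) * exp (- (2 * x))) * (K * exp (- \<delta>\<^sup>2 * (x - real s / 2)) * H)" by (simp only: mult_ac)
    also have "exp (2 * x) * exp (- (2 * x)) = 1" by (simp flip: exp_add)
    also have "1 * (K * exp (- \<delta>\<^sup>2 * (x - real s / 2)) * H) \<le> 1 * (K * (C2 / x ^ N) * H)"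
      using K0 H0 x1 by (intro mult_left_mono mult_right_mono C2) auto
    finally show "norm (of_real (exp (2 * x)) * (LINT t:?S|lborel. stokes_integrand p x n t / of_real (1 - t))) \<le> K * C2 * H / x ^ N"
      by (simp add: norm_mult)
  qed
  moreover have "K * C2 * H \<ge> 0" "real s \<ge> 1" using K0 C2 H0 by (auto simp: s_def)
  ultimately show ?thesis by blast
qed

section \<open>Expansion of the principal value\<close>

text \<open>The closed form that \<open>bessel_series_eq_limit\<close> gives for the principal value
  integral; read backwards it expresses the Bessel function by the truncated series plus this
  remainder.\<close>

definition stokes_remainder :: "complex \<Rightarrow> real \<Rightarrow> nat \<Rightarrow> complex" where
  "stokes_remainder p x n = of_real pi / sin (of_real pi * p) *
      (bessel_series x (1/2 - p) / of_real (exp x / sqrt (2 * pi * x))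
       + cos (of_real pi * p) * (of_real (exp (- (2 * x))) * Phi p (1 / (2 * x)))
       - (\<Sum>k<n. pochhammer p k / fact k * pochhammer (1 - p) k / of_real (2 * x) ^ k))"

text \<open>The regularised integrals converge to \<open>stokes_remainder\<close> by the exact
  identity, and to the near plus the far contribution by \<open>principal_value_limit\<close>.
  Uniqueness of limits equates the two, and the Laplace expansion is inserted into the near
  part.\<close>

lemma stokes_remainder_double_sum:
  assumes p: "p \<notin> \<int>" "Re p < 1" and N: "Re p + real (Suc N) \<ge> 0"
  shows "\<exists>C x1. C \<ge> 0 \<and> x1 \<ge> 1 \<and> (\<forall>x\<ge>x1. \<forall>\<alpha> n. \<bar>\<alpha>\<bar> \<le> real A \<longrightarrow> n > 0 \<longrightarrow> real n = 2 * x + \<alpha> \<longrightarrow>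
    norm (of_real (exp (2 * x)) * stokes_remainder p x n -
      (\<Sum>j<Suc N. Phi_coeff p j / of_real (2 * x) ^ j * (\<Sum>k<Suc N. g_coeff \<alpha> (2 * k) j * of_real (gauss_moment k / (x ^ k * sqrt x))))) \<le> C / x ^ Suc N)"
proof -
  define \<delta> where "\<delta> = tau_radius / 8"
  have \<delta>: "0 < \<delta>" "\<delta> \<le> tau_radius / 4" "\<delta> < tau_radius" using tau_radius_pos by (auto simp: \<delta>_def)
  obtain C1 where C1: "C1 \<ge> 0" "\<And>x \<alpha> n. x \<ge> 1 \<Longrightarrow> \<bar>\<alpha>\<bar> \<le> real A \<Longrightarrow> n > 0 \<Longrightarrow> real n = 2 * x + \<alpha> \<Longrightarrow>
    norm (of_real (exp (2 * x)) * (LINT w:{-\<delta>..\<delta>}|lborel. stokes_integrand p x n (tau_R w) * of_real (dtau_R w / (1 - tau_R w)) + stokes_integrand p x n 1 / of_real w)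
      - (\<Sum>j<Suc N. Phi_coeff p j / of_real (2 * x) ^ j * (LINT w:{-\<delta>..\<delta>}|lborel. of_real (exp (- x * w\<^sup>2)) * pole_regular (\<alpha> - real j) (of_real w))))
    \<le> C1 / x ^ Suc N"
    using near_integral[OF p(2) N \<delta>(1,2), of "real A"] by blast
  let ?S = "{0<..} - {tau_R (-\<delta>)..tau_R \<delta>}"
  obtain C2 x2 where C2: "C2 \<ge> 0" "x2 \<ge> 1" "\<And>x \<alpha> n. x \<ge> x2 \<Longrightarrow> \<bar>\<alpha>\<bar> \<le> real A \<Longrightarrow> n > 0 \<Longrightarrow> real n = 2 * x + \<alpha> \<Longrightarrow>
    set_integrable lborel ?S (\<lambda>t. stokes_integrand p x n t / of_real (1 - t)) \<and>
    norm (of_real (exp (2 * x)) * (LINT t:?S|lborel. stokes_integrand p x n t / of_real (1 - t))) \<le> C2 / x ^ Suc N"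
    using far_integral[OF p(2) \<delta>(1,3), of A "Suc N"] by blast
  have "\<exists>G. \<forall>j. G j \<ge> 0 \<and> (\<forall>x\<ge>1. \<forall>\<alpha>. \<bar>\<alpha>\<bar> \<le> real A \<longrightarrow>
    norm ((LINT w:{-\<delta>..\<delta>}|lborel. of_real (exp (- x * w\<^sup>2)) * pole_regular (\<alpha> - real j) (of_real w)) -
      (\<Sum>k<Suc N. g_coeff \<alpha> (2 * k) j * of_real (gauss_moment k / (x ^ k * sqrt x)))) \<le> G j / x ^ Suc N)"
    using pole_regular_Laplace[OF \<delta>(1,2), of "real A" _ "Suc N"] by (intro choice) blast
  then obtain G where G: "\<And>j. G j \<ge> 0" "\<And>j x \<alpha>. x \<ge> 1 \<Longrightarrow> \<bar>\<alpha>\<bar> \<le> real A \<Longrightarrow>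
    norm ((LINT w:{-\<delta>..\<delta>}|lborel. of_real (exp (- x * w\<^sup>2)) * pole_regular (\<alpha> - real j) (of_real w)) -
      (\<Sum>k<Suc N. g_coeff \<alpha> (2 * k) j * of_real (gauss_moment k / (x ^ k * sqrt x)))) \<le> G j / x ^ Suc N" by blast
  \<comment> \<open>The second entry makes 2 x + \<alpha> exceed |Re p|, so that
    \<open>Re p + real n > 0\<close> and the hyperterminant identity applies.\<close>
  define x1 where "x1 = max x2 (real A + \<bar>Re p\<bar> + 1)"
  define C where "C = C1 + C2 + (\<Sum>j<Suc N. norm (Phi_coeff p j) * G j)"
  have "norm (of_real (exp (2 * x)) * stokes_remainder p x n -
      (\<Sum>j<Suc N. Phi_coeff p j / of_real (2 * x) ^ j * (\<Sum>k<Suc N. g_coeff \<alpha> (2 * k) j * of_real (gauss_moment k / (x ^ k * sqrt x))))) \<le> C / x ^ Suc N"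
    if x: "x \<ge> x1" and \<alpha>: "\<bar>\<alpha>\<bar> \<le> real A" and n: "n > 0" "real n = 2 * x + \<alpha>" for x \<alpha> n
  proof -
    have x1: "x \<ge> 1" "x \<ge> x2" "x \<ge> real A + \<bar>Re p\<bar> + 1" using x C2(2) by (auto simp: x1_def)
    have pn: "Re p + real n > 0" using x1 \<alpha> n by linarith
    let ?F = "stokes_integrand p x n"
    let ?near = "LINT w:{-\<delta>..\<delta>}|lborel. ?F (tau_R w) * of_real (dtau_R w / (1 - tau_R w)) + ?F 1 / of_real w"
    let ?far = "LINT t:?S|lborel. ?F t / of_real (1 - t)"
    have kern: "of_real (t ^ (n - 1) * exp (- (2 * x) * t) * ((1 - t) / ((1 - t)\<^sup>2 + (1 / real (Suc i))\<^sup>2))) * Phi p (1 / (2 * x * t))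
      = of_real (pv_kernel i t) * ?F t" for i t
      unfolding stokes_integrand_def pv_kernel_def by (simp only: of_real_mult mult_ac)
    have lim1: "(\<lambda>i. LINT t:{0<..}|lborel. of_real (pv_kernel i t) * ?F t) \<longlonglongrightarrow> stokes_remainder p x n"
      using bessel_series_eq_limit[OF _ p pn n(1), of x] x1 unfolding kern stokes_remainder_def by simp
    obtain L where L: "\<forall>t\<in>{1/2..3/2}. norm (?F t - ?F 1) \<le> L * \<bar>t - 1\<bar>"
      using stokes_integrand_lipschitz[OF p(2) x1(1)] by blast
    have lim2: "(\<lambda>i. LINT t:{0<..}|lborel. of_real (pv_kernel i t) * ?F t) \<longlonglongrightarrow> ?near + ?far"
    proof (rule principal_value_limit[OF \<delta>(1,3), where L = L])
      show "continuous_on {0<..} ?F" using p x1 by (intro continuous_on_stokes_integrand) auto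
      show "norm (?F t - ?F 1) \<le> L * \<bar>t - 1\<bar>" if "t \<in> {tau_R (-\<delta>)..tau_R \<delta>}" for t
        using L that tau_R_bounds[of "-\<delta>"] tau_R_bounds[of \<delta>] \<delta> by auto
      show "set_integrable lborel {0<..} (\<lambda>t. of_real (pv_kernel i t) * ?F t)" for i
        using Phi_Stieltjes_average(1)[OF p pn n(1), of "2 * x" "1 / real (Suc i)"] x1 unfolding kern by simp
      show "set_integrable lborel ?S (\<lambda>t. ?F t / of_real (1 - t))" using C2(3)[OF x1(2) \<alpha> n] by blast
    qed
    have V: "stokes_remainder p x n = ?near + ?far" by (rule LIMSEQ_unique[OF lim1 lim2])
    let ?I = "\<lambda>j. LINT w:{-\<delta>..\<delta>}|lborel. of_real (exp (- x * w\<^sup>2)) * pole_regular (\<alpha> - real j) (of_real w)"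
    let ?T = "\<lambda>j. \<Sum>k<Suc N. g_coeff \<alpha> (2 * k) j * of_real (gauss_moment k / (x ^ k * sqrt x))"
    let ?c = "\<lambda>j. Phi_coeff p j / of_real (2 * x) ^ j"
    have 1: "norm (of_real (exp (2 * x)) * ?near - (\<Sum>j<Suc N. ?c j * ?I j)) \<le> C1 / x ^ Suc N"
      by (rule C1(2)[OF x1(1) \<alpha> n])
    have 2: "norm (of_real (exp (2 * x)) * ?far) \<le> C2 / x ^ Suc N" using C2(3)[OF x1(2) \<alpha> n] by blast
    have 3: "norm ((\<Sum>j<Suc N. ?c j * ?I j) - (\<Sum>j<Suc N. ?c j * ?T j)) \<le> (\<Sum>j<Suc N. norm (Phi_coeff p j) * G j) / x ^ Suc N"
    proof -
      have eq: "(\<Sum>j<Suc N. ?c j * ?I j) - (\<Sum>j<Suc N. ?c j * ?T j) = (\<Sum>j<Suc N. ?c j * (?I j - ?T j))"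
        by (simp only: sum_subtractf [symmetric] right_diff_distrib)
      have "norm (\<Sum>j<Suc N. ?c j * (?I j - ?T j)) \<le> (\<Sum>j<Suc N. norm (Phi_coeff p j) * (G j / x ^ Suc N))"
      proof (rule sum_norm_le)
        fix j
        have "1 \<le> (2 * x) ^ j" using x1 by (intro one_le_power) auto
        then have "norm (?c j) \<le> norm (Phi_coeff p j)"
          using x1 by (simp add: norm_divide norm_power norm_mult divide_le_eq mult_le_cancel_left1)
        then show "norm (?c j * (?I j - ?T j)) \<le> norm (Phi_coeff p j) * (G j / x ^ Suc N)"
          unfolding norm_mult using G(2)[OF x1(1) \<alpha>, of j] by (intro mult_mono) auto
      qed
      then show ?thesis unfolding eq by (simp only: sum_divide_distrib times_divide_eq_right)
    qed
    have eq: "of_real (exp (2 * x)) * stokes_remainder p x n - (\<Sum>j<Suc N. ?c j * ?T j) =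
       ((of_real (exp (2 * x)) * ?near - (\<Sum>j<Suc N. ?c j * ?I j)) + of_real (exp (2 * x)) * ?far) + ((\<Sum>j<Suc N. ?c j * ?I j) - (\<Sum>j<Suc N. ?c j * ?T j))"
      unfolding V by (simp only: distrib_left) simp
    have "norm (((of_real (exp (2 * x)) * ?near - (\<Sum>j<Suc N. ?c j * ?I j)) + of_real (exp (2 * x)) * ?far) + ((\<Sum>j<Suc N. ?c j * ?I j) - (\<Sum>j<Suc N. ?c j * ?T j))) \<le> (C1 / x ^ Suc N + C2 / x ^ Suc N) + (\<Sum>j<Suc N. norm (Phi_coeff p j) * G j) / x ^ Suc N"
      by (intro norm_triangle_mono 1 2 3)
    then show ?thesis unfolding eq by (simp only: C_def add_divide_distrib)
  qed
  moreover have "C \<ge> 0" unfolding C_def by (intro add_nonneg_nonneg sum_nonneg mult_nonneg_nonneg C1 C2 G norm_ge_zero)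
  moreover have "x1 \<ge> 1" using C2(2) by (simp add: x1_def)
  ultimately show ?thesis by blast
qed

lemma divide_power_mono:
  fixes x :: real
  assumes "C \<ge> 0" "x \<ge> 1" "M \<le> N"
  shows "C / x ^ N \<le> C / x ^ M"
  using assms by (intro divide_left_mono power_increasing) auto

text \<open>The square of indices is cut along the diagonals j + k = n: those below \<open>M\<close>
  form the stated coefficients, the others are of order x^(-M) uniformly in \<alpha>. The number of
  terms kept is raised to \<open>N = max N0 M\<close>, since the estimates for \<open>Phi\<close>
  need \<open>N\<close> large relative to - Re p.\<close>

lemma stokes_remainder_expansion:
  assumes p: "p \<notin> \<int>" "Re p < 1"
  shows "\<exists>C x1. C \<ge> 0 \<and> x1 \<ge> 1 \<and> (\<forall>x\<ge>x1. \<forall>\<alpha> n. \<bar>\<alpha>\<bar> \<le> real A \<longrightarrow> n > 0 \<longrightarrow> real n = 2 * x + \<alpha> \<longrightarrow>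
    norm (of_real (exp (2 * x)) * stokes_remainder p x n -
      of_real (sqrt (pi / x)) * (\<Sum>n<M. (\<Sum>k\<le>n. Phi_coeff p (n - k) / 2 ^ (n - k) * pochhammer (1/2) k * g_coeff \<alpha> (2 * k) (n - k)) / of_real x ^ n))
     \<le> C / x ^ M)"
proof -
  obtain N0 :: nat where "- Re p \<le> real N0" using real_arch_simple by blast
  define N where "N = max N0 M"
  have N: "Re p + real (Suc N) \<ge> 0" "M \<le> Suc N" using \<open>- Re p \<le> real N0\<close> by (auto simp: N_def)
  obtain C1 x1 where C1: "C1 \<ge> 0" "x1 \<ge> 1" "\<And>x \<alpha> n. x \<ge> x1 \<Longrightarrow> \<bar>\<alpha>\<bar> \<le> real A \<Longrightarrow> n > 0 \<Longrightarrow> real n = 2 * x + \<alpha> \<Longrightarrow>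
    norm (of_real (exp (2 * x)) * stokes_remainder p x n -
      (\<Sum>j<Suc N. Phi_coeff p j / of_real (2 * x) ^ j * (\<Sum>k<Suc N. g_coeff \<alpha> (2 * k) j * of_real (gauss_moment k / (x ^ k * sqrt x))))) \<le> C1 / x ^ Suc N"
    using stokes_remainder_double_sum[OF p N(1), of A] by blast
  have "\<forall>k j. \<exists>G. G \<ge> 0 \<and> (\<forall>\<alpha>. \<bar>\<alpha>\<bar> \<le> real A \<longrightarrow> norm (g_coeff \<alpha> k j) \<le> G)"
    using g_coeff_bound by blast
  then obtain G where G: "\<And>k j. G k j \<ge> 0" "\<And>k j \<alpha>. \<bar>\<alpha>\<bar> \<le> real A \<Longrightarrow> norm (g_coeff \<alpha> k j) \<le> G k j"
    by metis
  let ?S = "{..<Suc N} \<times> {..<Suc N} - {(k, j). k + j < M}"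
  define D where "D = (\<Sum>(k, j)\<in>?S. norm (Phi_coeff p j) * G (2 * k) j * gauss_moment k)"
  have D0: "D \<ge> 0" unfolding D_def by (auto intro!: sum_nonneg mult_nonneg_nonneg G gauss_moment_nonneg)
  have "norm (of_real (exp (2 * x)) * stokes_remainder p x n -
      of_real (sqrt (pi / x)) * (\<Sum>n<M. (\<Sum>k\<le>n. Phi_coeff p (n - k) / 2 ^ (n - k) * pochhammer (1/2) k * g_coeff \<alpha> (2 * k) (n - k)) / of_real x ^ n))
     \<le> (C1 + D) / x ^ M"
    if x: "x \<ge> x1" and \<alpha>: "\<bar>\<alpha>\<bar> \<le> real A" and n: "n > 0" "real n = 2 * x + \<alpha>" for x \<alpha> n
  proof -
    have x1: "x \<ge> 1" using x C1(2) by simp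
    define f where "f = (\<lambda>k j. Phi_coeff p j / of_real (2 * x) ^ j * (g_coeff \<alpha> (2 * k) j * of_real (gauss_moment k / (x ^ k * sqrt x))))"
    have s1: "(\<Sum>j<Suc N. Phi_coeff p j / of_real (2 * x) ^ j * (\<Sum>k<Suc N. g_coeff \<alpha> (2 * k) j * of_real (gauss_moment k / (x ^ k * sqrt x)))) = (\<Sum>j<Suc N. \<Sum>k<Suc N. f k j)"
      by (simp only: f_def sum_distrib_left)
    have s2: "(\<Sum>j<Suc N. \<Sum>k<Suc N. f k j) = (\<Sum>(k, j)\<in>{..<Suc N} \<times> {..<Suc N}. f k j)"
      by (subst sum.swap) (rule sum.cartesian_product)
    have s3: "(\<Sum>(k, j)\<in>{..<Suc N} \<times> {..<Suc N}. f k j) = (\<Sum>(k, j)\<in>?S. f k j) + (\<Sum>(k, j)\<in>{(k, j). k + j < M}. f k j)"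
      using N(2) by (intro sum.subset_diff) auto
    have s4: "(\<Sum>(k, j)\<in>{(k, j). k + j < M}. f k j) = (\<Sum>n<M. \<Sum>k\<le>n. f k (n - k))"
      by (rule sum.triangle_reindex)
    have s5: "(\<Sum>n<M. \<Sum>k\<le>n. f k (n - k)) = of_real (sqrt (pi / x)) * (\<Sum>n<M. (\<Sum>k\<le>n. Phi_coeff p (n - k) / 2 ^ (n - k) * pochhammer (1/2) k * g_coeff \<alpha> (2 * k) (n - k)) / of_real x ^ n)"
    proof -
      have "f k (n - k) = of_real (sqrt (pi / x)) * (Phi_coeff p (n - k) / 2 ^ (n - k) * pochhammer (1/2) k * g_coeff \<alpha> (2 * k) (n - k) / of_real x ^ n)"
        if "k \<le> n" for n k
      proof -
      from that have xp: "complex_of_real x ^ n = of_real x ^ (n - k) * of_real x ^ k" by (simp flip: power_add)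
      have "f k (n - k) = Phi_coeff p (n - k) / of_real (2 * x) ^ (n - k) * (g_coeff \<alpha> (2 * k) (n - k) * (of_real (gauss_moment k) / (of_real x ^ k * of_real (sqrt x))))"
        by (simp add: f_def)
      also have "\<dots> = of_real (sqrt (pi / x)) * (Phi_coeff p (n - k) / 2 ^ (n - k) * pochhammer (1/2) k * g_coeff \<alpha> (2 * k) (n - k) / of_real x ^ n)"
        unfolding of_real_gauss_moment xp using x1 by (simp add: real_sqrt_divide power_mult_distrib field_simps)
      finally show ?thesis .
      qed
      then have "(\<Sum>n<M. \<Sum>k\<le>n. f k (n - k)) = (\<Sum>n<M. \<Sum>k\<le>n. of_real (sqrt (pi / x)) * (Phi_coeff p (n - k) / 2 ^ (n - k) * pochhammer (1/2) k * g_coeff \<alpha> (2 * k) (n - k) / of_real x ^ n))"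
        by (intro sum.cong refl) simp
      then show ?thesis by (simp only: sum_distrib_left sum_divide_distrib)
    qed
    have split: "(\<Sum>j<Suc N. Phi_coeff p j / of_real (2 * x) ^ j * (\<Sum>k<Suc N. g_coeff \<alpha> (2 * k) j * of_real (gauss_moment k / (x ^ k * sqrt x)))) =
      (\<Sum>(k, j)\<in>?S. f k j) + of_real (sqrt (pi / x)) * (\<Sum>n<M. (\<Sum>k\<le>n. Phi_coeff p (n - k) / 2 ^ (n - k) * pochhammer (1/2) k * g_coeff \<alpha> (2 * k) (n - k)) / of_real x ^ n)"
      unfolding s1 s2 s3 s4 s5 ..
    have "norm (\<Sum>(k, j)\<in>?S. f k j) \<le> (\<Sum>(k, j)\<in>?S. norm (Phi_coeff p j) * G (2 * k) j * gauss_moment k / x ^ M)"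
    proof (rule sum_norm_le)
      fix z assume "z \<in> ?S"
      then obtain k j where z: "z = (k, j)" and kj: "M \<le> j + k" by auto
      have "norm (f k j) = norm (Phi_coeff p j) * norm (g_coeff \<alpha> (2 * k) j) * gauss_moment k / (2 ^ j * x ^ (j + k) * sqrt x)"
        using x1 gauss_moment_nonneg[of k] by (simp add: f_def norm_mult norm_divide norm_power power_mult_distrib power_add mult_ac)
      also have "\<dots> \<le> norm (Phi_coeff p j) * G (2 * k) j * gauss_moment k / x ^ M"
      proof (rule frac_le)
        show "norm (Phi_coeff p j) * norm (g_coeff \<alpha> (2 * k) j) * gauss_moment k \<le> norm (Phi_coeff p j) * G (2 * k) j * gauss_moment k"
          by (intro mult_right_mono mult_left_mono G \<alpha> gauss_moment_nonneg) auto
        show "0 \<le> norm (Phi_coeff p j) * G (2 * k) j * gauss_moment k"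
          by (intro mult_nonneg_nonneg G gauss_moment_nonneg) auto
        have "1 * x ^ M * 1 \<le> 2 ^ j * x ^ (j + k) * sqrt x"
          using x1 kj by (intro mult_mono power_increasing) auto
        then show "x ^ M \<le> 2 ^ j * x ^ (j + k) * sqrt x" by simp
      qed (use x1 in auto)
      finally show "norm (case z of (k, j) \<Rightarrow> f k j) \<le> (case z of (k, j) \<Rightarrow> norm (Phi_coeff p j) * G (2 * k) j * gauss_moment k / x ^ M)"
        unfolding z prod.case .
    qed
    also have "\<dots> = D / x ^ M" by (simp add: D_def sum_divide_distrib case_prod_unfold)
    finally have S: "norm (\<Sum>(k, j)\<in>?S. f k j) \<le> D / x ^ M" .
    have T: "norm (of_real (exp (2 * x)) * stokes_remainder p x n - ((\<Sum>(k, j)\<in>?S. f k j) + of_real (sqrt (pi / x)) * (\<Sum>n<M. (\<Sum>k\<le>n. Phi_coeff p (n - k) / 2 ^ (n - k) * pochhammer (1/2) k * g_coeff \<alpha> (2 * k) (n - k)) / of_real x ^ n))) \<le> C1 / x ^ M"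
      using C1(3)[OF x \<alpha> n] divide_power_mono[OF C1(1) x1 N(2)] unfolding split by linarith
    have eq: "a - c = (a - (b + c)) + b" for a b c :: complex by simp
    show ?thesis
      unfolding add_divide_distrib by (subst eq[of _ _ "\<Sum>(k, j)\<in>?S. f k j"]) (rule norm_triangle_mono[OF T S])
  qed
  moreover have "C1 + D \<ge> 0" using C1 D0 by simp
  ultimately show ?thesis using C1(2) by blast
qed

text \<open>The increment estimate between 0 and 1 / (2 x) requires enough Taylor terms for the
  given \<open>Re p\<close>; the surplus terms from \<open>M\<close> on are themselves of order
  x^(-M).\<close>

lemma Phi_expansion:
  assumes p: "Re p < 1"
  shows "\<exists>C\<ge>0. \<forall>x\<ge>1. norm (Phi p (1 / (2 * x)) - (\<Sum>k<M. Phi_coeff p k / of_real (2 * x) ^ k)) \<le> C / x ^ M"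
proof -
  obtain N0 :: nat where "- Re p \<le> real N0" using real_arch_simple by blast
  define N where "N = max N0 M"
  have N: "Re p + real (Suc N) \<ge> 0" "M \<le> Suc N" using \<open>- Re p \<le> real N0\<close> by (auto simp: N_def)
  define E where "E = (\<lambda>y. Phi p y - (\<Sum>j<Suc N. Phi_coeff p j * of_real y ^ j))"
  obtain C where C: "C \<ge> 0" "\<And>y1 y2. 0 \<le> y1 \<Longrightarrow> y1 \<le> y2 \<Longrightarrow> norm (E y2 - E y1) \<le> C * y2 ^ N * (y2 - y1)"
    using Phi_remainder_lipschitz[OF p N(1)] unfolding E_def by blast
  have E0: "E 0 = 0"
    by (simp add: E_def Phi_0[OF p] Phi_coeff_def power_0_left sum.lessThan_Suc_shift del: sum.lessThan_Suc)
  define D where "D = C + (\<Sum>k\<in>{M..<Suc N}. norm (Phi_coeff p k))"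
  have "norm (Phi p (1 / (2 * x)) - (\<Sum>k<M. Phi_coeff p k / of_real (2 * x) ^ k)) \<le> D / x ^ M" if x: "x \<ge> 1" for x
  proof -
    let ?y = "1 / (2 * x)"
    have t: "norm (Phi_coeff p k * of_real ?y ^ k) \<le> norm (Phi_coeff p k) / x ^ k" for k
    proof -
      have "(1 / (2 * x)) ^ k \<le> (1 / x) ^ k" using x by (intro power_mono divide_left_mono) auto
      from mult_left_mono[OF this, of "norm (Phi_coeff p k)"] show ?thesis
        using x by (simp add: norm_mult norm_power norm_divide power_divide)
    qed
    have "norm (E ?y - E 0) \<le> C * ?y ^ N * (?y - 0)" using x by (intro C) auto
    also have "\<dots> \<le> C * (1 / x) ^ N * (1 / x)"
      using x C(1) by (intro mult_mono mult_left_mono power_mono) (auto intro!: divide_left_mono)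
    also have "\<dots> = C / x ^ Suc N" by (simp add: power_divide)
    also have "\<dots> \<le> C / x ^ M" by (rule divide_power_mono[OF C(1) x N(2)])
    finally have 1: "norm (E ?y) \<le> C / x ^ M" by (simp add: E0)
    have 2: "norm (\<Sum>k\<in>{M..<Suc N}. Phi_coeff p k * of_real ?y ^ k) \<le> (\<Sum>k\<in>{M..<Suc N}. norm (Phi_coeff p k)) / x ^ M"
      unfolding sum_divide_distrib
    proof (rule sum_norm_le)
      fix k assume "k \<in> {M..<Suc N}"
      then show "norm (Phi_coeff p k * of_real ?y ^ k) \<le> norm (Phi_coeff p k) / x ^ M"
        using order_trans[OF t divide_power_mono[OF norm_ge_zero x]] by simp
    qed
    have "(\<Sum>k<Suc N. Phi_coeff p k * of_real ?y ^ k) = (\<Sum>k<M. Phi_coeff p k * of_real ?y ^ k) + (\<Sum>k\<in>{M..<Suc N}. Phi_coeff p k * of_real ?y ^ k)"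
      using sum.atLeastLessThan_concat[of 0 M "Suc N" "\<lambda>k. Phi_coeff p k * of_real ?y ^ k"] N(2) by (simp only: lessThan_atLeast0 le0)
    moreover have "(\<Sum>k<M. Phi_coeff p k / of_real (2 * x) ^ k) = (\<Sum>k<M. Phi_coeff p k * of_real ?y ^ k)"
      by (intro sum.cong refl) (simp add: power_divide)
    ultimately have "Phi p ?y - (\<Sum>k<M. Phi_coeff p k / of_real (2 * x) ^ k) = E ?y + (\<Sum>k\<in>{M..<Suc N}. Phi_coeff p k * of_real ?y ^ k)"
      by (simp only: E_def) simp
    then show ?thesis using norm_triangle_mono[OF 1 2] by (simp add: D_def add_divide_distrib)
  qed
  moreover have "D \<ge> 0" using C(1) by (auto simp: D_def intro!: add_nonneg_nonneg sum_nonneg)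
  ultimately show ?thesis by blast
qed

text \<open>One formula covers both cases. If Re \<nu> > - 1/2, then p = 1/2 - \<nu> and pi \<theta>
  = pi p - pi, so - cos (pi p) is already cos (pi \<theta>). Otherwise p = 1/2 + \<nu> and pi
  \<theta> = - pi p; the expansion is that of order - \<nu>, and the connection formula adds 2 cos
  (pi p), which turns - cos (pi p) into cos (pi p) = cos (pi \<theta>). The sine relation is the
  same in both.\<close>

lemma bessel_series_stokes:
  fixes \<nu> :: complex
  assumes \<nu>: "\<nu> - 1/2 \<notin> \<int>" and \<theta>: "\<theta> = - \<nu> - 1/2"
  obtains p where "p \<notin> \<int>" "Re p < 1" "p = 1/2 - \<nu> \<or> p = 1/2 + \<nu>" "sin (of_real pi * p) = - sin (of_real pi * \<theta>)"
    "\<And>x n. x > 0 \<Longrightarrow> bessel_series x \<nu> = of_real (exp x / sqrt (2 * pi * x)) *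
      ((\<Sum>k<n. pochhammer p k / fact k * pochhammer (1 - p) k / of_real (2 * x) ^ k)
       + cos (of_real pi * \<theta>) * (of_real (exp (- (2 * x))) * Phi p (1 / (2 * x)))
       + sin (of_real pi * p) / of_real pi * stokes_remainder p x n)"
proof -
  have sin0: "sin (of_real pi * p) \<noteq> 0" if "p \<notin> \<int>" for p :: complex
  proof
    assume "sin (of_real pi * p) = 0"
    then obtain k :: int where "of_real pi * p = of_real (of_int k * pi)"
      unfolding sin_eq_0 by (auto simp: mult_ac)
    then have "p = of_int k" by (simp add: field_simps)
    then show False using that by simp
  qed
  have rem: "bessel_series x (1/2 - p) = of_real (exp x / sqrt (2 * pi * x)) *
      ((\<Sum>k<n. pochhammer p k / fact k * pochhammer (1 - p) k / of_real (2 * x) ^ k)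
       - cos (of_real pi * p) * (of_real (exp (- (2 * x))) * Phi p (1 / (2 * x)))
       + sin (of_real pi * p) / of_real pi * stokes_remainder p x n)"
    if "p \<notin> \<int>" "x > 0" for p x n
  proof -
    define E where "E = complex_of_real (exp x / sqrt (2 * pi * x))"
    have E: "E \<noteq> 0" using that by (simp add: E_def)
    \<comment> \<open>Solves the definition of \<open>stokes_remainder\<close> for the Bessel
      function; this needs sin (pi p) to be nonzero, where the exclusion of half-integer orders
      enters.\<close>
    have aux: "b = E * (S - c + s / q * (q / s * (b / E + c - S)))" if "s \<noteq> 0" "q \<noteq> 0" for b S c s q
      using that E by (simp add: field_simps)
    show ?thesis unfolding stokes_remainder_def E_def [symmetric] using sin0[OF that(1)] by (intro aux) auto
  qed
  show ?thesis
  proof (cases "Re \<nu> > - 1/2")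
    case True
    define p where "p = 1/2 - \<nu>"
    have pZ: "p \<notin> \<int>" using \<nu> Ints_minus[of p] by (auto simp: p_def)
    have th: "of_real pi * \<theta> = of_real pi * p - of_real pi"
      by (simp add: p_def \<theta> algebra_simps)
    have tr: "sin (of_real pi * \<theta>) = - sin (of_real pi * p)" "cos (of_real pi * \<theta>) = - cos (of_real pi * p)"
      unfolding th by (simp_all add: sin_diff cos_diff)
    have "1/2 - p = \<nu>" by (simp add: p_def)
    then show ?thesis using rem[OF pZ] tr pZ True
      by (intro that[of p]) (auto simp: p_def)
  next
    case False
    define p where "p = 1/2 + \<nu>"
    have pZ: "p \<notin> \<int>" using \<nu> Ints_diff[of p 1] by (auto simp: p_def)
    have p1: "Re p < 1" using False by (simp add: p_def)
    have th: "of_real pi * \<theta> = - (of_real pi * p)"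
      by (simp add: p_def \<theta> algebra_simps)
    have tr: "sin (of_real pi * \<theta>) = - sin (of_real pi * p)" "cos (of_real pi * \<theta>) = cos (of_real pi * p)"
      unfolding th by simp_all
    have "bessel_series x \<nu> = of_real (exp x / sqrt (2 * pi * x)) *
      ((\<Sum>k<n. pochhammer p k / fact k * pochhammer (1 - p) k / of_real (2 * x) ^ k)
       + cos (of_real pi * \<theta>) * (of_real (exp (- (2 * x))) * Phi p (1 / (2 * x)))
       + sin (of_real pi * p) / of_real pi * stokes_remainder p x n)" if x: "x > 0" for x n
    proof -
      have "p - 1/2 = \<nu>" by (simp add: p_def)
      then have "bessel_series x \<nu> = bessel_series x (1/2 - p) + of_real (exp x / sqrt (2 * pi * x)) * (2 * cos (of_real pi * p) * (of_real (exp (- (2 * x))) * Phi p (1 / (2 * x))))"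
        using bessel_connection[OF x p1] by (simp add: algebra_simps)
      also note rem[OF pZ x, of n]
      finally show ?thesis unfolding tr by (simp add: algebra_simps)
    qed
    then show ?thesis using tr pZ p1 by (intro that[of p]) (auto simp: p_def)
  qed
qed

theorem theorem3:
  fixes \<nu> \<theta> :: complex and M :: nat and m :: "real \<Rightarrow> nat"
  assumes "\<nu> - 1/2 \<notin> \<int>"
    and "\<theta> = - \<nu> - 1/2"
    and "M > 0"
    and "\<And>x. x > 0 \<Longrightarrow> m x > 0"
    and "(\<lambda>x. real (m x) - 2 * x) \<in> O[at_top](\<lambda>_. 1)"
  shows "\<exists>R :: real \<Rightarrow> complex.
    R \<in> O[at_top](\<lambda>x. 1 / of_real x ^ M) \<and>
    (\<forall>x>0.
       exp (- of_real pi * \<nu> * \<i>) * besselI \<nu> (of_real x * exp (of_real pi * \<i>)) =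
         of_real (exp x / sqrt (2 * pi * x)) *
           (\<Sum>k<m x. (-1) ^ k * a_coeff \<nu> k / of_real x ^ k) +
         of_real (exp (- x) / sqrt (2 * pi * x)) *
           (cos (of_real pi * \<theta>) * (\<Sum>k<M. a_coeff \<nu> k / of_real x ^ k)
            - sin (of_real pi * \<theta>) / of_real (sqrt (pi * x)) *
                (\<Sum>j<M. (-1) ^ j * B_coeff \<nu> (real (m x) - 2 * x) j / of_real (2 * x) ^ j)
            + R x))"
proof -
  obtain p where p: "p \<notin> \<int>" "Re p < 1" "p = 1/2 - \<nu> \<or> p = 1/2 + \<nu>" "sin (of_real pi * p) = - sin (of_real pi * \<theta>)"
    and bes: "\<And>x n. x > 0 \<Longrightarrow> bessel_series x \<nu> = of_real (exp x / sqrt (2 * pi * x)) *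
      ((\<Sum>k<n. pochhammer p k / fact k * pochhammer (1 - p) k / of_real (2 * x) ^ k)
       + cos (of_real pi * \<theta>) * (of_real (exp (- (2 * x))) * Phi p (1 / (2 * x)))
       + sin (of_real pi * p) / of_real pi * stokes_remainder p x n)"
    by (rule bessel_series_stokes[OF assms(1,2)]) (rule that)
  obtain c where c: "c > 0" "\<forall>\<^sub>F x in at_top. norm (real (m x) - 2 * x) \<le> c * norm (1::real)"
    by (rule landau_o.bigE[OF assms(5)])
  \<comment> \<open>The boundedness of \<open>m x - 2 * x\<close> is used only in this form: one
    \<open>A\<close> fixed for all large x, with estimates uniform over |\<alpha>| <= A.\<close>
  obtain A :: nat where A: "c \<le> real A" using real_arch_simple by blast
  have poch: "pochhammer p k * pochhammer (1 - p) k = pochhammer (1/2 - \<nu>) k * pochhammer (1/2 + \<nu>) k" for k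
    using p(3) by (auto simp: mult.commute)
  have Pa: "Phi_coeff p k / 2 ^ k = a_coeff \<nu> k" for k
    using poch[of k] by (simp add: Phi_coeff_def a_coeff_def mult_ac)
  have PA: "Phi_coeff p k = (-1) ^ k * A_coeff \<nu> k" for k
    using poch[of k] by (simp add: Phi_coeff_def A_coeff_def mult.assoc)
  have sgn: "(-1) ^ k * (-1) ^ k = (1 :: complex)" for k by (simp flip: power_mult_distrib)
  have dom: "(\<Sum>k<n. pochhammer p k / fact k * pochhammer (1 - p) k / of_real (2 * x) ^ k) = (\<Sum>k<n. (-1) ^ k * a_coeff \<nu> k / of_real x ^ k)" for x n
  proof (intro sum.cong refl)
    fix k
    have "(-1) ^ k * a_coeff \<nu> k = (-1) ^ k * (-1) ^ k * (pochhammer p k * pochhammer (1 - p) k) / (2 ^ k * fact k)"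
      unfolding poch by (simp add: a_coeff_def mult_ac)
    then have "(-1) ^ k * a_coeff \<nu> k = pochhammer p k * pochhammer (1 - p) k / (2 ^ k * fact k)" unfolding sgn by simp
    then show "pochhammer p k / fact k * pochhammer (1 - p) k / of_real (2 * x) ^ k = (-1) ^ k * a_coeff \<nu> k / of_real x ^ k"
      by (simp add: power_mult_distrib mult_ac)
  qed
  have sub: "(\<Sum>k<M. Phi_coeff p k / of_real (2 * x) ^ k) = (\<Sum>k<M. a_coeff \<nu> k / of_real x ^ k)" for x
    by (intro sum.cong refl) (simp add: Pa [symmetric] power_mult_distrib)
  \<comment> \<open>The powers of -2 in B_j arise from writing x^n as (2 x)^n / 2^n and collecting
    signs: (-1)^n (-2)^k / 2^n = (-1)^(n - k) / 2^(n - k).\<close>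
  have Bc: "(\<Sum>k\<le>n. Phi_coeff p (n - k) / 2 ^ (n - k) * pochhammer (1/2) k * g_coeff \<alpha> (2 * k) (n - k)) / of_real x ^ n = (-1) ^ n * B_coeff \<nu> \<alpha> n / of_real (2 * x) ^ n" for n \<alpha> x
  proof -
    have "(-1) ^ n * ((-2) ^ k * pochhammer (1/2) k * A_coeff \<nu> (n - k) * g_coeff \<alpha> (2 * k) (n - k)) / 2 ^ n =
      Phi_coeff p (n - k) / 2 ^ (n - k) * pochhammer (1/2) k * g_coeff \<alpha> (2 * k) (n - k)" if k: "k \<le> n" for k
    proof -
      have n: "n = (n - k) + k" using k by simp
      have "(-1) ^ n * (-2) ^ k / 2 ^ n = (-1) ^ (n - k) / (2 ^ (n - k) :: complex)"
      proof -
        have "(-1) ^ n * (-2) ^ k = (-1) ^ (n - k) * ((-1) ^ k * (-1) ^ k) * (2 ^ k :: complex)"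
          by (subst n) (simp only: power_add power_minus[of 2] mult_ac)
        moreover have "2 ^ n = (2 ^ (n - k) * 2 ^ k :: complex)" by (subst n) (simp only: power_add)
        ultimately show ?thesis unfolding sgn by simp
      qed
      then have "(-1) ^ n * ((-2) ^ k * pochhammer (1/2) k * A_coeff \<nu> (n - k) * g_coeff \<alpha> (2 * k) (n - k)) / 2 ^ n =
         (-1) ^ (n - k) / 2 ^ (n - k) * (pochhammer (1/2) k * A_coeff \<nu> (n - k) * g_coeff \<alpha> (2 * k) (n - k))"
        by (simp add: mult.assoc [symmetric] flip: times_divide_eq_left)
      then show ?thesis unfolding PA by simp
    qed
    then have "(-1) ^ n * B_coeff \<nu> \<alpha> n / 2 ^ n = (\<Sum>k\<le>n. Phi_coeff p (n - k) / 2 ^ (n - k) * pochhammer (1/2) k * g_coeff \<alpha> (2 * k) (n - k))"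
      unfolding B_coeff_def sum_distrib_left sum_divide_distrib by (intro sum.cong refl) simp
    then show ?thesis by (simp add: power_mult_distrib flip: divide_divide_eq_left)
  qed
  define \<alpha> where "\<alpha> = (\<lambda>x. real (m x) - 2 * x)"
  define SB where "SB = (\<lambda>x. \<Sum>j<M. (-1) ^ j * B_coeff \<nu> (\<alpha> x) j / of_real (2 * x) ^ j)"
  define SA where "SA = (\<lambda>x. \<Sum>k<M. a_coeff \<nu> k / complex_of_real x ^ k)"
  \<comment> \<open>The sum of the two expansion errors, the second rescaled by exp (2 x). With this
    \<open>R\<close> the stated identity is exact for every x > 0; only the size of \<open>R\<close>
    is asymptotic.\<close>
  define R where "R = (\<lambda>x. cos (of_real pi * \<theta>) * (Phi p (1 / (2 * x)) - SA x)
     + sin (of_real pi * p) / of_real pi * (of_real (exp (2 * x)) * stokes_remainder p x (m x) - of_real (sqrt (pi / x)) * SB x))"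
  obtain C1 where C1: "C1 \<ge> 0" "\<And>x. x \<ge> 1 \<Longrightarrow> norm (Phi p (1 / (2 * x)) - (\<Sum>k<M. a_coeff \<nu> k / of_real x ^ k)) \<le> C1 / x ^ M"
    using Phi_expansion[OF p(2), of M, unfolded sub] by blast
  obtain C2 x2 where C2: "C2 \<ge> 0" "x2 \<ge> 1" "\<And>x \<alpha> n. x \<ge> x2 \<Longrightarrow> \<bar>\<alpha>\<bar> \<le> real A \<Longrightarrow> n > 0 \<Longrightarrow> real n = 2 * x + \<alpha> \<Longrightarrow>
    norm (of_real (exp (2 * x)) * stokes_remainder p x n - of_real (sqrt (pi / x)) * (\<Sum>n<M. (-1) ^ n * B_coeff \<nu> \<alpha> n / of_real (2 * x) ^ n)) \<le> C2 / x ^ M"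
    using stokes_remainder_expansion[OF p(1,2), of A M, unfolded Bc] by blast
  have "R \<in> O[at_top](\<lambda>x. 1 / of_real x ^ M)"
  proof (rule landau_o.bigI[of "norm (cos (of_real pi * \<theta>)) * C1 + norm (sin (of_real pi * p) / of_real pi) * C2 + 1"])
    show "0 < norm (cos (of_real pi * \<theta>)) * C1 + norm (sin (of_real pi * p) / of_real pi) * C2 + 1"
      using C1(1) C2(1) by (intro add_nonneg_pos add_nonneg_nonneg mult_nonneg_nonneg) auto
    have "\<forall>\<^sub>F x in at_top. x \<ge> x2" by (rule eventually_ge_at_top)
    with c(2) show "\<forall>\<^sub>F x in at_top. norm (R x) \<le> (norm (cos (of_real pi * \<theta>)) * C1 + norm (sin (of_real pi * p) / of_real pi) * C2 + 1) * norm (1 / complex_of_real x ^ M)"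
    proof eventually_elim
      case (elim x)
      have x: "x \<ge> 1" using elim(2) C2(2) by simp
      have al: "\<bar>\<alpha> x\<bar> \<le> real A" "real (m x) = 2 * x + \<alpha> x" using elim(1) A by (auto simp: \<alpha>_def)
      have mx: "m x > 0" using assms(4) x by simp
      let ?a = "norm (cos (of_real pi * \<theta>))" and ?b = "norm (sin (of_real pi * p) / of_real pi)"
      have S: "norm (Phi p (1 / (2 * x)) - SA x) \<le> C1 / x ^ M" unfolding SA_def by (rule C1(2)[OF x])
      have T: "norm (of_real (exp (2 * x)) * stokes_remainder p x (m x) - of_real (sqrt (pi / x)) * SB x) \<le> C2 / x ^ M"
        unfolding SB_def by (rule C2(3)[OF elim(2) al(1) mx al(2)])
      have le: "norm (R x) \<le> ?a * (C1 / x ^ M) + ?b * (C2 / x ^ M)"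
        unfolding R_def by (intro norm_triangle_mono, unfold norm_mult) (intro mult_left_mono S T norm_ge_zero)+
      have le': "?a * (C1 / x ^ M) + ?b * (C2 / x ^ M) \<le> (?a * C1 + ?b * C2 + 1) * (1 / x ^ M)"
        using x by (simp add: add_divide_distrib)
      have eq: "norm (1 / complex_of_real x ^ M) = 1 / x ^ M" using x by (simp add: norm_divide norm_power)
      show ?case unfolding eq by (rule order_trans[OF le le'])
    qed
  qed
  moreover have "exp (- of_real pi * \<nu> * \<i>) * besselI \<nu> (of_real x * exp (of_real pi * \<i>)) =
         of_real (exp x / sqrt (2 * pi * x)) * (\<Sum>k<m x. (-1) ^ k * a_coeff \<nu> k / of_real x ^ k) +
         of_real (exp (- x) / sqrt (2 * pi * x)) *
           (cos (of_real pi * \<theta>) * SA x - sin (of_real pi * \<theta>) / of_real (sqrt (pi * x)) * SB x + R x)"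
    if x: "x > 0" for x
  proof -
    let ?E = "complex_of_real (exp x / sqrt (2 * pi * x))"
    let ?D = "\<Sum>k<m x. (-1) ^ k * a_coeff \<nu> k / complex_of_real x ^ k"
    let ?V = "stokes_remainder p x (m x)"
    have e: "of_real (exp (- x) / sqrt (2 * pi * x)) = ?E * of_real (exp (- (2 * x)))"
    proof -
      have "exp (- x) = exp x * exp (- (2 * x))" by (simp flip: exp_add)
      then have "exp (- x) / sqrt (2 * pi * x) = exp x / sqrt (2 * pi * x) * exp (- (2 * x))" by simp
      then show ?thesis by (simp only: of_real_mult)
    qed
    have one: "complex_of_real (exp (- (2 * x))) * of_real (exp (2 * x)) = 1"
      by (simp only: of_real_mult [symmetric] exp_add [symmetric]) simp
    \<comment> \<open>The Gaussian contributes sqrt (pi / x) and the reflection constant 1 / pi;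
      their product is 1 / sqrt (pi x).\<close>
    have s: "sin (of_real pi * \<theta>) / of_real (sqrt (pi * x)) = - (sin (of_real pi * p) / of_real pi * of_real (sqrt (pi / x)))"
    proof -
      have "1 / sqrt (pi * x) = sqrt (pi / x) / pi"
        using x by (simp add: real_sqrt_mult real_sqrt_divide field_simps)
      from arg_cong[OF this, of complex_of_real]
      have "1 / complex_of_real (sqrt (pi * x)) = of_real (sqrt (pi / x)) / of_real pi"
        by (simp only: of_real_divide of_real_1)
      moreover have "sin (of_real pi * \<theta>) = - sin (of_real pi * p)" using p(4) by simp
      ultimately show ?thesis by (simp add: divide_inverse mult_ac)
    qed
    have e1: "cos (of_real pi * \<theta>) * SA x - sin (of_real pi * \<theta>) / of_real (sqrt (pi * x)) * SB x + R x =
      cos (of_real pi * \<theta>) * Phi p (1 / (2 * x)) + sin (of_real pi * p) / of_real pi * (of_real (exp (2 * x)) * ?V)"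
      unfolding s R_def by (simp add: algebra_simps)
    have e2: "E * d + E * a * (c * f + b * (g * V)) = E * (d + c * (a * f) + b * V)" if "a * g = 1" for E d a c f b g V :: complex
      using that by algebra
    have "bessel_series x \<nu> = exp (- of_real pi * \<nu> * \<i>) * besselI \<nu> (of_real x * exp (of_real pi * \<i>))"
      by (simp only: besselI_at_negative_real[OF x] bessel_series_def)
    then show ?thesis
      unfolding e1 e e2[OF one] using bes[OF x, of "m x"] by (simp only: dom)
  qed
  ultimately show ?thesis
    unfolding SA_def SB_def \<alpha>_def by (intro exI[of _ R] conjI allI impI)
qed

end
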